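(* Let $q:\mathbb{R}^{2n}\to\mathbb{C}$ be a quadratic form such that $\mathbf{K}=\exp H_q$ is strictly positive, let $Q=q^w(x,D_x)$, and let $e^{-iQ}$ be the evolution operator defined in the context. Then the spectrum of $\overline{\mathbf{K}}^{-1}\mathbf{K}$ (where $\overline{\mathbf{K}}$ is the entrywise complex conjugate matrix) can be written as $\{\mu_j,\mu_j^{-1}\}_{j=1}^n$ with $\mu_j\in(0,1)$ repeated according to algebraic multiplicity, and \[ \|e^{-iQ}\|_{\mathcal{L}(L^2(\mathbb{R}^n))}=\prod_{j=1}^n\mu_j^{1/4}. \]
   Context: Points of $\mathbb{C}^{2n}$ are written $\mathbf{z}=(x,\xi)$, and $\sigma((x_1,\xi_1),(x_2,\xi_2))=\xi_1\cdot x_2-\xi_2\cdot x_1$ (complex bilinear, no conjugation). A complex linear map $\mathbf{K}$ of $\mathbb{C}^{2n}$ is canonical if $\sigma(\mathbf{K}\mathbf{z},\mathbf{K}\mathbf{w})=\sigma(\mathbf{z},\mathbf{w})$ for all $\mathbf{z},\mathbf{w}$; it is strictly positive if it is canonical and $i\big(\sigma(\overline{\mathbf{K}\mathbf{z}},\mathbf{K}\mathbf{z})-\sigma(\overline{\mathbf{z}},\mathbf{z})\big)>0$ for all $\mathbf{z}\in\mathbb{C}^{2n}\setminus\{0\}$. For a quadratic form $q$ (extended holomorphically to $\mathbb{C}^{2n}$), its Hamilton map is the matrix $H_q=\begin{pmatrix} q''_{\xi x} & q''_{\xi\xi}\\ -q''_{xx} & -q''_{x\xi}\end{pmatrix}$,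 i.e. the linear vector field $\partial_\xi q\,\partial_x-\partial_x q\,\partial_\xi$; $\exp H_q$ is canonical. Weyl quantization: $a^w(x,D_x)u(x)=\operatorname{Op}^w(a)u(x)=(2\pi)^{-n}\iint e^{i(x-y)\cdot\xi}a(\tfrac{x+y}{2},\xi)u(y)\,dy\,d\xi$, with $D_x=-i\partial_x$. Definition of the evolution: a quadratic form $q$ on $\mathbb{R}^{2n}$ is supersymmetric if $q(x,\xi)=B(\xi-G_+x)\cdot(\xi-G_-x)$ with $B\in\mathbb{C}^{n\times n}$ and $G_\pm$ complex symmetric with $\pm\operatorname{Im}G_\pm$ positive definite; it is known that if $\exp H_q$ is strictly positive then $q$ is supersymmetric. For supersymmetric $q$ there are a complex linear canonical transformation $\mathbf{T}$, a strictly convex real quadratic weight $\Phi$ on $\mathbb{C}^n$, a matrix $M\in\mathbb{C}^{n\times n}$, and a unitary FBI–Bargmann transform $\mathfrak{T}:L^2(\mathbb{R}^n)\to H_\Phi=\operatorname{Hol}(\mathbb{C}^n)\cap L^2(e^{-2\Phi}d\operatorname{Re}x\,d\operatorname{Im}x)$ (an integral operator with quadratic phase) such that $\mathfrak{T}a^w\mathfrak{T}^*=(a\circ\mathbf{T}^{-1})^w$ and $q\circ\mathbf{T}^{-1}(x,\xi)=Mx\cdot i\xi$. With $Q=q^w$, one defines $e^{-iQ}=\mathfrak{T}^*e^{-i\tilde Q}\mathfrak{T}$, where $e^{-i\tilde Q}u(x)=e^{-\frac i2\operatorname{tr}M}u(e^{-iM}x)$ on the maximal domain $\{u\in H_\Phi: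 u(e^{-iM}\cdot)\in H_\Phi\}$. *)

theory Defs
  imports "HOL-Analysis.Analysis" "HOL-Computational_Algebra.Polynomial"
begin

text \<open>Phase space C^{2n} is modelled as complex^('n + 'n): the component Inl i is x_i,
  the component Inr i is xi_i.\<close>

type_synonym 'n phase = "complex ^ ('n + 'n)"
type_synonym 'n pmat = "complex ^ ('n + 'n) ^ ('n + 'n)"

definition xpart :: "('n::finite) phase \<Rightarrow> complex ^ ('n::finite)" where
  "xpart z = (\<chi> i. z $ Inl i)"

definition xipart :: "('n::finite) phase \<Rightarrow> complex ^ ('n::finite)" where
  "xipart z = (\<chi> i. z $ Inr i)"

definition mkpt :: "complex ^ ('n::finite) \<Rightarrow> complex ^ ('n::finite) \<Rightarrow> ('n::finite) phase" where
  "mkpt x \<xi> = (\<chi> k. case k of Inl i \<Rightarrow> x $ i | Inr i \<Rightarrow> \<xi> $ i)"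

definition cdot :: "complex ^ ('n::finite) \<Rightarrow> complex ^ ('n::finite) \<Rightarrow> complex" where
  "cdot a b = (\<Sum>i\<in>UNIV. a $ i * b $ i)"

definition symp :: "('n::finite) phase \<Rightarrow> ('n::finite) phase \<Rightarrow> complex" where
  "symp z w = cdot (xipart z) (xpart w) - cdot (xipart w) (xpart z)"

definition cnj_vec :: "complex ^ ('m::finite) \<Rightarrow> complex ^ ('m::finite)" where
  "cnj_vec z = (\<chi> i. cnj (z $ i))"

definition cnj_mat :: "complex ^ ('m::finite) ^ 'k \<Rightarrow> complex ^ ('m::finite) ^ 'k" where
  "cnj_mat A = (\<chi> i j. cnj (A $ i $ j))"

definition canonical :: "('n::finite) pmat \<Rightarrow> bool" where
  "canonical K \<longleftrightarrow> (\<forall>z w. symp (K *v z) (K *v w) = symp z w)"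

text \<open>The quantity i(sigma(conj(Kz),Kz) - sigma(conj z, z)) is automatically real; we
  require its real part to be positive.\<close>
definition strictly_positive :: "('n::finite) pmat \<Rightarrow> bool" where
  "strictly_positive K \<longleftrightarrow> canonical K \<and>
     (\<forall>z. z \<noteq> 0 \<longrightarrow>
        Re (\<i> * (symp (cnj_vec (K *v z)) (K *v z) - symp (cnj_vec z) z)) > 0)"

definition qform :: "complex ^ ('m::finite) ^ 'm \<Rightarrow> complex ^ ('m::finite) \<Rightarrow> complex" where
  "qform A z = (\<Sum>i\<in>UNIV. \<Sum>j\<in>UNIV. A $ i $ j * z $ i * z $ j)"

definition symmetric_mat :: "'a ^ ('m::finite) ^ ('m::finite) \<Rightarrow> bool" where
  "symmetric_mat A \<longleftrightarrow> transpose A = A"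

text \<open>Hamilton map of q(z) = z.Az: the Hessian is q'' = 2A, and
  H_q = [[q''_{xi x}, q''_{xi xi}], [-q''_{xx}, -q''_{x xi}]].\<close>
definition hamilton_map :: "('n::finite) pmat \<Rightarrow> ('n::finite) pmat" where
  "hamilton_map A = (\<chi> k l. case k of
       Inl i \<Rightarrow> 2 * A $ Inr i $ l
     | Inr i \<Rightarrow> - 2 * A $ Inl i $ l)"

definition matpow :: "'a::semiring_1 ^ ('m::finite) ^ ('m::finite) \<Rightarrow> nat \<Rightarrow> 'a ^ ('m::finite) ^ ('m::finite)" where
  "matpow A k = ((\<lambda>B. B ** A) ^^ k) (mat 1)"

definition mexp :: "complex ^ ('m::finite) ^ 'm \<Rightarrow> complex ^ ('m::finite) ^ 'm" where
  "mexp A = (\<Sum>k. (inverse (fact k) :: real) *\<^sub>R matpow A k)"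

definition charpoly :: "complex ^ ('m::finite) ^ 'm \<Rightarrow> complex poly" where
  "charpoly A = det (\<chi> i j. (if i = j then [:0, 1:] else 0) - [:A $ i $ j:])"

definition holo :: "(complex ^ ('n::finite) \<Rightarrow> complex) \<Rightarrow> bool" where
  "holo f \<longleftrightarrow> (\<forall>z. \<exists>L. (f has_derivative L) (at z) \<and>
                     (\<forall>c w. L (c *s w) = c * L w))"

definition L2 :: "(real ^ ('n::finite) \<Rightarrow> complex) set" where
  "L2 = {u. u \<in> borel_measurable lborel \<and> integrable lborel (\<lambda>y. (norm (u y))\<^sup>2)}"

definition L2norm :: "(real ^ ('n::finite) \<Rightarrow> complex) \<Rightarrow> real" where
  "L2norm u = sqrt (integral\<^sup>L lborel (\<lambda>y. (norm (u y))\<^sup>2))"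

text \<open>H_Phi = Hol(C^n) \<inter> L^2(e^{-2 Phi} dRe x dIm x); lborel on complex^'n is the Lebesgue
  measure d Re x d Im x.\<close>
definition HPhi :: "(complex ^ ('n::finite) \<Rightarrow> real) \<Rightarrow> (complex ^ ('n::finite) \<Rightarrow> complex) set" where
  "HPhi \<Phi> = {u. holo u \<and> integrable lborel (\<lambda>x. (norm (u x))\<^sup>2 * exp (- 2 * \<Phi> x))}"

definition HPhinorm :: "(complex ^ ('n::finite) \<Rightarrow> real) \<Rightarrow> (complex ^ ('n::finite) \<Rightarrow> complex) \<Rightarrow> real" where
  "HPhinorm \<Phi> u = sqrt (integral\<^sup>L lborel (\<lambda>x. (norm (u x))\<^sup>2 * exp (- 2 * \<Phi> x)))"

definition cvec_of :: "real ^ ('n::finite) \<Rightarrow> complex ^ ('n::finite)" where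
  "cvec_of y = (\<chi> i. complex_of_real (y $ i))"

definition fbi :: "complex \<Rightarrow> ('n::finite) pmat \<Rightarrow> (real ^ ('n::finite) \<Rightarrow> complex) \<Rightarrow> complex ^ ('n::finite) \<Rightarrow> complex" where
  "fbi c P u x = c * integral\<^sup>L lborel (\<lambda>y. exp (\<i> * qform P (mkpt x (cvec_of y))) * u y)"

text \<open>Admissible phase: Im phi''_{yy} > 0 and det phi''_{xy} \<noteq> 0.\<close>
definition fbi_phase :: "('n::finite) pmat \<Rightarrow> bool" where
  "fbi_phase P \<longleftrightarrow> symmetric_mat P \<and>
     (\<forall>y::real^'n. y \<noteq> 0 \<longrightarrow> Im (qform P (mkpt 0 (cvec_of y))) > 0) \<and>
     det (\<chi> i j. P $ Inl i $ Inr j) \<noteq> 0"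

definition phase_dx :: "('n::finite) pmat \<Rightarrow> complex ^ ('n::finite) \<Rightarrow> complex ^ ('n::finite) \<Rightarrow> complex ^ ('n::finite)" where
  "phase_dx P x y = (\<chi> i. 2 * (\<Sum>k\<in>UNIV. P $ Inl i $ k * mkpt x y $ k))"

definition phase_dy :: "('n::finite) pmat \<Rightarrow> complex ^ ('n::finite) \<Rightarrow> complex ^ ('n::finite) \<Rightarrow> complex ^ ('n::finite)" where
  "phase_dy P x y = (\<chi> i. 2 * (\<Sum>k\<in>UNIV. P $ Inr i $ k * mkpt x y $ k))"

definition fbi_canon :: "('n::finite) pmat \<Rightarrow> ('n::finite) pmat \<Rightarrow> bool" where
  "fbi_canon P T \<longleftrightarrow> (\<forall>x y. T *v mkpt y (- phase_dy P x y) = mkpt x (phase_dx P x y))"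

definition fbi_weight :: "('n::finite) pmat \<Rightarrow> complex ^ ('n::finite) \<Rightarrow> real" where
  "fbi_weight P x = (SUP y::real^'n. - Im (qform P (mkpt x (cvec_of y))))"

definition model_evol :: "complex ^ ('n::finite) ^ 'n \<Rightarrow> (complex ^ ('n::finite) \<Rightarrow> complex) \<Rightarrow> complex ^ ('n::finite) \<Rightarrow> complex" where
  "model_evol M u x = exp (- \<i> / 2 * trace M) * u (mexp (\<chi> i j. - \<i> * M $ i $ j) *v x)"

text \<open>e^{-iQ} = T^* e^{-iQ~} T; T^* is the inverse of the unitary T on H_Phi.\<close>
definition evol :: "complex \<Rightarrow> ('n::finite) pmat \<Rightarrow> complex ^ ('n::finite) ^ 'n \<Rightarrow> (real ^ ('n::finite) \<Rightarrow> complex) \<Rightarrow> (real ^ ('n::finite) \<Rightarrow> complex)" where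
  "evol c P M u = (SOME w. w \<in> L2 \<and> fbi c P w = model_evol M (fbi c P u))"

definition evol_dom :: "complex \<Rightarrow> ('n::finite) pmat \<Rightarrow> complex ^ ('n::finite) ^ 'n \<Rightarrow> (real ^ ('n::finite) \<Rightarrow> complex) set" where
  "evol_dom c P M = {u \<in> L2. model_evol M (fbi c P u) \<in> HPhi (fbi_weight P)}"

definition has_L2_opnorm :: "((real ^ ('n::finite) \<Rightarrow> complex) \<Rightarrow> (real ^ ('n::finite) \<Rightarrow> complex)) \<Rightarrow> real \<Rightarrow> bool" where
  "has_L2_opnorm E C \<longleftrightarrow> (\<forall>u\<in>L2. L2norm (E u) \<le> C * L2norm u) \<and>
      (\<forall>C'<C. \<exists>u\<in>L2. L2norm (E u) > C' * L2norm u)"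

end

theory Submission
  imports Defs "HOL-Complex_Analysis.Complex_Analysis"
begin

text \<open>Conjugated by the FBI transform, the evolution is v(x) \<mapsto> exp(-(i/2) tr M) v(F x) on the
  weighted space, with F = exp(-iM) and G the inverse of F. Its squared norm is therefore, up to the
  factor |det G|, the best constant in the inequality between the integrals of |v|^2 exp(-2 \<Phi>(G x))
  and |v|^2 exp(-2 \<Phi>(x)), and strict positivity of K amounts to 2 \<Phi>(G x) > 2 \<Phi>(x).
  Dividing v by a holomorphic Gaussian subtracts the same pluriharmonic form Re (x . b x) from both
  exponents. Choose b to maximize the ratio of the determinants of the two shifted forms: criticality
  says that their inverses differ by a positive Hermitian matrix D. Hence one weight is the other one
  convolved with a rotation invariant Gaussian, and the mean value property gives the best constant,
  with equality for constant functions, that is for v a holomorphic Gaussian.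
  Diagonalizing the Hermitian parts S, S1 of the two inverses simultaneously, S u = s S1 u with s > 1,
  produces eigenvectors of the quotient of K by its conjugate for the eigenvalues s and, by
  conjugation, 1/s; the same s give the ratio of the two Gaussian integrals.\<close>

section \<open>Block matrices, pairings and real quadratic forms\<close>

text \<open>Pointwise comparison of the two weights only gives the constant 1, since both forms
  vanish at the origin; it ignores that \<open>v\<close> is holomorphic. Holomorphy enters through
  the freedom to multiply by exp(x . b x / 2) and through the mean value property. The latter needs
  an averaging kernel invariant under t \<mapsto> exp(i a) t, and this is why the inverses of the
  shifted forms must differ by a purely Hermitian matrix. The quantity maximized over
  \<open>b\<close> has a meaning: Gaussian integrals are inverse square roots of determinants, so
  the ratio of determinants is the square of the quotient of the two weighted integrals of |exp(x .
  b x / 2)|^2. Thus \<open>b\<close> is the best holomorphic Gaussian. The maximum is found on a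
  compact set that includes degenerate forms; at these the determinant in the numerator vanishes, so
  the maximum is interior and criticality is available. The exponent 1/4 collects two square roots:
  one from the Gaussian integral, one from passing from squared norms to norms. The Gaussian ratio
  also contains |det F|, which cancels the |det G| left by the change of variables.\<close>

declare transpose_matrix_vector [simp del]

lemma sum_UNIV_sum:
  "(\<Sum>k\<in>(UNIV::('a::finite + 'b::finite) set). f k) = (\<Sum>i\<in>UNIV. f (Inl i)) + (\<Sum>i\<in>UNIV. f (Inr i))"
  by (simp add: UNIV_Plus_UNIV[symmetric] sum.Plus del: UNIV_Plus_UNIV)

lemma prod_UNIV_sum:
  "(\<Prod>k\<in>(UNIV::('a::finite + 'b::finite) set). f k) = (\<Prod>i\<in>UNIV. f (Inl i)) * (\<Prod>i\<in>UNIV. f (Inr i))"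
  by (simp add: UNIV_Plus_UNIV[symmetric] prod.Plus del: UNIV_Plus_UNIV)

definition blk :: "'a ^ 'n ^ 'n \<Rightarrow> 'a ^ 'n ^ 'n \<Rightarrow> 'a ^ 'n ^ 'n \<Rightarrow> 'a ^ 'n ^ 'n \<Rightarrow> 'a ^ ('n::finite + 'n) ^ ('n + 'n)" where
  "blk a b c d = (\<chi> k l. case k of
      Inl i \<Rightarrow> (case l of Inl j \<Rightarrow> a $ i $ j | Inr j \<Rightarrow> b $ i $ j)
    | Inr i \<Rightarrow> (case l of Inl j \<Rightarrow> c $ i $ j | Inr j \<Rightarrow> d $ i $ j))"

lemma blk_nth [simp]:
  "blk a b c d $ Inl i $ Inl j = a $ i $ j" "blk a b c d $ Inl i $ Inr j = b $ i $ j"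
  "blk a b c d $ Inr i $ Inl j = c $ i $ j" "blk a b c d $ Inr i $ Inr j = d $ i $ j"
  by (simp_all add: blk_def)

lemma mkpt_nth [simp]: "mkpt x y $ Inl i = x $ i" "mkpt x y $ Inr i = y $ i"
  by (simp_all add: mkpt_def)

lemma mkpt_parts [simp]: "xpart (mkpt x y) = x" "xipart (mkpt x y) = y" "mkpt (xpart z) (xipart z) = z"
  by (simp_all add: xpart_def xipart_def vec_eq_iff split_sum_all)

lemma mkpt_eq_iff [simp]: "mkpt x y = mkpt x' y' \<longleftrightarrow> x = x' \<and> y = y'"
  by (metis mkpt_parts)

lemma blk_mult:
  "blk a b c d ** blk a' b' c' d' =
   blk (a ** a' + b ** c') (a ** b' + b ** d') (c ** a' + d ** c') (c ** b' + d ** (d' :: ('a::semiring_1) ^ ('n::finite) ^ 'n))"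
  by (simp add: vec_eq_iff split_sum_all matrix_matrix_mult_def sum_UNIV_sum)

lemma blk_mult_mkpt: "blk a b c d *v mkpt x y = mkpt (a *v x + b *v y) (c *v x + d *v y)"
  by (simp add: vec_eq_iff split_sum_all matrix_vector_mult_def sum_UNIV_sum)

lemma blk_one: "blk (mat 1) 0 0 (mat 1) = mat 1"
  by (simp add: vec_eq_iff split_sum_all mat_def)

lemma blk_cases: obtains a b c d where "X = blk a b c d"
proof
  show "X = blk (\<chi> i j. X $ Inl i $ Inl j) (\<chi> i j. X $ Inl i $ Inr j)
                (\<chi> i j. X $ Inr i $ Inl j) (\<chi> i j. X $ Inr i $ Inr j)"
    by (simp add: vec_eq_iff split_sum_all)
qed

lemma blk_eq_iff [simp]: "blk a b c d = blk a' b' c' d' \<longleftrightarrow> a = a' \<and> b = b' \<and> c = c' \<and> d = d'"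
  by (auto simp: vec_eq_iff split_sum_all)

lemma transpose_blk: "transpose (blk a b c d) = blk (transpose a) (transpose c) (transpose b) (transpose d)"
  by (simp add: vec_eq_iff split_sum_all transpose_def)

lemma cnj_mat_blk: "cnj_mat (blk a b c d) = blk (cnj_mat a) (cnj_mat b) (cnj_mat c) (cnj_mat d)"
  by (simp add: vec_eq_iff split_sum_all cnj_mat_def)

lemma trace_blk: "trace (blk a b c (d :: ('a::semiring_1) ^ 'n ^ ('n::finite))) = trace a + trace d"
  by (simp add: trace_def sum_UNIV_sum)

section \<open>Determinants of block matrices, derivative of the determinant, characteristic
  polynomials\<close>

lemma det_blk_left:
  "det (blk a 0 0 (mat 1)) = det (a :: ('a::comm_ring_1) ^ 'n ^ ('n::finite))"
proof -
  let ?M = "blk a 0 0 (mat 1) :: 'a ^ ('n + 'n) ^ ('n + 'n)"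
  let ?f = "\<lambda>p. of_int (sign p) * (\<Prod>k\<in>UNIV. ?M $ k $ p k)"
  let ?P = "(\<lambda>\<pi>. map_permutation (UNIV :: 'n set) (Inl :: 'n \<Rightarrow> 'n + 'n) \<pi>) ` {p. p permutes (UNIV::'n set)}"
  have mpl: "map_permutation UNIV Inl \<pi> (Inl i :: 'n + 'n) = Inl (\<pi> i)" for \<pi> and i :: 'n
    by (rule map_permutation_apply) auto
  have mpr: "map_permutation (UNIV::'n set) (Inl :: 'n \<Rightarrow> 'n + 'n) \<pi> (Inr i) = Inr i" for \<pi> i
    by (auto simp: map_permutation_def restrict_id_def)
  have sub: "?P \<subseteq> {p. p permutes (UNIV :: ('n+'n) set)}"
    by (auto intro!: permutes_subset[OF map_permutation_permutes[where B = "range Inl"]] simp: bij_betw_def)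
  \<comment> \<open>A nonzero Leibniz term forces \<open>p\<close> to fix every
    \<open>Inr i\<close>, since that row has a single nonzero entry. Then \<open>p\<close> preserves
    the \<open>Inl\<close> part and comes from a permutation of the upper left block.\<close>
  have zero: "?f p = 0" if p: "p permutes UNIV" "p \<notin> ?P" for p
  proof (rule ccontr)
    assume "?f p \<noteq> 0"
    then have nz: "(\<Prod>k\<in>UNIV. ?M $ k $ p k) \<noteq> 0" by auto
    have nzk: "?M $ k $ p k \<noteq> 0" for k
    proof
      assume "?M $ k $ p k = 0"
      then have "(\<Prod>k\<in>UNIV. ?M $ k $ p k) = 0"
        by (subst prod.remove[of _ k]) auto
      then show False using nz by simp
    qed
    have r: "p (Inr i) = Inr i" for i
      using nzk[of "Inr i"] by (cases "p (Inr i)") (auto simp: mat_def split: if_splits)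
    have l: "\<exists>j. p (Inl i) = Inl j" for i
      using nzk[of "Inl i"] by (cases "p (Inl i)") auto
    then obtain \<pi> where \<pi>: "\<And>i. p (Inl i) = Inl (\<pi> i)" by metis
    have "inj \<pi>"
      using \<pi> permutes_inj[OF p(1)] by (metis injD injI sum.inject(1))
    then have "\<pi> permutes UNIV"
      by (auto intro!: bij_imp_permutes simp: bij_def finite_UNIV_inj_surj)
    moreover have "p = map_permutation UNIV Inl \<pi>"
    proof
      fix k show "p k = map_permutation UNIV Inl \<pi> k"
        by (cases k) (auto simp: mpl mpr \<pi> r)
    qed
    ultimately show False using p(2) by auto
  qed
  have inj: "inj_on (map_permutation (UNIV::'n set) (Inl :: 'n \<Rightarrow> 'n + 'n)) {p. p permutes UNIV}"
    by (auto simp: inj_on_def fun_eq_iff) (metis mpl sum.inject(1))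
  have "det ?M = (\<Sum>p\<in>?P. ?f p)"
    unfolding det_def using zero sub by (intro sum.mono_neutral_right) (auto simp: finite_permutations)
  also have "\<dots> = (\<Sum>p\<in>{p. p permutes (UNIV::'n set)}. ?f (map_permutation UNIV Inl p))"
    by (subst sum.reindex[OF inj]) simp
  also have "\<dots> = det a"
    unfolding det_def
    by (intro sum.cong) (auto simp: sign_map_permutation prod_UNIV_sum mpl mpr mat_def)
  finally show ?thesis .
qed

lemma det_blk_right:
  "det (blk (mat 1) 0 0 d) = det (d :: ('a::field) ^ 'n ^ ('n::finite))"
proof -
  let ?P = "blk 0 (mat 1) (mat 1) 0 :: 'a ^ ('n + 'n) ^ ('n + 'n)"
  have "?P ** blk d 0 0 (mat 1) ** ?P = blk (mat 1) 0 0 d"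
    by (simp add: blk_mult)
  moreover have "det ?P * det ?P = 1"
    by (simp add: det_mul[symmetric] blk_mult blk_one)
  ultimately show ?thesis
    using det_blk_left[of d] by (metis (no_types, lifting) det_mul mult.assoc mult.commute mult_1)
qed

lemma det_blk_upper:
  "det (blk a b 0 d) = det a * det (d :: complex ^ 'n ^ ('n::finite))"
proof -
  have 1: "det (blk (mat 1) b 0 (mat 1) :: complex ^ ('n + 'n) ^ ('n + 'n)) = 1" for b
  proof -
    \<comment> \<open>?s conjugates ?U b to its inverse, so det (?U b) = 1 or -1; moreover ?U b is a square.\<close>
    let ?U = "\<lambda>b. blk (mat 1) b 0 (mat 1) :: complex ^ ('n + 'n) ^ ('n + 'n)"
    let ?s = "blk (mat 1) 0 0 (- mat 1) :: complex ^ ('n + 'n) ^ ('n + 'n)"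
    have m1: "x ** (- y) = - (x ** y)" "(- x) ** y = - (x ** y)" for x y :: "complex^'n^'n"
      by (simp_all add: vec_eq_iff matrix_matrix_mult_def sum_negf)
    have *: "det (?U b) * det (?U b) = 1" for b
    proof -
      have "?s ** ?U b ** ?s ** ?U b = mat 1"
        by (simp add: blk_mult m1 blk_one)
      from arg_cong[OF this, of det] have "det ?s * det (?U b) * det ?s * det (?U b) = 1"
        by (simp add: det_mul)
      moreover have "?s ** ?s = mat 1" by (simp add: blk_mult m1 blk_one)
      from arg_cong[OF this, of det] have "det ?s * det ?s = 1" by (simp add: det_mul)
      ultimately show ?thesis by (simp add: algebra_simps)
    qed
    let ?h = "(1/2) *\<^sub>R b"
    have "?U ?h ** ?U ?h = ?U b"
      by (simp add: blk_mult scaleR_half_double flip: scaleR_left.add)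
    then show ?thesis using *[of ?h] by (metis det_mul)
  qed
  have "blk a b 0 d = blk (mat 1) 0 0 d ** blk (mat 1) b 0 (mat 1) ** blk a 0 0 (mat 1)"
    by (simp add: blk_mult)
  then show ?thesis
    by (simp add: det_mul det_blk_left det_blk_right 1)
qed

lemma det_blk_lower:
  "det (blk a 0 c d) = det a * det (d :: complex ^ 'n ^ ('n::finite))"
proof -
  have zt: "0 = transpose (0 :: complex ^ 'n ^ 'n)" by (simp add: vec_eq_iff transpose_def)
  show ?thesis
    using det_blk_upper[of "transpose a" "transpose c" "transpose d"]
    by (metis det_transpose transpose_blk zt)
qed

text \<open>A permutation other than the identity moves at least two indices. Differentiating one
  factor of its Leibniz term leaves another off-diagonal entry of the identity matrix, so only the
  diagonal term survives.\<close>

lemma has_derivative_det_one: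
  fixes X :: "real \<Rightarrow> complex ^ 'm ^ ('m::finite)"
  assumes X0: "X 0 = mat 1"
    and D: "\<And>i j. ((\<lambda>t. X t $ i $ j) has_vector_derivative D $ i $ j) (at 0)"
  shows "((\<lambda>t. det (X t)) has_vector_derivative trace D) (at 0)"
proof -
  let ?d = "\<lambda>p. \<Sum>i\<in>UNIV. (D $ i $ p i) * (\<Prod>j\<in>UNIV - {i}. X 0 $ j $ p j)"
  have pr: "((\<lambda>t. \<Prod>i\<in>UNIV. X t $ i $ p i) has_vector_derivative ?d p) (at 0)" for p
  proof -
    have "((\<lambda>t. \<Prod>i\<in>UNIV. X t $ i $ p i) has_derivative
       (\<lambda>y. \<Sum>i\<in>UNIV. (y *\<^sub>R (D $ i $ p i)) * (\<Prod>j\<in>UNIV - {i}. X 0 $ j $ p j))) (at 0)"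
      using D unfolding has_vector_derivative_def by (intro has_derivative_prod) auto
    then show ?thesis
      unfolding has_vector_derivative_def by (simp add: scaleR_sum_right)
  qed
  have dz: "?d p = (if p = id then trace D else 0)" if p: "p permutes UNIV" for p
  proof (cases "p = id")
    case True
    then show ?thesis by (simp add: X0 mat_def trace_def)
  next
    case False
    have "(\<Prod>j\<in>UNIV - {i}. X 0 $ j $ p j) = 0" for i
    proof -
      obtain k where k: "p k \<noteq> k" using False by (auto simp: fun_eq_iff)
      have "p (p k) \<noteq> p k" using permutes_inj[OF p] k by (auto dest: injD)
      then have "\<exists>j. j \<noteq> i \<and> p j \<noteq> j" using k by metis
      then obtain j where "j \<noteq> i" "p j \<noteq> j" by auto
      then show ?thesis by (intro prod_zero) (auto simp: X0 mat_def intro!: bexI[of _ j])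
    qed
    then show ?thesis using False by (simp only: mult_zero_right sum.neutral_const if_False)
  qed
  have "((\<lambda>t. \<Sum>p\<in>{p. p permutes UNIV}. of_int (sign p) * (\<Prod>i\<in>UNIV. X t $ i $ p i))
     has_vector_derivative (\<Sum>p\<in>{p. p permutes UNIV}. of_int (sign p) * ?d p)) (at 0)"
    by (intro has_vector_derivative_sum has_vector_derivative_mult_right pr)
  moreover have "(\<Sum>p\<in>{p. p permutes (UNIV :: 'm set)}. of_int (sign p) * ?d p)
      = (\<Sum>p\<in>{p. p permutes (UNIV :: 'm set)}. if p = id then trace D else 0)"
    by (intro sum.cong) (auto simp: dz)
  moreover have "\<dots> = trace D"
    by (simp add: finite_permutations permutes_id)
  ultimately show ?thesis unfolding det_def by simp
qed

text \<open>The matrix of eigenvectors intertwines \<open>t - N\<close> with a diagonal matrix.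
  Arguing at each value \<open>t\<close> keeps all determinants over the field of complex numbers;
  the polynomial identity follows from equality of values.\<close>

lemma charpoly_eigenbasis:
  fixes N :: "complex ^ 'm ^ ('m::finite)"
  assumes e: "\<And>k. N *v e k = l k *s e k"
    and inv: "det (\<chi> i k. e k $ i) \<noteq> 0"
  shows "charpoly N = (\<Prod>k\<in>UNIV. [:- l k, 1:])"
proof -
  let ?P = "\<chi> i k. e k $ i" and ?D = "\<lambda>t. (\<chi> i j. if i = j then t - l j else 0) :: complex ^ 'm ^ 'm"
  have "poly (charpoly N) t = poly (\<Prod>k\<in>UNIV. [:- l k, 1:]) t" for t
  proof -
    let ?M = "\<chi> i j. (if i = j then t else 0) - N $ i $ j"
    have ev: "poly (charpoly N) t = det ?M"
      unfolding charpoly_def det_def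
      by (simp add: poly_sum poly_prod if_distrib[of "\<lambda>p. poly p t"] cong: if_cong)
    have "?M ** ?P = ?P ** ?D t"
    proof -
      have f1: "(\<Sum>k\<in>UNIV. ((if i = k then t else 0) - N $ i $ k) * e j $ k) = e j $ i * (t - l j)" for i j
      proof -
        have "(\<Sum>k\<in>UNIV. ((if i = k then t else 0) - N $ i $ k) * e j $ k)
            = (\<Sum>k\<in>UNIV. (if i = k then t * e j $ k else 0)) - (N *v e j) $ i"
          unfolding matrix_vector_mult_def vec_lambda_beta sum_subtractf[symmetric]
          by (intro sum.cong) (auto simp: left_diff_distrib)
        then show ?thesis by (simp add: e algebra_simps)
      qed
      have f2: "(\<Sum>k\<in>UNIV. e k $ i * (if k = j then t - l j else 0)) = e j $ i * (t - l j)" for i j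
        by (simp add: if_distrib cong: if_cong)
      show ?thesis
        by (simp only: vec_eq_iff matrix_matrix_mult_def vec_lambda_beta f1 f2 simp_thms)
    qed
    from arg_cong[OF this, of det] have "det ?M * det ?P = det ?P * det (?D t)" by (simp add: det_mul)
    then have "det ?M = det (?D t)" using inv by simp
    moreover have "det (?D t) = (\<Prod>k\<in>UNIV. t - l k)"
      by (subst det_diagonal) auto
    ultimately show ?thesis by (simp add: poly_prod ev)
  qed
  then show ?thesis by (intro poly_eq_poly_eq_iff[THEN iffD1] ext)
qed

section \<open>Bilinear and Hermitian pairings\<close>

definition hadj :: "complex ^ 'n ^ 'm \<Rightarrow> complex ^ 'm ^ 'n" where
  "hadj A = transpose (cnj_mat A)"

text \<open>Antilinear in the first argument, unlike the bilinear \<open>cdot\<close>. Its real part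
  is the euclidean inner product of the underlying real space, so that antilinear maps can be
  treated as self-adjoint real-linear maps.\<close>

definition hip :: "complex ^ 'n \<Rightarrow> complex ^ 'n \<Rightarrow> complex" where
  "hip x y = cdot (cnj_vec x) y"

lemma cdot_commute: "cdot x y = cdot y x"
  by (simp add: cdot_def mult.commute)

lemma cdot_simps:
  "cdot (x + x') y = cdot x y + cdot x' y" "cdot x (y + y') = cdot x y + cdot x y'"
  "cdot (x - x') y = cdot x y - cdot x' y" "cdot x (y - y') = cdot x y - cdot x y'"
  "cdot (- x) y = - cdot x y" "cdot x (- y) = - cdot x y"
  "cdot (c *s x) y = c * cdot x y" "cdot x (c *s y) = c * cdot x y"
  "cdot 0 y = 0" "cdot x 0 = 0"
  by (simp_all add: cdot_def algebra_simps sum.distrib sum_subtractf sum_negf sum_distrib_left)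

lemma cdot_matrix: "cdot (A *v x) y = cdot x (transpose A *v y)"
  unfolding cdot_def matrix_vector_mult_def transpose_def
  by (simp add: sum_distrib_left sum_distrib_right mult_ac) (rule sum.swap)

lemma cdot_eqI: "(\<And>w. cdot w x = cdot w y) \<Longrightarrow> x = y"
proof -
  assume a: "\<And>w. cdot w x = cdot w y"
  have "cdot (axis i 1) z = z $ i" for i and z :: "complex ^ 'a"
    by (simp add: cdot_def axis_def if_distrib if_distribR cong: if_cong)
  then show ?thesis using a by (metis vec_eq_iff)
qed

lemma cnj_vec_simps [simp]:
  "cnj_vec (cnj_vec x) = x" "cnj_vec (x + y) = cnj_vec x + cnj_vec y" "cnj_vec (x - y) = cnj_vec x - cnj_vec y"
  "cnj_vec (- x) = - cnj_vec x" "cnj_vec (c *s x) = cnj c *s cnj_vec x" "cnj_vec 0 = 0"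
  "cnj_vec (A *v x) = cnj_mat A *v cnj_vec x" "cnj_vec x = 0 \<longleftrightarrow> x = 0" "cnj_vec (r *\<^sub>R x) = r *\<^sub>R cnj_vec x"
  by (simp_all add: cnj_vec_def cnj_mat_def vec_eq_iff matrix_vector_mult_def)

lemma cnj_mat_simps [simp]:
  "cnj_mat (cnj_mat A) = A" "cnj_mat (A + B) = cnj_mat A + cnj_mat B" "cnj_mat (A - B) = cnj_mat A - cnj_mat B"
  "cnj_mat (- A) = - cnj_mat A" "cnj_mat 0 = 0" "cnj_mat (mat 1) = mat 1"
  by (simp_all add: cnj_mat_def vec_eq_iff mat_def)

lemma cnj_mat_mult [simp]: "cnj_mat (A ** B) = cnj_mat A ** cnj_mat B"
  by (simp add: cnj_mat_def vec_eq_iff matrix_matrix_mult_def)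

lemma cnj_mat_transpose [simp]: "cnj_mat (transpose A) = transpose (cnj_mat A)"
  by (simp add: cnj_mat_def vec_eq_iff transpose_def)

lemma cnj_vec_mkpt [simp]: "cnj_vec (mkpt x y) = mkpt (cnj_vec x) (cnj_vec y)"
  by (simp add: cnj_vec_def vec_eq_iff split_sum_all)

lemma cnj_cdot: "cnj (cdot x y) = cdot (cnj_vec x) (cnj_vec y)"
  by (simp add: cdot_def cnj_vec_def)

lemma det_cnj_mat: "det (cnj_mat A) = cnj (det A)"
  by (simp add: det_def cnj_mat_def)

lemma hip_simps:
  "hip (x + x') y = hip x y + hip x' y" "hip x (y + y') = hip x y + hip x y'"
  "hip (x - x') y = hip x y - hip x' y" "hip x (y - y') = hip x y - hip x y'"
  "hip (- x) y = - hip x y" "hip x (- y) = - hip x y"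
  "hip (c *s x) y = cnj c * hip x y" "hip x (c *s y) = c * hip x y"
  "hip 0 y = 0" "hip x 0 = 0"
  by (simp_all add: hip_def cdot_simps)

lemma hip_adj: "hip (A *v x) y = hip x (hadj A *v y)"
  by (simp add: hip_def cdot_matrix hadj_def)

lemma hadj_hadj [simp]: "hadj (hadj A) = A"
  by (simp add: hadj_def)

lemma hip_adj': "hip x (A *v y) = hip (hadj A *v x) y"
  by (simp add: hip_adj)

lemma cnj_hip: "cnj (hip x y) = hip y x"
  by (simp add: hip_def cnj_cdot cdot_commute)

lemma Re_hip: "Re (hip x y) = x \<bullet> y"
  by (simp add: hip_def cdot_def cnj_vec_def inner_vec_def inner_complex_def)

lemma hip_self: "hip x x = complex_of_real ((norm x)\<^sup>2)"
proof -
  have "Im (hip x x) = 0" by (metis cnj_hip cnj.simps(2) equal_neg_zero)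
  then show ?thesis by (simp add: complex_eq_iff Re_hip power2_norm_eq_inner)
qed

lemma hadj_mult: "hadj (A ** B) = hadj B ** hadj A"
  by (simp add: hadj_def matrix_transpose_mul)

lemma hadj_add: "hadj (A + B) = hadj A + hadj B" "hadj (A - B) = hadj A - hadj B"
  by (simp_all add: hadj_def transpose_def vec_eq_iff)

lemma det_hadj: "det (hadj A) = cnj (det A)"
  by (simp add: hadj_def det_cnj_mat)

lemma hadj_blk: "hadj (blk a b c d) = blk (hadj a) (hadj c) (hadj b) (hadj d)"
  by (simp add: hadj_def transpose_blk cnj_mat_blk)

lemma hermitian_cnj: "hadj A = A \<Longrightarrow> transpose A = cnj_mat A"
  by (metis cnj_mat_simps(1) cnj_mat_transpose hadj_def)

lemma scaleR_smult: "r *\<^sub>R x = complex_of_real r *s (x :: complex ^ 'n)"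
  by (simp add: vec_eq_iff) (simp add: scaleR_conv_of_real)

lemma matrix_smult: "A *v (c *s x) = c *s (A *v (x :: complex ^ 'n))"
  by (simp add: vector_scalar_commute)

lemma linear_matrix_vector: "linear ((*v) (A :: complex ^ 'n ^ 'm))"
  by (rule linearI) (simp_all add: matrix_vector_right_distrib scaleR_smult matrix_smult)

lemma linear_cnj_vec: "linear cnj_vec"
  by (rule linearI) simp_all

text \<open>For Hermitian H and symmetric B the real-linear map rl H B is self-adjoint for the real inner
  product and rq H B x is the inner product of x with rl H B x; Wm H B is the matrix of rl H B in the
  coordinates (x, conjugate of x).\<close>

definition rq :: "complex ^ 'n ^ 'n \<Rightarrow> complex ^ 'n ^ 'n \<Rightarrow> complex ^ 'n \<Rightarrow> real" where
  "rq H B x = Re (hip x (H *v x)) + Re (cdot x (B *v x))"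

definition rl :: "complex ^ 'n ^ 'n \<Rightarrow> complex ^ 'n ^ 'n \<Rightarrow> complex ^ 'n \<Rightarrow> complex ^ 'n" where
  "rl H B x = H *v x + cnj_mat B *v cnj_vec x"

lemma inner_rl: "x \<bullet> rl H B y = Re (hip x (H *v y)) + Re (cdot x (B *v y))"
proof -
  have "Re (hip x (cnj_mat B *v cnj_vec y)) = Re (cnj (hip x (cnj_mat B *v cnj_vec y)))" by simp
  also have "\<dots> = Re (cdot x (B *v y))"
    by (simp only: hip_def cnj_cdot) simp
  finally show ?thesis by (simp add: rl_def Re_hip[symmetric] hip_simps)
qed

lemma rq_inner: "rq H B x = x \<bullet> rl H B x"
  by (simp add: inner_rl rq_def)

lemma linear_rl: "linear (rl H B)"
  unfolding rl_def
  by (intro linear_compose_add linear_matrix_vector linear_compose[OF linear_cnj_vec linear_matrix_vector, unfolded o_def])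

lemma inner_rl_sym:
  assumes "hadj H = H" "transpose B = B"
  shows "x \<bullet> rl H B y = rl H B x \<bullet> y"
proof -
  have "Re (hip x (H *v y)) = Re (hip y (H *v x))"
    by (metis assms(1) cnj.simps(1) cnj_hip hip_adj)
  moreover have "cdot x (B *v y) = cdot y (B *v x)"
    by (metis assms(2) cdot_commute cdot_matrix)
  ultimately show ?thesis by (simp add: inner_rl inner_commute[of "rl H B x"])
qed

definition Wm :: "complex ^ 'n ^ 'n \<Rightarrow> complex ^ 'n ^ 'n \<Rightarrow> complex ^ ('n::finite + 'n) ^ ('n + 'n)" where
  "Wm H B = blk H (cnj_mat B) B (cnj_mat H)"

lemma Wm_mult: "Wm H B *v mkpt x (cnj_vec x) = mkpt (rl H B x) (cnj_vec (rl H B x))"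
  by (simp add: Wm_def rl_def blk_mult_mkpt add.commute)

section \<open>Spectral theorem and Takagi factorization\<close>

text \<open>A maximum point of \<open>x \<bullet> f x\<close> on the unit sphere of \<open>V\<close>
  is an eigenvector, because the first variation vanishes in all directions of \<open>V\<close>. The
  setting is real because the map behind Takagi's factorization is antilinear.\<close>

lemma self_adjoint_eigenvector:
  fixes f :: "'a::euclidean_space \<Rightarrow> 'a"
  assumes f: "linear f" and sym: "\<And>x y. x \<bullet> f y = f x \<bullet> y"
    and V: "subspace V" "V \<noteq> {0}" and inv: "\<And>x. x \<in> V \<Longrightarrow> f x \<in> V"
  shows "\<exists>v k. v \<in> V \<and> norm v = 1 \<and> f v = k *\<^sub>R v"
proof -
  let ?S = "sphere 0 1 \<inter> V"
  have "compact ?S"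
    using V by (intro compact_Int_closed closed_subspace) auto
  moreover have "?S \<noteq> {}"
  proof -
    obtain x where "x \<in> V" "x \<noteq> 0" using V subspace_0 by blast
    then have "x /\<^sub>R norm x \<in> ?S" using V by (auto intro: subspace_scale)
    then show ?thesis by blast
  qed
  moreover have cf: "continuous_on S f" for S using f by (simp add: linear_continuous_on linear_conv_bounded_linear)
  have "continuous_on ?S (\<lambda>x. x \<bullet> f x)"
    by (intro continuous_intros cf)
  ultimately have "\<exists>v\<in>?S. \<forall>x\<in>?S. x \<bullet> f x \<le> v \<bullet> f v"
    by (intro continuous_attains_sup)
  then obtain v where v: "v \<in> ?S" and mx: "\<And>x. x \<in> ?S \<Longrightarrow> x \<bullet> f x \<le> v \<bullet> f v" by blast
  define m where "m = v \<bullet> f v"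
  have vv: "v \<in> V" "norm v = 1" "v \<bullet> v = 1" using v by (auto simp: norm_eq_1)
  have le: "x \<bullet> f x \<le> m * (x \<bullet> x)" if "x \<in> V" for x
  proof (cases "x = 0")
    case False
    have "x /\<^sub>R norm x \<in> ?S" using that False V by (auto intro: subspace_scale)
    from mx[OF this] have "(x \<bullet> f x) / (norm x * norm x) \<le> m"
      by (simp add: linear_scale[OF f] m_def divide_simps)
    then show ?thesis using False by (simp add: field_simps dot_square_norm power2_eq_square)
  qed (simp add: linear_0[OF f])
  have "w \<bullet> (f v - m *\<^sub>R v) = 0" if w: "w \<in> V" for w
  proof -
    define b where "b = w \<bullet> (f v - m *\<^sub>R v)"
    define c where "c = w \<bullet> f w - m * (w \<bullet> w)"
    \<comment> \<open>This is \<open>le\<close> at the point \<open>v + t *\<^sub>R w\<close>. A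
      quadratic in \<open>t\<close> without constant term that stays nonpositive has no linear
      term.\<close>
    have q: "2 * t * b + t\<^sup>2 * c \<le> 0" for t
    proof -
      have "v + t *\<^sub>R w \<in> V" using w vv V by (auto intro: subspace_add subspace_scale)
      from le[OF this] show ?thesis
        by (simp add: linear_add[OF f] linear_scale[OF f] inner_simps b_def c_def vv m_def
            sym[of v w] inner_commute[of v w] inner_commute[of "f v" w] algebra_simps power2_eq_square)
    qed
    have "b = 0"
    proof (rule ccontr)
      assume "b \<noteq> 0"
      \<comment> \<open>At \<open>t = b / d\<close> the quadratic equals
        \<open>b\<^sup>2 / d\<close> times \<open>2 + c / d\<close>, and
        \<open>d > \<bar>c\<bar>\<close> makes the second factor larger than 1.\<close>
      define d where "d = 1 + \<bar>c\<bar>"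
      have d: "d > 0" "- d < c" by (auto simp: d_def)
      have eq: "2 * (b / d) * b + (b / d)\<^sup>2 * c = (b\<^sup>2 / d) * (2 + c / d)"
        using d by (simp add: power2_eq_square field_simps)
      have "c / d > - 1" using d by (simp add: field_simps)
      moreover have "b\<^sup>2 / d > 0" using \<open>b \<noteq> 0\<close> d by simp
      ultimately have "2 * (b / d) * b + (b / d)\<^sup>2 * c > 0"
        unfolding eq by (intro mult_pos_pos) linarith+
      with q[of "b / d"] show False by simp
    qed
    then show ?thesis by (simp add: b_def)
  qed
  moreover have "f v - m *\<^sub>R v \<in> V" using vv inv V by (auto intro: subspace_diff subspace_scale)
  ultimately have "f v = m *\<^sub>R v" by (metis inner_eq_zero_iff right_minus_eq)
  then show ?thesis using vv by blast
qed

lemma inner_ii: "(\<i> *s x) \<bullet> (\<i> *s y) = x \<bullet> (y :: complex ^ 'n)"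
  by (simp add: Re_hip[symmetric] hip_simps)

lemma inner_i_left: "(\<i> *s x) \<bullet> y = - (x \<bullet> (\<i> *s (y :: complex ^ 'n)))"
  by (simp add: Re_hip[symmetric] hip_simps)

lemma hip_inner: "hip x y = Complex (x \<bullet> y) (- (x \<bullet> (\<i> *s y)))"
  by (simp add: complex_eq_iff Re_hip[symmetric] hip_simps)

lemma smult_linear: "linear (\<lambda>x :: complex ^ 'n. c *s x)"
  by (rule linearI) (simp_all add: vec_eq_iff algebra_simps)

text \<open>The cases e = 1 and e = -1 give the spectral theorem for Hermitian matrices and Takagi's
  factorization of complex symmetric matrices.\<close>

lemma complex_eigenbasis_aux:
  fixes f :: "complex ^ 'n \<Rightarrow> complex ^ 'n" and I :: "'i set"
  assumes f: "linear f" and sym: "\<And>x y. x \<bullet> f y = f x \<bullet> y"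
    and fi: "\<And>x. f (\<i> *s x) = e *\<^sub>R (\<i> *s f x)" and "finite I"
  shows "subspace V \<Longrightarrow> (\<And>x. x \<in> V \<Longrightarrow> f x \<in> V) \<Longrightarrow> (\<And>x. x \<in> V \<Longrightarrow> \<i> *s x \<in> V) \<Longrightarrow> dim V = 2 * card I
    \<Longrightarrow> \<exists>v k. (\<forall>i\<in>I. v i \<in> V \<and> f (v i) = k i *\<^sub>R v i) \<and> (\<forall>i\<in>I. \<forall>j\<in>I. hip (v i) (v j) = (if i = j then 1 else 0))"
  using \<open>finite I\<close>
proof (induction I arbitrary: V rule: finite_induct)
  case empty
  then show ?case by simp
next
  case (insert a I)
  have "V \<noteq> {0}" using insert.prems(4) insert.hyps by auto
  then obtain w c where w: "w \<in> V" "norm w = 1" "f w = c *\<^sub>R w"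
    using self_adjoint_eigenvector[OF f sym insert.prems(1) _ insert.prems(2)] by blast
  \<comment> \<open>The whole complex line through \<open>w\<close> is split off, so that the
    remaining vectors are orthogonal to \<open>w\<close> for \<open>hip\<close> and not only for its
    real part. Since \<open>f\<close> maps \<open>\<i> *s w\<close> to a real multiple of itself,
    the complement stays invariant; its real dimension drops by two.\<close>
  define V' where "V' = {y \<in> V. w \<bullet> y = 0 \<and> (\<i> *s w) \<bullet> y = 0}"
  have ww: "w \<bullet> w = 1" using w by (simp add: norm_eq_1)
  have wi: "w \<bullet> (\<i> *s w) = 0" using inner_i_left[of w w] by (simp add: inner_commute)
  have "dim V' + dim (span {w, \<i> *s w}) = dim V"
  proof -
    have "V' = {y \<in> V. \<forall>x \<in> span {w, \<i> *s w}. orthogonal x y}"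
    proof -
      have "(\<forall>x \<in> span {w, \<i> *s w}. orthogonal x y) \<longleftrightarrow> w \<bullet> y = 0 \<and> (\<i> *s w) \<bullet> y = 0" for y
      proof
        assume "\<forall>x \<in> span {w, \<i> *s w}. orthogonal x y"
        then show "w \<bullet> y = 0 \<and> (\<i> *s w) \<bullet> y = 0" by (simp add: span_base orthogonal_def)
      next
        assume "w \<bullet> y = 0 \<and> (\<i> *s w) \<bullet> y = 0"
        then have "orthogonal y x" if "x \<in> span {w, \<i> *s w}" for x
          by (intro orthogonal_to_span[OF that]) (auto simp: orthogonal_def inner_commute)
        then show "\<forall>x \<in> span {w, \<i> *s w}. orthogonal x y" by (simp add: orthogonal_commute)
      qed
      then show ?thesis by (simp add: V'_def)
    qed
    then show ?thesis
      using dim_subspace_orthogonal_to_vectors[of "span {w, \<i> *s w}" V] insert.prems(1,3) w(1)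
      by (simp add: span_minimal)
  qed
  moreover have "dim (span {w, \<i> *s w}) = 2"
  proof -
    have ne: "w \<noteq> \<i> *s w" using wi ww by auto
    have "pairwise orthogonal {w, \<i> *s w}"
      using wi by (auto simp: pairwise_def orthogonal_def inner_commute)
    moreover have "0 \<notin> {w, \<i> *s w}" using ww inner_ii[of w w] by auto
    ultimately have "independent {w, \<i> *s w}" by (rule pairwise_orthogonal_independent)
    then show ?thesis using ne by (simp add: dim_eq_card_independent)
  qed
  ultimately have dV': "dim V' = 2 * card I" using insert.prems(4) insert.hyps by simp
  have "\<exists>v k. (\<forall>i\<in>I. v i \<in> V' \<and> f (v i) = k i *\<^sub>R v i) \<and> (\<forall>i\<in>I. \<forall>j\<in>I. hip (v i) (v j) = (if i = j then 1 else 0))"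
  proof (rule insert.IH[OF _ _ _ dV'])
    show "subspace V'"
      using insert.prems(1) by (auto simp: V'_def subspace_def inner_simps)
    show "f x \<in> V'" if "x \<in> V'" for x
    proof -
      have "f (\<i> *s w) = (e * c) *\<^sub>R (\<i> *s w)"
        by (simp add: fi w(3) linear_scale[OF smult_linear])
      then show ?thesis using that insert.prems(2) by (simp add: V'_def sym w(3))
    qed
    show "\<i> *s x \<in> V'" if "x \<in> V'" for x
      using that insert.prems(3) inner_i_left[of w x] by (auto simp: V'_def inner_ii)
  qed
  then obtain v k where v: "\<And>i. i \<in> I \<Longrightarrow> v i \<in> V'" "\<And>i. i \<in> I \<Longrightarrow> f (v i) = k i *\<^sub>R v i"
    "\<And>i j. i \<in> I \<Longrightarrow> j \<in> I \<Longrightarrow> hip (v i) (v j) = (if i = j then 1 else 0)" by blast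
  have ort: "hip w (v i) = 0" "hip (v i) w = 0" if "i \<in> I" for i
  proof -
    show 1: "hip w (v i) = 0" using v(1)[OF that] inner_i_left[of w "v i"]
      by (simp add: V'_def hip_inner complex_eq_iff)
    then show "hip (v i) w = 0" by (metis cnj_hip complex_cnj_zero)
  qed
  have "hip w w = 1" by (simp add: hip_self w)
  then show ?case
    using v ort w insert.hyps V'_def
    by (intro exI[of _ "v(a := w)"] exI[of _ "k(a := c)"]) auto
qed

definition diagm :: "('n \<Rightarrow> real) \<Rightarrow> complex ^ 'n ^ ('n::finite)" where
  "diagm k = (\<chi> i j. if i = j then complex_of_real (k i) else 0)"

lemma diagm_mult: "diagm k ** diagm l = diagm (\<lambda>i. k i * l i)"
  unfolding vec_eq_iff diagm_def matrix_matrix_mult_def vec_lambda_beta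
  by (simp add: if_distrib[of "\<lambda>z. z * _"] cong: if_cong)

lemma diagm_vec: "diagm k *v x = (\<chi> i. complex_of_real (k i) * x $ i)"
  unfolding vec_eq_iff diagm_def matrix_vector_mult_def vec_lambda_beta
  by (simp add: if_distrib[of "\<lambda>z. z * _"] cong: if_cong)

lemma diagm_one: "diagm (\<lambda>i. 1) = mat 1"
  by (auto simp: diagm_def mat_def vec_eq_iff)

lemma diagm_adj [simp]: "hadj (diagm k) = diagm k" "transpose (diagm k) = diagm k" "cnj_mat (diagm k) = diagm k"
  by (auto simp: diagm_def hadj_def transpose_def cnj_mat_def vec_eq_iff)

lemma det_diagm: "det (diagm k) = complex_of_real (\<Prod>i\<in>UNIV. k i)"
  by (simp add: diagm_def det_diagonal)

lemma complex_eigenbasis: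
  fixes f :: "complex ^ 'n \<Rightarrow> complex ^ 'n"
  assumes f: "linear f" and sym: "\<And>x y. x \<bullet> f y = f x \<bullet> y"
    and fi: "\<And>x. f (\<i> *s x) = e *\<^sub>R (\<i> *s f x)"
  obtains U :: "complex ^ 'n ^ 'n" and k where "hadj U ** U = mat 1" "\<And>i. f (column i U) = k i *\<^sub>R column i U"
proof -
  have "dim (UNIV :: (complex ^ 'n) set) = 2 * card (UNIV :: 'n set)"
    by simp
  then obtain v :: "'n \<Rightarrow> complex ^ 'n" and k where v: "\<And>i. f (v i) = k i *\<^sub>R v i" "\<And>i j. hip (v i) (v j) = (if i = j then 1 else 0)"
    using complex_eigenbasis_aux[OF f sym fi, of "UNIV :: 'n set" UNIV] by auto
  let ?U = "\<chi> i j. v j $ i"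
  have "hadj ?U ** ?U = mat 1"
    using v(2) by (simp add: vec_eq_iff hadj_def transpose_def cnj_mat_def matrix_matrix_mult_def hip_def
        cdot_def cnj_vec_def mat_def)
  moreover have "column i ?U = v i" for i by (simp add: column_def vec_eq_iff)
  ultimately show ?thesis using that[of ?U k] v(1) by simp
qed

lemma hermitian_diagonalize:
  assumes H: "hadj H = H"
  obtains U :: "complex ^ 'n ^ 'n" and k where "hadj U ** U = mat 1" "hadj U ** H ** U = diagm k"
proof -
  have 1: "x \<bullet> (H *v y) = (H *v x) \<bullet> y" for x y
    by (simp add: Re_hip[symmetric] hip_adj H)
  have 2: "H *v (\<i> *s x) = 1 *\<^sub>R (\<i> *s (H *v x))" for x
    by (simp add: matrix_smult)
  obtain U :: "complex ^ 'n ^ 'n" and k where U: "hadj U ** U = mat 1" "\<And>i. H *v column i U = k i *\<^sub>R column i U"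
    using complex_eigenbasis[OF linear_matrix_vector 1 2] by blast
  have "(H ** U) $ i $ j = (U ** diagm k) $ i $ j" for i j
  proof -
    have "(H ** U) $ i $ j = (H *v column j U) $ i" by (simp add: matrix_matrix_mult_def matrix_vector_mult_def column_def)
    also have "\<dots> = (U ** diagm k) $ i $ j" unfolding U(2)
      by (simp add: column_def matrix_matrix_mult_def diagm_def if_distrib cong: if_cong)
        (simp add: scaleR_conv_of_real)
    finally show ?thesis .
  qed
  then have "H ** U = U ** diagm k" by (simp add: vec_eq_iff)
  then have "hadj U ** H ** U = diagm k" by (metis U(1) matrix_mul_assoc matrix_mul_lid)
  with U(1) show ?thesis using that by blast
qed

text \<open>The antilinear map \<open>x \<mapsto> cnj_vec (B *v x)\<close> is self-adjoint for the
  real inner product because \<open>B\<close> is symmetric, and it anticommutes with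
  \<open>\<i>\<close>. Its eigenvectors satisfy B u = k conj(u), which is the diagonalization by
  congruence. The real numbers \<open>k\<close> may have either sign.\<close>

lemma takagi_factorization:
  assumes B: "transpose B = B"
  obtains U :: "complex ^ 'n ^ 'n" and k where "hadj U ** U = mat 1" "transpose U ** B ** U = diagm k"
proof -
  let ?f = "\<lambda>x. cnj_vec (B *v x)"
  have 1: "x \<bullet> ?f y = ?f x \<bullet> y" for x y
  proof -
    have *: "x \<bullet> ?f y = Re (cdot x (B *v y))" for x y
      by (metis Re_hip cnj.simps(1) cnj_cdot cnj_vec_simps(1) hip_def)
    have "cdot x (B *v y) = cdot y (B *v x)" by (metis B cdot_commute cdot_matrix)
    then show ?thesis by (simp only: * inner_commute[of "?f x"])
  qed
  have 2: "?f (\<i> *s x) = (-1) *\<^sub>R (\<i> *s ?f x)" for x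
    by (simp add: matrix_smult vec_eq_iff cnj_vec_def)
  have lf: "linear ?f"
    by (rule linear_compose[OF linear_matrix_vector linear_cnj_vec, unfolded o_def])
  obtain U :: "complex ^ 'n ^ 'n" and k where U: "hadj U ** U = mat 1" "\<And>i. ?f (column i U) = k i *\<^sub>R column i U"
    using complex_eigenbasis[OF lf 1 2] by blast
  have "(B ** U) $ i $ j = (cnj_mat U ** diagm k) $ i $ j" for i j
  proof -
    have "(B ** U) $ i $ j = (B *v column j U) $ i" by (simp add: matrix_matrix_mult_def matrix_vector_mult_def column_def)
    also have "B *v column j U = cnj_vec (k j *\<^sub>R column j U)" using U(2)[of j] by (metis cnj_vec_simps(1))
    also have "\<dots> $ i = (cnj_mat U ** diagm k) $ i $ j"
      by (simp add: column_def matrix_matrix_mult_def diagm_def if_distrib cnj_mat_def cnj_vec_def cong: if_cong)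
        (simp add: scaleR_conv_of_real)
    finally show ?thesis .
  qed
  then have "B ** U = cnj_mat U ** diagm k" by (simp add: vec_eq_iff)
  moreover have "transpose U ** cnj_mat U = mat 1"
    using arg_cong[OF U(1), of cnj_mat] by (simp add: hadj_def)
  ultimately have "transpose U ** B ** U = diagm k" by (metis matrix_mul_assoc matrix_mul_lid)
  with U(1) show ?thesis using that by blast
qed

section \<open>Positive definite matrices and simultaneous normal forms\<close>

definition posdef :: "complex ^ 'n ^ 'n \<Rightarrow> bool" where
  "posdef H \<longleftrightarrow> hadj H = H \<and> (\<forall>x. x \<noteq> 0 \<longrightarrow> Re (hip x (H *v x)) > 0)"

lemma diagm_axis: "hip (axis i 1) (diagm k *v axis i 1) = complex_of_real (k i)"
  by (simp add: diagm_vec hip_def cdot_def cnj_vec_def axis_def if_distrib if_distribR cong: if_cong)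

lemma hip_congruence: "hip (V *v x) (H *v (V *v x)) = hip x ((hadj V ** H ** V) *v x)"
  by (simp add: hip_adj matrix_vector_mul_assoc matrix_mul_assoc)

lemma left_inverse_det: "A ** B = mat 1 \<Longrightarrow> det (A :: complex ^ 'n ^ 'n) \<noteq> 0 \<and> det B \<noteq> 0"
proof -
  assume "A ** B = mat 1"
  from arg_cong[OF this, of det] show ?thesis by (auto simp: det_mul)
qed

lemma det_inj: "det (A :: complex ^ 'n ^ 'n) \<noteq> 0 \<Longrightarrow> A *v x = 0 \<Longrightarrow> x = 0"
  by (metis invertible_det_nz invertible_def matrix_vector_mul_assoc matrix_vector_mul_lid matrix_vector_mult_0_right)

lemma posdef_normalize:
  assumes H: "posdef H"
  obtains V :: "complex ^ 'n ^ 'n" where "det V \<noteq> 0" "hadj V ** H ** V = mat 1"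
proof -
  obtain U :: "complex ^ 'n ^ 'n" and k where U: "hadj U ** U = mat 1" "hadj U ** H ** U = diagm k"
    using hermitian_diagonalize H unfolding posdef_def by blast
  have dU: "det U \<noteq> 0" using left_inverse_det[OF U(1)] by simp
  have kpos: "k i > 0" for i
  proof -
    have "U *v axis i 1 \<noteq> 0" using det_inj[OF dU] by (metis axis_eq_0_iff one_neq_zero)
    then have "0 < Re (hip (U *v axis i 1) (H *v (U *v axis i 1)))" using H by (simp add: posdef_def)
    also have "\<dots> = k i" by (simp only: hip_congruence U(2) diagm_axis Re_complex_of_real)
    finally show ?thesis .
  qed
  let ?D = "diagm (\<lambda>i. 1 / sqrt (k i))"
  have "det ?D \<noteq> 0" using kpos by (simp add: det_diagm less_imp_neq[symmetric])
  moreover have "hadj (U ** ?D) ** H ** (U ** ?D) = ?D ** (hadj U ** H ** U) ** ?D"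
    by (simp add: hadj_mult matrix_mul_assoc)
  moreover have "\<dots> = diagm (\<lambda>i. 1)"
  proof -
    have "1 / sqrt (k i) * k i * (1 / sqrt (k i)) = 1" for i using kpos[of i]
      by (simp add: field_simps)
    then show ?thesis by (simp only: U(2) diagm_mult)
  qed
  ultimately show ?thesis using that[of "U ** ?D"] dU by (simp add: det_mul diagm_one)
qed

text \<open>Once \<open>H\<close> is normalized to the identity, a unitary matrix can still be
  applied: it preserves the identity and diagonalizes the other form.\<close>

lemma hermitian_pencil:
  assumes H: "posdef H" and A: "hadj A = A"
  obtains V :: "complex ^ 'n ^ 'n" and k where "det V \<noteq> 0" "hadj V ** H ** V = mat 1" "hadj V ** A ** V = diagm k"
proof -
  obtain V :: "complex ^ 'n ^ 'n" where V: "det V \<noteq> 0" "hadj V ** H ** V = mat 1" using posdef_normalize[OF H] .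
  have "hadj (hadj V ** A ** V) = hadj V ** A ** V" by (simp add: hadj_mult A matrix_mul_assoc)
  then obtain U :: "complex ^ 'n ^ 'n" and k where U: "hadj U ** U = mat 1" "hadj U ** (hadj V ** A ** V) ** U = diagm k"
    using hermitian_diagonalize by blast
  have "hadj (V ** U) ** H ** (V ** U) = hadj U ** (hadj V ** H ** V) ** U"
    by (simp add: hadj_mult matrix_mul_assoc)
  then show ?thesis
    using that[of "V ** U" k] U V left_inverse_det[OF U(1)] by (simp add: hadj_mult matrix_mul_assoc det_mul)
qed

text \<open>The congruences with \<open>hadj V\<close> and with \<open>transpose V\<close> are both
  induced by the one substitution \<open>x \<mapsto> V *v x\<close>, see
  \<open>rq_congruence\<close>. A real quadratic form given by a Hermitian and a symmetric part thus
  becomes a sum of real squares.\<close>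

lemma takagi_pencil:
  assumes H: "posdef H" and B: "transpose B = B"
  obtains V :: "complex ^ 'n ^ 'n" and k where "det V \<noteq> 0" "hadj V ** H ** V = mat 1" "transpose V ** B ** V = diagm k"
proof -
  obtain V :: "complex ^ 'n ^ 'n" where V: "det V \<noteq> 0" "hadj V ** H ** V = mat 1" using posdef_normalize[OF H] .
  have "transpose (transpose V ** B ** V) = transpose V ** B ** V" by (simp add: matrix_transpose_mul B matrix_mul_assoc)
  then obtain U :: "complex ^ 'n ^ 'n" and k where U: "hadj U ** U = mat 1" "transpose U ** (transpose V ** B ** V) ** U = diagm k"
    using takagi_factorization by blast
  have "hadj (V ** U) ** H ** (V ** U) = hadj U ** (hadj V ** H ** V) ** U"
    by (simp add: hadj_mult matrix_mul_assoc)
  then show ?thesis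
    using that[of "V ** U" k] U V left_inverse_det[OF U(1)] by (simp add: matrix_transpose_mul matrix_mul_assoc det_mul)
qed

section \<open>The matrix exponential\<close>

lemma matpow_simps [simp]: "matpow A 0 = mat 1" "matpow A (Suc k) = matpow A k ** A"
  by (simp_all add: matpow_def)

lemma matpow_add: "matpow A (k + l) = matpow A k ** matpow A l"
  by (induction l) (simp_all add: matrix_mul_assoc)

lemma matrix_scaleR:
  "(r *\<^sub>R A) ** B = r *\<^sub>R (A ** (B :: complex ^ 'm ^ ('m::finite)))" "A ** (r *\<^sub>R B) = r *\<^sub>R (A ** B)"
  by (simp_all add: matrix_matrix_mult_def vec_eq_iff scaleR_sum_right)

lemma matpow_scaleR: "matpow (r *\<^sub>R A) k = r ^ k *\<^sub>R matpow (A :: complex ^ 'm ^ ('m::finite)) k"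
  by (induction k) (simp_all add: matrix_scaleR mult.commute)

lemma norm_matpow_nth:
  "norm (matpow (A :: complex ^ 'm ^ ('m::finite)) k $ i $ j) \<le> (\<Sum>i\<in>UNIV. \<Sum>j\<in>UNIV. norm (A $ i $ j)) ^ k"
proof (induction k arbitrary: i j)
  case 0
  then show ?case by (simp add: mat_def)
next
  case (Suc k)
  let ?c = "\<Sum>i\<in>UNIV. \<Sum>j\<in>UNIV. norm (A $ i $ j)"
  have "norm (matpow A (Suc k) $ i $ j) \<le> (\<Sum>l\<in>UNIV. norm (matpow A k $ i $ l) * norm (A $ l $ j))"
    by (simp add: matrix_matrix_mult_def norm_mult[symmetric] norm_sum)
  also have "\<dots> \<le> (\<Sum>l\<in>UNIV. ?c ^ k * norm (A $ l $ j))"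
    by (intro sum_mono mult_right_mono Suc) auto
  also have "\<dots> = ?c ^ k * (\<Sum>l\<in>UNIV. norm (A $ l $ j))"
    by (simp add: sum_distrib_left)
  also have "\<dots> \<le> ?c ^ k * ?c"
    by (intro mult_left_mono sum_mono zero_le_power sum_nonneg member_le_sum[where f = "\<lambda>j. norm (A $ _ $ j)"]) auto
  finally show ?case by (simp add: mult.commute)
qed

lemma summable_mexp_entry:
  "summable (\<lambda>k. norm ((inverse (fact k) :: real) *\<^sub>R matpow (A :: complex ^ 'm ^ ('m::finite)) k $ i $ j))"
proof (rule summable_comparison_test[OF exI[of _ 0]], intro allI impI)
  let ?c = "\<Sum>i\<in>UNIV. \<Sum>j\<in>UNIV. norm (A $ i $ j)"
  show "summable (\<lambda>k. inverse (fact k) * ?c ^ k)" by (rule summable_exp)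
  show "norm (norm ((inverse (fact k) :: real) *\<^sub>R matpow A k $ i $ j)) \<le> inverse (fact k) * ?c ^ k" for k
    by (simp add: norm_matpow_nth mult_left_mono)
qed

lemma matrix_sumsI:
  fixes S :: "complex ^ 'm::finite ^ 'k::finite"
  assumes "\<And>i j. (\<lambda>k. f k $ i $ j) sums (S $ i $ j)"
  shows "f sums S"
  using assms unfolding sums_def
  by (intro vec_tendstoI) simp

lemma mexp_entry_sums:
  "(\<lambda>k. (inverse (fact k) :: real) *\<^sub>R matpow (A :: complex ^ 'm ^ ('m::finite)) k $ i $ j) sums (mexp A $ i $ j)"
proof -
  let ?S = "\<chi> i j. \<Sum>k. (inverse (fact k) :: real) *\<^sub>R matpow A k $ i $ j"
  have "(\<lambda>k. (inverse (fact k) :: real) *\<^sub>R matpow A k) sums ?S"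
    by (rule matrix_sumsI) (simp add: summable_norm_cancel[OF summable_mexp_entry] summable_sums)
  then have "mexp A = ?S" by (simp add: mexp_def sums_iff)
  then show ?thesis by (simp add: summable_norm_cancel[OF summable_mexp_entry] summable_sums)
qed

lemma mexp_sums: "(\<lambda>k. (inverse (fact k) :: real) *\<^sub>R matpow A k) sums mexp A"
  by (rule matrix_sumsI) (simp add: mexp_entry_sums)

lemma mexp_unique: "(\<lambda>k. (inverse (fact k) :: real) *\<^sub>R matpow A k) sums S \<Longrightarrow> mexp A = S"
  by (simp add: mexp_def sums_iff)

lemma mexp_intertwine:
  fixes A B P :: "complex ^ 'm ^ ('m::finite)"
  assumes "P ** A = B ** P"
  shows "P ** mexp A = mexp B ** P"
proof -
  have pk: "P ** matpow A k = matpow B k ** P" for k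
    by (induction k) (simp_all add: matrix_mul_assoc, metis assms matrix_mul_assoc)
  have rd: "(X + Y) ** P = X ** P + Y ** P" for X Y
    by (simp add: matrix_matrix_mult_def vec_eq_iff distrib_right sum.distrib)
  have "linear (\<lambda>X :: complex ^ 'm ^ 'm. P ** X)"
    by (rule linearI) (simp_all add: matrix_add_ldistrib matrix_scaleR)
  moreover have "linear (\<lambda>X :: complex ^ 'm ^ 'm. X ** P)"
    by (rule linearI) (simp_all add: rd matrix_scaleR)
  ultimately have bl: "bounded_linear (\<lambda>X :: complex ^ 'm ^ 'm. P ** X)" "bounded_linear (\<lambda>X :: complex ^ 'm ^ 'm. X ** P)"
    by (simp_all add: linear_conv_bounded_linear)
  have "(\<lambda>k. P ** ((inverse (fact k) :: real) *\<^sub>R matpow A k)) sums (P ** mexp A)"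
    "(\<lambda>k. ((inverse (fact k) :: real) *\<^sub>R matpow B k) ** P) sums (mexp B ** P)"
    using bounded_linear.sums[OF bl(1) mexp_sums] bounded_linear.sums[OF bl(2) mexp_sums] by auto
  then show ?thesis by (auto simp: matrix_scaleR pk intro: sums_unique2)
qed

lemma mexp_transpose: "mexp (transpose A) = transpose (mexp A)"
proof (rule mexp_unique, rule matrix_sumsI)
  have c: "A ** matpow A k = matpow A k ** A" for k
    by (induction k) (simp_all, metis matrix_mul_assoc)
  have "matpow (transpose A) k = transpose (matpow A k)" for k
    by (induction k) (simp_all add: c matrix_transpose_mul[symmetric])
  then show "(\<lambda>k. ((inverse (fact k) :: real) *\<^sub>R matpow (transpose A) k) $ i $ j) sums (transpose (mexp A) $ i $ j)" for i j
    using mexp_entry_sums[of A j i] by (simp add: transpose_def)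
qed

lemma mexp_blk: "mexp (blk A 0 0 D) = blk (mexp A) 0 0 (mexp D)"
proof (rule mexp_unique, rule matrix_sumsI)
  have "matpow (blk A 0 0 D) k = blk (matpow A k) 0 0 (matpow D k)" for k
    by (induction k) (simp_all add: blk_mult blk_one)
  then show "(\<lambda>k. ((inverse (fact k) :: real) *\<^sub>R matpow (blk A 0 0 D) k) $ i $ j) sums (blk (mexp A) 0 0 (mexp D) $ i $ j)" for i j
    using mexp_entry_sums[of A] mexp_entry_sums[of D] by (cases i; cases j) auto
qed

text \<open>Entrywise Cauchy product of the absolutely convergent series. All powers are powers of
  the same \<open>A\<close>, so the coefficients combine by the scalar identity
  \<open>exp_series_add_commuting\<close>.\<close>

lemma mexp_scaleR_add:
  fixes A :: "complex ^ 'm ^ ('m::finite)"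
  shows "mexp ((s + t) *\<^sub>R A) = mexp (s *\<^sub>R A) ** mexp (t *\<^sub>R A)"
proof (rule mexp_unique, rule matrix_sumsI)
  fix i j
  let ?a = "\<lambda>k. (inverse (fact k) :: real) *\<^sub>R matpow (s *\<^sub>R A) k"
  let ?b = "\<lambda>k. (inverse (fact k) :: real) *\<^sub>R matpow (t *\<^sub>R A) k"
  let ?e = "\<lambda>r k. (r ^ k) /\<^sub>R fact k :: real"
  have "(\<lambda>k. \<Sum>m\<le>k. ?a m $ i $ l * ?b (k - m) $ l $ j) sums (mexp (s *\<^sub>R A) $ i $ l * mexp (t *\<^sub>R A) $ l $ j)" for l
    using Cauchy_product_sums[of "\<lambda>k. ?a k $ i $ l" "\<lambda>k. ?b k $ l $ j"]
      summable_mexp_entry[of "s *\<^sub>R A" i l] summable_mexp_entry[of "t *\<^sub>R A" l j]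
      mexp_entry_sums[of "s *\<^sub>R A" i l] mexp_entry_sums[of "t *\<^sub>R A" l j] by (simp add: sums_iff)
  then have "(\<lambda>k. \<Sum>l\<in>UNIV. \<Sum>m\<le>k. ?a m $ i $ l * ?b (k - m) $ l $ j) sums
      (\<Sum>l\<in>UNIV. mexp (s *\<^sub>R A) $ i $ l * mexp (t *\<^sub>R A) $ l $ j)"
    by (intro sums_sum)
  moreover have "(\<Sum>l\<in>UNIV. \<Sum>m\<le>k. ?a m $ i $ l * ?b (k - m) $ l $ j) =
      ((inverse (fact k) :: real) *\<^sub>R matpow ((s + t) *\<^sub>R A) k) $ i $ j" for k
  proof -
    have "(\<Sum>l\<in>UNIV. \<Sum>m\<le>k. ?a m $ i $ l * ?b (k - m) $ l $ j)
        = (\<Sum>m\<le>k. \<Sum>l\<in>UNIV. (?e s m * ?e t (k - m)) *\<^sub>R (matpow A m $ i $ l * matpow A (k - m) $ l $ j))"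
      by (subst sum.swap) (simp add: matpow_scaleR mult_ac)
    also have "\<dots> = (\<Sum>m\<le>k. (?e s m * ?e t (k - m)) *\<^sub>R (matpow A k $ i $ j))"
    proof (rule sum.cong)
      fix m assume "m \<in> {..k}"
      then have "matpow A k = matpow A m ** matpow A (k - m)" by (simp add: matpow_add[symmetric])
      then show "(\<Sum>l\<in>UNIV. (?e s m * ?e t (k - m)) *\<^sub>R (matpow A m $ i $ l * matpow A (k - m) $ l $ j))
          = (?e s m * ?e t (k - m)) *\<^sub>R (matpow A k $ i $ j)"
        by (simp add: matrix_matrix_mult_def scaleR_sum_right)
    qed simp
    also have "\<dots> = ?e (s + t) k *\<^sub>R (matpow A k $ i $ j)"
      using exp_series_add_commuting[of s t k] by (simp add: scaleR_sum_left mult.commute)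
    finally show ?thesis by (simp add: matpow_scaleR)
  qed
  ultimately show "(\<lambda>k. ((inverse (fact k) :: real) *\<^sub>R matpow ((s + t) *\<^sub>R A) k) $ i $ j) sums
      ((mexp (s *\<^sub>R A) ** mexp (t *\<^sub>R A)) $ i $ j)"
    by (simp add: matrix_matrix_mult_def)
qed

lemma mexp_zero: "mexp (0 :: complex ^ 'a ^ ('a::finite)) = mat 1"
proof (rule mexp_unique)
  have "matpow (0 :: complex ^ 'a ^ 'a) k = (if k = 0 then mat 1 else 0)" for k
    by (cases k) auto
  then have "(\<lambda>k. (inverse (fact k) :: real) *\<^sub>R matpow (0 :: complex ^ 'a ^ 'a) k) = (\<lambda>k. if k = 0 then mat 1 else 0)"
    by (auto simp: fun_eq_iff)
  then show "(\<lambda>k. (inverse (fact k) :: real) *\<^sub>R matpow 0 k) sums (mat 1 :: complex ^ 'a ^ 'a)"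
    using sums_single[of 0 "\<lambda>_. mat 1 :: complex ^ 'a ^ 'a"] by (simp only:)
qed

lemma mexp_minus: "mexp A ** mexp (- A) = mat 1"
  using mexp_scaleR_add[of 1 "-1" A] by (simp add: mexp_zero)

text \<open>Each entry of \<open>mexp (t *\<^sub>R A)\<close> is an everywhere convergent power
  series in \<open>t\<close>; the derivative at 0 is its coefficient of degree one.\<close>

lemma mexp_entry_deriv:
  fixes A :: "complex ^ 'm ^ ('m::finite)"
  shows "((\<lambda>t. mexp (t *\<^sub>R A) $ i $ j) has_vector_derivative A $ i $ j) (at 0)"
proof -
  let ?c = "\<lambda>k. (inverse (fact k) :: real) *\<^sub>R matpow A k $ i $ j"
  let ?n = "\<Sum>i\<in>UNIV. \<Sum>j\<in>UNIV. norm (A $ i $ j)"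
  have "summable (\<lambda>k. ?c k * z ^ k)" for z
  proof (rule summable_comparison_test[OF exI[of _ 0]], intro allI impI)
    show "summable (\<lambda>k. inverse (fact k) * (?n * norm z) ^ k)" by (rule summable_exp)
    show "norm (?c k * z ^ k) \<le> inverse (fact k) * (?n * norm z) ^ k" for k
      using norm_matpow_nth[of A k i j]
      by (simp add: norm_mult norm_power power_mult_distrib mult.assoc[symmetric] mult_right_mono mult_left_mono)
  qed
  from termdiffs_strong_converges_everywhere[OF this, of 0]
  have "((\<lambda>z. \<Sum>k. ?c k * z ^ k) has_field_derivative diffs ?c 0) (at 0)"
    unfolding powser_zero .
  then have "((\<lambda>z. \<Sum>k. ?c k * z ^ k) has_field_derivative A $ i $ j) (at (of_real 0))"
    by (simp add: diffs_def)
  from has_vector_derivative_real_field[OF this]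
  have "((\<lambda>t::real. \<Sum>k. ?c k * of_real t ^ k) has_vector_derivative A $ i $ j) (at 0)" by simp
  moreover have "(\<Sum>k. ?c k * of_real t ^ k) = mexp (t *\<^sub>R A) $ i $ j" for t :: real
    using mexp_entry_sums[of "t *\<^sub>R A" i j]
    by (simp add: sums_iff matpow_scaleR scaleR_conv_of_real[where 'a = complex] mult_ac)
  ultimately show ?thesis by simp
qed

text \<open>Along the line \<open>t *\<^sub>R A\<close> the quotient \<open>f\<close> of the two
  sides is multiplicative in \<open>t\<close>. Hence its vanishing derivative at 0 propagates to
  every \<open>t\<close>, and \<open>f\<close> is constant.\<close>

lemma det_mexp: "det (mexp A) = exp (trace (A :: complex ^ 'm ^ ('m::finite)))"
proof -
  define f where "f = (\<lambda>t. det (mexp (t *\<^sub>R A)) * exp (- (t *\<^sub>R trace A)))"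
  have mult: "f (s + t) = f s * f t" for s t
    unfolding f_def mexp_scaleR_add det_mul by (simp add: scaleR_add_left exp_add[symmetric])
  have "((\<lambda>t. det (mexp (t *\<^sub>R A))) has_vector_derivative trace A) (at 0)"
    by (rule has_derivative_det_one) (simp_all add: mexp_zero mexp_entry_deriv)
  moreover have "((\<lambda>t::real. exp (- (t *\<^sub>R trace A))) has_vector_derivative (- trace A)) (at 0)"
    using exp_scaleR_has_vector_derivative_right[of "- trace A" 0 UNIV] by simp
  ultimately have "(f has_vector_derivative (det (mexp (0 *\<^sub>R A)) * (- trace A) + trace A * exp (- (0 *\<^sub>R trace A)))) (at 0)"
    unfolding f_def by (rule has_vector_derivative_mult)
  then have f0: "(f has_vector_derivative 0) (at 0)" by (simp add: mexp_zero)
  have "(f has_vector_derivative 0) (at t)" for t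
  proof -
    have "((f \<circ> (\<lambda>x. x - t)) has_vector_derivative (1 *\<^sub>R 0)) (at t)"
      using f0 by (intro vector_diff_chain_at) (auto intro!: derivative_eq_intros)
    then have "((\<lambda>x. f t * (f \<circ> (\<lambda>x. x - t)) x) has_vector_derivative f t * (1 *\<^sub>R 0)) (at t)"
      by (rule has_vector_derivative_mult_right)
    moreover have "(\<lambda>x. f t * (f \<circ> (\<lambda>x. x - t)) x) = f"
      by (simp add: fun_eq_iff mult[symmetric])
    ultimately show ?thesis by simp
  qed
  then have "\<exists>c. \<forall>x\<in>UNIV. f x = c"
    by (intro has_derivative_zero_constant) (auto simp: has_vector_derivative_def)
  then have "f 1 = f 0" by auto
  then show ?thesis by (simp add: f_def mexp_zero exp_minus field_simps)
qed

section \<open>Linear changes of variables and Gaussian integrals\<close>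

text \<open>Domination by \<open>1 / (1 + t\<^sup>2)\<close>, whose integral over each half line is
  read off from the arctangent.\<close>

lemma gauss_line_finite: "(\<integral>\<^sup>+(t::real). ennreal (exp (- t\<^sup>2)) \<partial>lborel) < \<infinity>"
proof -
  let ?h = "\<lambda>t::real. ennreal (inverse (1 + t\<^sup>2))"
  have h: "(\<integral>\<^sup>+t. ?h t * indicator {0..} t \<partial>lborel) = ennreal (pi / 2 - arctan 0)"
    by (rule nn_integral_FTC_atLeast)
       (auto intro!: DERIV_arctan tendsto_arctan_at_top tendsto_eq_intros
          simp: add_nonneg_pos add_nonneg_eq_0_iff)
  have "(\<integral>\<^sup>+t. ?h t * indicator {..0} t \<partial>lborel) = (\<integral>\<^sup>+t. ?h t * indicator {0..} t \<partial>lborel)"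
    by (subst nn_integral_real_affine[of _ "-1" 0]) (auto intro!: nn_integral_cong split: split_indicator)
  with h have h': "(\<integral>\<^sup>+t. ?h t * indicator {..0} t \<partial>lborel) = ennreal (pi / 2 - arctan 0)" by simp
  have "(\<integral>\<^sup>+(t::real). ennreal (exp (- t\<^sup>2)) \<partial>lborel)
      \<le> (\<integral>\<^sup>+t. ?h t * indicator {0..} t + ?h t * indicator {..0} t \<partial>lborel)"
  proof (rule nn_integral_mono)
    fix t :: real
    have "exp (- t\<^sup>2) \<le> inverse (1 + t\<^sup>2)"
      unfolding exp_minus by (intro le_imp_inverse_le exp_ge_add_one_self) (simp add: add_pos_nonneg)
    then have "ennreal (exp (- t\<^sup>2)) \<le> ?h t" by (rule ennreal_leI)
    then show "ennreal (exp (- t\<^sup>2)) \<le> ?h t * indicator {0..} t + ?h t * indicator {..0} t"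
      by (cases "t \<ge> 0") (auto split: split_indicator simp: add_increasing add_increasing2)
  qed
  also have "\<dots> = ennreal (pi / 2 - arctan 0) + ennreal (pi / 2 - arctan 0)"
    by (subst nn_integral_add) (simp_all add: h h')
  also have "\<dots> < \<infinity>" by simp
  finally show ?thesis .
qed

definition gauss :: "'a::euclidean_space \<Rightarrow> ennreal" where
  "gauss x = ennreal (exp (- (norm x)\<^sup>2))"

lemma gauss_measurable [measurable]: "gauss \<in> borel_measurable borel"
  unfolding gauss_def[abs_def] by measurable

lemma gauss_finite: "(\<integral>\<^sup>+(x::'a::euclidean_space). gauss x \<partial>lborel) < \<infinity>"
proof -
  have "(\<integral>\<^sup>+(x::'a). gauss x \<partial>lborel) = (\<integral>\<^sup>+(x::'a). (\<Prod>b\<in>Basis. ennreal (exp (- (x \<bullet> b)\<^sup>2))) \<partial>lborel)"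
  proof (rule nn_integral_cong)
    fix x :: 'a
    have "(norm x)\<^sup>2 = (\<Sum>b\<in>Basis. (x \<bullet> b)\<^sup>2)"
      unfolding power2_norm_eq_inner by (subst euclidean_inner) (simp add: power2_eq_square)
    then show "gauss x = (\<Prod>b\<in>Basis. ennreal (exp (- (x \<bullet> b)\<^sup>2)))"
      by (simp add: gauss_def prod_ennreal exp_sum[symmetric] sum_negf)
  qed
  also have "\<dots> = (\<Prod>b\<in>(Basis::'a set). (\<integral>\<^sup>+t. ennreal (exp (- t\<^sup>2)) \<partial>lborel))"
    by (rule nn_integral_lborel_prod) auto
  also have "\<dots> < \<infinity>"
    using gauss_line_finite by (simp add: power_less_top_ennreal)
  finally show ?thesis .
qed

lemma nn_integral_exp_pos:
  assumes [measurable]: "f \<in> borel_measurable borel"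
  shows "(\<integral>\<^sup>+(x::'a::euclidean_space). ennreal (exp (f x)) \<partial>lborel) > 0"
proof (rule ccontr)
  assume "\<not> ?thesis"
  then have "AE (x::'a) in lborel. ennreal (exp (f x)) = 0"
    by (subst (asm) not_gr_zero, subst (asm) nn_integral_0_iff_AE) auto
  then have "AE (x::'a) in lborel. False" by simp
  then show False
    by (simp add: eventually_False ae_filter_eq_bot_iff)
qed

lemma nn_integral_translate:
  fixes f :: "'a::euclidean_space \<Rightarrow> ennreal"
  assumes [measurable]: "f \<in> borel_measurable borel"
  shows "(\<integral>\<^sup>+x. f (c + x) \<partial>lborel) = (\<integral>\<^sup>+x. f x \<partial>lborel)"
  by (subst (2) lborel_distr_plus[symmetric, of c], subst nn_integral_distr) auto

lemma linear_measurable: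
  fixes L :: "'a::euclidean_space \<Rightarrow> 'b::euclidean_space"
  shows "linear L \<Longrightarrow> L \<in> borel_measurable borel"
  by (intro borel_measurable_continuous_onI linear_continuous_on) (simp add: linear_conv_bounded_linear)

text \<open>Uniqueness of Haar measure: the double integral of f (L x + y) g (- L x) is evaluated in both orders.\<close>

lemma nn_integral_linear_gauss:
  fixes L :: "'a::euclidean_space \<Rightarrow> 'a" and f :: "'a \<Rightarrow> ennreal"
  assumes L: "linear L" "bij L" and f[measurable]: "f \<in> borel_measurable borel"
  shows "(\<integral>\<^sup>+x. f (L x) \<partial>lborel) * (\<integral>\<^sup>+(x::'a). gauss x \<partial>lborel) = (\<integral>\<^sup>+x. gauss (L x) \<partial>lborel) * (\<integral>\<^sup>+x. f x \<partial>lborel)"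
proof -
  have [measurable]: "L \<in> borel_measurable borel" using L by (rule_tac linear_measurable)
  let ?g = "gauss :: 'a \<Rightarrow> ennreal"
  have Ls: "L (inv L y + x) = y + L x" for x y
    by (simp add: linear_add[OF L(1)] surj_f_inv_f bij_is_surj L(2))
  have "(\<integral>\<^sup>+x. f (L x) \<partial>lborel) * (\<integral>\<^sup>+x. ?g x \<partial>lborel) = (\<integral>\<^sup>+x. (\<integral>\<^sup>+y. f (L x) * ?g y \<partial>lborel) \<partial>lborel)"
    by (simp add: nn_integral_cmult nn_integral_multc)
  \<comment> \<open>The translations move \<open>L x\<close> from \<open>f\<close> to the Gaussian:
    \<open>y\<close> is shifted by \<open>- L x\<close> and, after the exchange of the integrals,
    \<open>x\<close> by \<open>inv L y\<close>. The evenness of \<open>gauss\<close> removes the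
    sign.\<close>
  also have "\<dots> = (\<integral>\<^sup>+x. (\<integral>\<^sup>+y. f (L x) * ?g (- L x + y) \<partial>lborel) \<partial>lborel)"
    by (subst nn_integral_translate[where f = "\<lambda>y. f (L _) * ?g y"]) auto
  also have "\<dots> = (\<integral>\<^sup>+y. (\<integral>\<^sup>+x. f (L x) * ?g (- L x + y) \<partial>lborel) \<partial>lborel)"
    by (rule lborel_pair.Fubini') measurable
  also have "\<dots> = (\<integral>\<^sup>+y. (\<integral>\<^sup>+x. f (y + L x) * ?g (- L x) \<partial>lborel) \<partial>lborel)"
  proof (rule nn_integral_cong)
    fix y
    have "(\<integral>\<^sup>+x. f (L x) * ?g (- L x + y) \<partial>lborel) = (\<integral>\<^sup>+x. f (L (inv L y + x)) * ?g (- L (inv L y + x) + y) \<partial>lborel)"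
      by (rule nn_integral_translate[symmetric]) measurable
    then show "(\<integral>\<^sup>+x. f (L x) * ?g (- L x + y) \<partial>lborel) = (\<integral>\<^sup>+x. f (y + L x) * ?g (- L x) \<partial>lborel)"
      by (simp add: Ls)
  qed
  also have "\<dots> = (\<integral>\<^sup>+x. (\<integral>\<^sup>+y. f (y + L x) * ?g (- L x) \<partial>lborel) \<partial>lborel)"
    by (rule lborel_pair.Fubini') measurable
  also have "\<dots> = (\<integral>\<^sup>+x. (\<integral>\<^sup>+y. f y \<partial>lborel) * ?g (- L x) \<partial>lborel)"
    by (subst nn_integral_multc) (auto simp: nn_integral_translate add.commute[of _ "L _"])
  also have "\<dots> = (\<integral>\<^sup>+y. f y \<partial>lborel) * (\<integral>\<^sup>+x. ?g (L x) \<partial>lborel)"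
    by (subst nn_integral_cmult) (auto simp: gauss_def)
  finally show ?thesis by (simp add: mult.commute)
qed

lemma ennreal_cancel:
  assumes "a * c = b * (c :: ennreal)" "c > 0" "c < \<infinity>"
  shows "a = b"
  using assms by (metis mult_divide_eq_ennreal less_irrefl infinity_ennreal_def)

lemma gauss_pos: "(\<integral>\<^sup>+(x::'a::euclidean_space). gauss x \<partial>lborel) > 0"
  unfolding gauss_def by (rule nn_integral_exp_pos) measurable

lemma nn_integral_isometry:
  fixes L :: "'a::euclidean_space \<Rightarrow> 'a" and f :: "'a \<Rightarrow> ennreal"
  assumes L: "linear L" "bij L" and n: "\<And>x. norm (L x) = norm x" and f: "f \<in> borel_measurable borel"
  shows "(\<integral>\<^sup>+x. f (L x) \<partial>lborel) = (\<integral>\<^sup>+x. f x \<partial>lborel)"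
proof (rule ennreal_cancel[of _ "\<integral>\<^sup>+(x::'a). gauss x \<partial>lborel"])
  have "gauss (L x) = gauss x" for x by (simp add: gauss_def n)
  then show "(\<integral>\<^sup>+x. f (L x) \<partial>lborel) * (\<integral>\<^sup>+(x::'a). gauss x \<partial>lborel) = (\<integral>\<^sup>+x. f x \<partial>lborel) * (\<integral>\<^sup>+(x::'a). gauss x \<partial>lborel)"
    using nn_integral_linear_gauss[OF L f] by (simp only: mult.commute)
qed (rule gauss_pos gauss_finite)+

lemma bij_matrix:
  assumes "det (V :: complex ^ 'n ^ 'n) \<noteq> 0"
  shows "bij ((*v) V)"
  using assms by (simp add: invertible_det_nz[symmetric] invertible_eq_bij)

lemma nn_integral_unitary:
  fixes U :: "complex ^ 'n ^ 'n" and f :: "complex ^ 'n \<Rightarrow> ennreal"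
  assumes U: "hadj U ** U = mat 1" and f: "f \<in> borel_measurable borel"
  shows "(\<integral>\<^sup>+x. f (U *v x) \<partial>lborel) = (\<integral>\<^sup>+x. f x \<partial>lborel)"
proof (rule nn_integral_isometry[OF linear_matrix_vector _ _ f])
  show "bij ((*v) U)" using left_inverse_det[OF U] by (intro bij_matrix) simp
  show "norm (U *v x) = norm x" for x
  proof -
    have "hip (U *v x) (U *v x) = hip x x"
      by (simp add: hip_adj matrix_vector_mul_assoc U)
    then have "(norm (U *v x))\<^sup>2 = (norm x)\<^sup>2" unfolding hip_self using of_real_eq_iff by blast
    then show ?thesis by simp
  qed
qed

lemma Basis_complex_vec:
  "(\<Prod>b\<in>(Basis :: (complex ^ 'n) set). f b) = (\<Prod>i\<in>UNIV. f (axis i 1) * f (axis i \<i>))"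
  "(\<Sum>b\<in>(Basis :: (complex ^ 'n) set). g b) = (\<Sum>i\<in>UNIV. g (axis i 1) + g (axis i \<i>))"
proof -
  have eq: "(Basis :: (complex ^ 'n) set) = (\<lambda>i. axis i 1) ` UNIV \<union> (\<lambda>i. axis i \<i>) ` UNIV"
    by (auto simp: Basis_vec_def Basis_complex_def)
  have disj: "(\<lambda>i. axis i 1 :: complex ^ 'n) ` UNIV \<inter> (\<lambda>i. axis i \<i>) ` UNIV = {}"
    by (auto simp: axis_eq_axis)
  have inj: "inj (\<lambda>i. axis i 1 :: complex ^ 'n)" "inj (\<lambda>i. axis i \<i> :: complex ^ 'n)"
    by (auto intro!: injI simp: axis_eq_axis)
  show "(\<Prod>b\<in>(Basis :: (complex ^ 'n) set). f b) = (\<Prod>i\<in>UNIV. f (axis i 1) * f (axis i \<i>))"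
    unfolding eq by (subst prod.union_disjoint[OF _ _ disj]) (simp_all add: prod.reindex inj prod.distrib)
  show "(\<Sum>b\<in>(Basis :: (complex ^ 'n) set). g b) = (\<Sum>i\<in>UNIV. g (axis i 1) + g (axis i \<i>))"
    unfolding eq by (subst sum.union_disjoint[OF _ _ disj]) (simp_all add: sum.reindex inj sum.distrib)
qed

lemma nn_integral_scale_components:
  fixes f :: "complex ^ 'n \<Rightarrow> ennreal"
  assumes p: "\<And>i. p i > 0" "\<And>i. q i > 0" and f[measurable]: "f \<in> borel_measurable borel"
  shows "(\<integral>\<^sup>+x. f x \<partial>lborel) =
    ennreal (\<Prod>i\<in>UNIV. p i * q i) * (\<integral>\<^sup>+x. f (\<chi> i. Complex (p i * Re (x $ i)) (q i * Im (x $ i))) \<partial>lborel)"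
proof -
  \<comment> \<open>The library rule asks for one scaling factor per element of
    \<open>Basis\<close>. This formula gives \<open>p i\<close> at \<open>axis i 1\<close> and
    \<open>q i\<close> at \<open>axis i \<i>\<close> without a case distinction.\<close>
  let ?c = "\<lambda>b :: complex ^ 'n. \<Sum>i\<in>UNIV. p i * (Re (b $ i))\<^sup>2 + q i * (Im (b $ i))\<^sup>2"
  let ?T = "\<lambda>x. 0 + (\<Sum>b\<in>Basis. (?c b * (x \<bullet> b)) *\<^sub>R b)"
  have c1: "?c (axis i 1) = p i" for i
    by (subst sum.remove[of _ i]) (auto simp: axis_def intro!: sum.neutral)
  have c2: "?c (axis i \<i>) = q i" for i
    by (subst sum.remove[of _ i]) (auto simp: axis_def intro!: sum.neutral)
  have c0: "?c b > 0" if "b \<in> Basis" for b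
  proof -
    from that obtain i where "b = axis i 1 \<or> b = axis i \<i>" by (auto simp: Basis_vec_def Basis_complex_def)
    then show ?thesis using c1[of i] c2[of i] p by auto
  qed
  have T: "?T x = (\<chi> i. Complex (p i * Re (x $ i)) (q i * Im (x $ i)))" for x
  proof -
    have "x \<bullet> axis i 1 = Re (x $ i)" "x \<bullet> axis i \<i> = Im (x $ i)" for i
      by (simp_all add: inner_axis inner_complex_def)
    then have Tx: "?T x = (\<Sum>i\<in>UNIV. (p i * Re (x $ i)) *\<^sub>R axis i 1 + (q i * Im (x $ i)) *\<^sub>R axis i \<i>)"
      by (simp only: Basis_complex_vec c1 c2 add_0_left)
    show ?thesis unfolding Tx vec_eq_iff
      by (simp add: axis_def sum.distrib if_distrib if_distribR complex_eq_iff cong: if_cong)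
  qed
  have [measurable]: "?T \<in> borel_measurable borel" by measurable
  have "(\<integral>\<^sup>+x. f x \<partial>lborel) = (\<integral>\<^sup>+x. f x \<partial>density (distr lborel borel ?T) (\<lambda>_. (\<Prod>j\<in>Basis. \<bar>?c j\<bar>)))"
  proof (rule arg_cong[where f = "\<lambda>M. nn_integral M f"], rule lborel_affine_euclidean)
    show "?c j \<noteq> 0" if "j \<in> Basis" for j using c0[OF that] by linarith
  qed
  also have "\<dots> = ennreal (\<Prod>j\<in>Basis. \<bar>?c j\<bar>) * (\<integral>\<^sup>+x. f (?T x) \<partial>lborel)"
    by (simp add: nn_integral_density nn_integral_cmult nn_integral_distr)
  also have "(\<Prod>j\<in>Basis. \<bar>?c j\<bar>) = (\<Prod>i\<in>UNIV. p i * q i)"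
    unfolding Basis_complex_vec c1 c2 using p by (simp add: less_imp_le)
  finally show ?thesis unfolding T .
qed

text \<open>Singular value decomposition \<open>V = W ** D ** hadj U\<close>: the unitary factors
  preserve the measure, and \<open>D\<close> scales the real and the imaginary part of coordinate
  \<open>i\<close> by \<open>sqrt (k i)\<close> each, hence the area by \<open>k i\<close>. The
  product of the \<open>k i\<close> is the determinant of \<open>hadj V ** V\<close>.\<close>

lemma nn_integral_complex_linear:
  fixes V :: "complex ^ 'n ^ 'n" and f :: "complex ^ 'n \<Rightarrow> ennreal"
  assumes V: "det V \<noteq> 0" and f[measurable]: "f \<in> borel_measurable borel"
  shows "(\<integral>\<^sup>+x. f x \<partial>lborel) = ennreal ((norm (det V))\<^sup>2) * (\<integral>\<^sup>+x. f (V *v x) \<partial>lborel)"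
proof -
  have mm: "(*v) A \<in> borel_measurable borel" for A :: "complex ^ 'n ^ 'n"
    by (rule linear_measurable[OF linear_matrix_vector])
  note [measurable] = mm
  obtain U :: "complex ^ 'n ^ 'n" and k where U: "hadj U ** U = mat 1" "hadj U ** (hadj V ** V) ** U = diagm k"
    using hermitian_diagonalize[of "hadj V ** V"] by (auto simp: hadj_mult)
  have dU: "det U \<noteq> 0" using left_inverse_det[OF U(1)] by simp
  have k: "k i > 0" for i
  proof -
    let ?x = "V *v (U *v axis i 1)"
    have "?x \<noteq> 0" using det_inj[OF dU] det_inj[OF V] by (metis axis_eq_0_iff one_neq_zero)
    then have "0 < Re (hip ?x ?x)" by (simp add: hip_self)
    also have "hip ?x ?x = hip (axis i 1) ((hadj U ** (hadj V ** V) ** U) *v axis i 1)"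
      by (simp add: hip_adj hadj_mult matrix_vector_mul_assoc matrix_mul_assoc)
    also have "Re \<dots> = k i" unfolding U(2) diagm_axis by simp
    finally show ?thesis .
  qed
  define D where "D = diagm (\<lambda>i. sqrt (k i))"
  define W where "W = V ** U ** diagm (\<lambda>i. 1 / sqrt (k i))"
  have "hadj W ** W = diagm (\<lambda>i. 1 / sqrt (k i)) ** (hadj U ** (hadj V ** V) ** U) ** diagm (\<lambda>i. 1 / sqrt (k i))"
    by (simp add: W_def hadj_mult matrix_mul_assoc)
  also have "\<dots> = diagm (\<lambda>i. 1)"
  proof -
    have "1 / sqrt (k i) * k i * (1 / sqrt (k i)) = 1" for i using k[of i] by (simp add: field_simps)
    then show ?thesis by (simp only: U(2) diagm_mult)
  qed
  finally have W: "hadj W ** W = mat 1" by (simp add: diagm_one)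
  have U': "U ** hadj U = mat 1" using U(1) by (simp add: matrix_left_right_inverse)
  have "diagm (\<lambda>i. 1 / sqrt (k i)) ** D = mat 1"
    using k by (simp add: D_def diagm_mult diagm_one less_imp_neq[symmetric])
  then have V_eq: "V = W ** D ** hadj U"
    unfolding W_def by (metis U' matrix_mul_assoc matrix_mul_rid)
  have "(\<integral>\<^sup>+x. f (V *v x) \<partial>lborel) = (\<integral>\<^sup>+x. f (W *v (D *v (hadj U *v x))) \<partial>lborel)"
    by (simp add: V_eq matrix_vector_mul_assoc matrix_mul_assoc)
  also have "\<dots> = (\<integral>\<^sup>+x. f (W *v (D *v x)) \<partial>lborel)"
    by (rule nn_integral_unitary[where f = "\<lambda>x. f (W *v (D *v x))"]) (use U' in simp, measurable)
  finally have 1: "(\<integral>\<^sup>+x. f (V *v x) \<partial>lborel) = (\<integral>\<^sup>+x. f (W *v (D *v x)) \<partial>lborel)" .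
  have "(\<integral>\<^sup>+x. f x \<partial>lborel) = (\<integral>\<^sup>+x. f (W *v x) \<partial>lborel)"
    by (rule nn_integral_unitary[OF W f, symmetric])
  also have "\<dots> = ennreal (\<Prod>i\<in>UNIV. sqrt (k i) * sqrt (k i)) *
      (\<integral>\<^sup>+x. f (W *v (\<chi> i. Complex (sqrt (k i) * Re (x $ i)) (sqrt (k i) * Im (x $ i)))) \<partial>lborel)"
    by (rule nn_integral_scale_components) (use k in auto)
  also have "(\<lambda>x. \<chi> i. Complex (sqrt (k i) * Re (x $ i)) (sqrt (k i) * Im (x $ i))) = (*v) D"
    by (simp add: fun_eq_iff D_def diagm_vec vec_eq_iff complex_eq_iff)
  finally have 2: "(\<integral>\<^sup>+x. f x \<partial>lborel) = ennreal (\<Prod>i\<in>UNIV. k i) * (\<integral>\<^sup>+x. f (W *v (D *v x)) \<partial>lborel)"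
    using k by (simp add: less_imp_le fun_eq_iff)
  have "complex_of_real (\<Prod>i\<in>UNIV. k i) = cnj (det U) * (cnj (det V) * det V) * det U"
    by (simp only: det_diagm[symmetric] U(2)[symmetric] det_mul det_hadj)
  moreover have "cnj (det U) * det U = 1"
    using arg_cong[OF U(1), of det] by (simp add: det_mul det_hadj)
  ultimately have "complex_of_real (\<Prod>i\<in>UNIV. k i) = det V * cnj (det V)" by (simp add: mult_ac)
  then have "(\<Prod>i\<in>UNIV. k i) = (norm (det V))\<^sup>2"
    unfolding complex_norm_square[symmetric] using of_real_eq_iff by blast
  then show ?thesis using 1 2 by simp
qed

section \<open>Gaussian integrals of real quadratic forms\<close>

lemma rq_measurable [measurable]: "rq H B \<in> borel_measurable borel"
proof -
  have "rl H B \<in> borel_measurable borel" by (rule linear_measurable[OF linear_rl])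
  then show ?thesis unfolding rq_inner[abs_def] by measurable
qed

lemma rq_i: "rq H B (\<i> *s x) = Re (hip x (H *v x)) - Re (cdot x (B *v x))"
  by (simp add: rq_def matrix_smult hip_simps cdot_simps)

text \<open>Adding the values at \<open>x\<close> and at \<open>\<i> *s x\<close> cancels the
  pluriharmonic part and leaves twice the Hermitian part.\<close>

lemma posdef_of_rq:
  assumes "hadj H = H" "\<And>x. x \<noteq> 0 \<Longrightarrow> rq H B x > 0"
  shows "posdef H"
  unfolding posdef_def
proof (intro conjI allI impI)
  fix x :: "complex ^ 'a" assume x: "x \<noteq> 0"
  then have "\<i> *s x \<noteq> 0" by simp
  then show "Re (hip x (H *v x)) > 0"
    using assms(2)[OF x] assms(2)[of "\<i> *s x"] by (simp add: rq_i) (simp add: rq_def)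
qed (rule assms)

lemma rq_congruence: "rq H B (V *v x) = rq (hadj V ** H ** V) (transpose V ** B ** V) x"
  unfolding rq_def hip_congruence by (simp add: cdot_matrix matrix_vector_mul_assoc matrix_mul_assoc)

lemma rq_diag: "rq (mat 1) (diagm k) x = (\<Sum>i\<in>UNIV. (1 + k i) * (Re (x $ i))\<^sup>2 + (1 - k i) * (Im (x $ i))\<^sup>2)"
  by (simp add: rq_def hip_def cdot_def cnj_vec_def diagm_vec sum.distrib[symmetric] algebra_simps power2_eq_square)

lemma Wm_congruence:
  "blk (hadj V) 0 0 (transpose V) ** Wm H B ** blk V 0 0 (cnj_mat V) =
   Wm (hadj V ** H ** V) (transpose V ** B ** V)"
  by (simp add: Wm_def blk_mult hadj_def)

lemma det_Wm_diag: "det (Wm (mat 1) (diagm k)) = complex_of_real (\<Prod>i\<in>UNIV. (1 + k i) * (1 - k i))"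
proof -
  have e: "mat 1 = diagm k ** diagm k + diagm (\<lambda>i. (1 + k i) * (1 - k i))"
    unfolding diagm_mult by (auto simp: diagm_def mat_def vec_eq_iff algebra_simps)
  have "Wm (mat 1) (diagm k) = blk (mat 1) 0 (diagm k) (mat 1) ** blk (mat 1) (diagm k) 0 (diagm (\<lambda>i. (1 + k i) * (1 - k i)))"
    by (simp add: Wm_def blk_mult e[symmetric])
  then show ?thesis by (simp add: det_mul det_blk_lower det_blk_upper det_diagm)
qed

text \<open>The n-th power of \<pi>; it stays abstract because only quotients of Gaussian integrals
  occur.\<close>

definition gauss_const :: "'n::finite itself \<Rightarrow> real" where
  "gauss_const _ = enn2real (\<integral>\<^sup>+(x::complex ^ 'n). gauss x \<partial>lborel)"

lemma gauss_const: "(\<integral>\<^sup>+(x::complex ^ 'n). gauss x \<partial>lborel) = ennreal (gauss_const TYPE('n))" "gauss_const TYPE('n) > 0"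
  using gauss_finite[where 'a = "complex ^ 'n"] gauss_pos[where 'a = "complex ^ 'n"]
  by (auto simp: gauss_const_def enn2real_positive_iff)

text \<open>In the coordinates of \<open>takagi_pencil\<close> the form is a sum of real squares
  with coefficients \<open>1 + k i\<close> and \<open>1 - k i\<close>, whose product is |det V|^4
  times the determinant of \<open>Wm H B\<close>. This is the usual inverse square root law, stated
  as constancy of \<open>Z\<^sup>2 * d\<close> so that two forms can be compared without
  roots.\<close>

lemma gaussian_integral:
  fixes H B :: "complex ^ 'n ^ 'n"
  assumes H: "hadj H = H" and B: "transpose B = B" and pos: "\<And>x. x \<noteq> 0 \<Longrightarrow> rq H B x > 0"
  obtains Z d where "Z > 0" "d > 0" "(\<integral>\<^sup>+x. ennreal (exp (- rq H B x)) \<partial>lborel) = ennreal Z"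
    "det (Wm H B) = complex_of_real d" "Z\<^sup>2 * d = (gauss_const TYPE('n))\<^sup>2"
proof -
  obtain V :: "complex ^ 'n ^ 'n" and k where V: "det V \<noteq> 0" "hadj V ** H ** V = mat 1" "transpose V ** B ** V = diagm k"
    using takagi_pencil[OF posdef_of_rq[OF H pos] B] by blast
  have VQ: "rq H B (V *v x) = (\<Sum>i\<in>UNIV. (1 + k i) * (Re (x $ i))\<^sup>2 + (1 - k i) * (Im (x $ i))\<^sup>2)" for x
    by (simp only: rq_congruence V rq_diag)
  have k: "1 + k i > 0" "1 - k i > 0" for i
  proof -
    have "V *v axis i 1 \<noteq> 0" "V *v axis i \<i> \<noteq> 0" using det_inj[OF V(1)] by (metis axis_eq_0_iff one_neq_zero complex_i_not_zero)+
    then have *: "rq H B (V *v axis i 1) > 0" "rq H B (V *v axis i \<i>) > 0" using pos by auto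
    show "1 + k i > 0" using *(1) unfolding VQ by (subst (asm) sum.remove[of _ i]) (auto simp: axis_def)
    show "1 - k i > 0" using *(2) unfolding VQ by (subst (asm) sum.remove[of _ i]) (auto simp: axis_def)
  qed
  define s where "s = (\<Prod>i\<in>UNIV. sqrt (1 + k i) * sqrt (1 - k i))"
  have s: "s > 0" unfolding s_def using k by (intro prod_pos) auto
  have s2: "s\<^sup>2 = (\<Prod>i\<in>UNIV. (1 + k i) * (1 - k i))"
    unfolding s_def prod_power_distrib using k
    by (intro prod.cong) (auto simp: power_mult_distrib less_imp_le)
  let ?c = "gauss_const TYPE('n)" and ?D = "(norm (det V))\<^sup>2"
  have D: "?D > 0" using V(1) by simp
  have "ennreal ?c = ennreal s * (\<integral>\<^sup>+x. gauss (\<chi> i. Complex (sqrt (1 + k i) * Re (x $ i)) (sqrt (1 - k i) * Im (x $ i)) :: complex ^ 'n) \<partial>lborel)"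
    unfolding gauss_const(1)[symmetric] s_def by (rule nn_integral_scale_components) (use k in auto)
  also have "(\<integral>\<^sup>+x. gauss (\<chi> i. Complex (sqrt (1 + k i) * Re (x $ i)) (sqrt (1 - k i) * Im (x $ i)) :: complex ^ 'n) \<partial>lborel)
      = (\<integral>\<^sup>+x. ennreal (exp (- rq H B (V *v x))) \<partial>lborel)"
  proof (rule nn_integral_cong)
    fix x :: "complex ^ 'n"
    have "(norm (\<chi> i. Complex (sqrt (1 + k i) * Re (x $ i)) (sqrt (1 - k i) * Im (x $ i)) :: complex ^ 'n))\<^sup>2 = rq H B (V *v x)"
      unfolding VQ power2_norm_eq_inner inner_vec_def inner_complex_def
      using k by (intro sum.cong) (auto simp: power2_eq_square[symmetric] power_mult_distrib less_imp_le)
    then show "gauss (\<chi> i. Complex (sqrt (1 + k i) * Re (x $ i)) (sqrt (1 - k i) * Im (x $ i)) :: complex ^ 'n) = ennreal (exp (- rq H B (V *v x)))"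
      by (simp add: gauss_def)
  qed
  finally have 1: "ennreal ?c = ennreal s * (\<integral>\<^sup>+x. ennreal (exp (- rq H B (V *v x))) \<partial>lborel)" .
  have 2: "(\<integral>\<^sup>+x. ennreal (exp (- rq H B x)) \<partial>lborel) = ennreal ?D * (\<integral>\<^sup>+x. ennreal (exp (- rq H B (V *v x))) \<partial>lborel)"
    by (rule nn_integral_complex_linear[OF V(1)]) measurable
  let ?I = "\<integral>\<^sup>+x. ennreal (exp (- rq H B (V *v x))) \<partial>lborel"
  have "?I = ennreal (?c / s)"
  proof (rule ennreal_cancel[of _ "ennreal s"])
    show "?I * ennreal s = ennreal (?c / s) * ennreal s"
      using 1 s gauss_const(2)[where 'n = 'n] by (simp add: mult.commute ennreal_mult'[symmetric])
  qed (use s in auto)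
  then have I: "(\<integral>\<^sup>+x. ennreal (exp (- rq H B x)) \<partial>lborel) = ennreal (?D * (?c / s))"
    using 2 D gauss_const(2)[where 'n = 'n] s by (simp add: ennreal_mult'[symmetric])
  have "cnj (det V) * det V * det (Wm H B) * (det V * cnj (det V)) = complex_of_real (s\<^sup>2)"
    using arg_cong[OF Wm_congruence[of V H B], of det]
    unfolding V det_Wm_diag s2 det_mul det_blk_lower det_hadj det_transpose det_cnj_mat by simp
  then have "complex_of_real (?D * ?D) * det (Wm H B) = complex_of_real (s\<^sup>2)"
    unfolding of_real_mult complex_norm_square by (simp add: mult_ac)
  then have dW: "det (Wm H B) = complex_of_real (s\<^sup>2 / (?D * ?D))"
    using D by (simp add: field_simps)
  show ?thesis
  proof (rule that[OF _ _ I dW])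
    show "?D * (?c / s) > 0" "s\<^sup>2 / (?D * ?D) > 0" using D s gauss_const(2)[where 'n = 'n] by auto
    show "(?D * (?c / s))\<^sup>2 * (s\<^sup>2 / (?D * ?D)) = ?c\<^sup>2" using V(1) s
      by (simp add: power2_eq_square)
  qed
qed

section \<open>Domination of Gaussian weights on holomorphic functions\<close>

lemma holo_continuous: "holo h \<Longrightarrow> continuous_on UNIV h"
  unfolding holo_def using has_derivative_continuous by (blast intro: continuous_at_imp_continuous_on)

lemma holo_measurable: "holo h \<Longrightarrow> h \<in> borel_measurable borel"
  by (intro borel_measurable_continuous_onI holo_continuous)

text \<open>Restriction to a complex line through the origin, where one-variable function theory
  applies.\<close>

lemma holo_disc:
  assumes "holo h"
  shows "(\<lambda>z. h (z *s t)) holomorphic_on UNIV"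
unfolding holomorphic_on_def field_differentiable_def
proof
  fix z
  obtain L where L: "(h has_derivative L) (at (z *s t))" "\<And>c w. L (c *s w) = c * L w"
    using assms unfolding holo_def by blast
  have "linear (\<lambda>z. z *s t)" by (rule linearI) (simp_all add: vec_eq_iff algebra_simps)
  then have "((\<lambda>z. z *s t) has_derivative (\<lambda>z. z *s t)) (at z)"
    by (intro bounded_linear.has_derivative[of "\<lambda>z. z *s t", OF _ has_derivative_ident])
       (simp add: linear_conv_bounded_linear)
  from diff_chain_at[OF this L(1)] have "((\<lambda>z. h (z *s t)) has_derivative (\<lambda>c. c * L t)) (at z)"
    by (simp add: o_def L(2))
  then show "\<exists>f'. ((\<lambda>z. h (z *s t)) has_field_derivative f') (at z within UNIV)"
    unfolding has_field_derivative_def by (intro exI[of _ "L t"]) (simp only: mult.commute[of _ "L t"])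
qed

text \<open>Cauchy's formula is applied to the square of \<open>h\<close>: its value at 0 is its
  mean over the circle, and the modulus of a mean is at most the mean of the modulus.\<close>

lemma circle_mean_square:
  fixes h :: "complex \<Rightarrow> complex"
  assumes h: "h holomorphic_on UNIV"
  shows "ennreal ((norm (h 0))\<^sup>2) \<le> (\<integral>\<^sup>+\<theta>. ennreal ((norm (h (cis (2 * pi * \<theta>))))\<^sup>2) * indicator {0..1} \<theta> \<partial>lborel)"
proof -
  let ?e = "\<lambda>x::real. cis (2 * pi * x)"
  have hc: "continuous_on UNIV h" by (rule holomorphic_on_imp_continuous_on[OF h])
  have ce: "continuous_on S ?e" for S by (intro continuous_intros)
  have che: "continuous_on S (\<lambda>x. h (?e x))" for S
    by (rule continuous_on_compose2[OF hc ce]) auto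
  have "((\<lambda>u. (h u)\<^sup>2 / (u - 0)) has_contour_integral 2 * of_real pi * \<i> * (h 0)\<^sup>2) (circlepath 0 1)"
    by (rule Cauchy_integral_circlepath_simple) (auto intro!: holomorphic_intros holomorphic_on_subset[OF h])
  then have "((\<lambda>x. (h (circlepath 0 1 x))\<^sup>2 / circlepath 0 1 x * vector_derivative (circlepath 0 1) (at x within {0..1}))
      has_integral 2 * of_real pi * \<i> * (h 0)\<^sup>2) {0..1}"
    by (simp add: has_contour_integral_def)
  moreover have "(h (circlepath 0 1 x))\<^sup>2 / circlepath 0 1 x * vector_derivative (circlepath 0 1) (at x within {0..1})
      = (2 * of_real pi * \<i>) * (h (?e x))\<^sup>2" if "x \<in> {0..1}" for x
  proof -
    have "circlepath 0 1 x = ?e x" by (simp add: circlepath cis_conv_exp mult_ac)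
    then show ?thesis using that
      by (simp add: vector_derivative_circlepath01 cis_conv_exp mult_ac)
  qed
  ultimately have "((\<lambda>x. (2 * of_real pi * \<i>) * (h (?e x))\<^sup>2) has_integral (2 * of_real pi * \<i>) * (h 0)\<^sup>2) {0..1}"
    by (metis (no_types, lifting) has_integral_cong)
  moreover define k where "k = 2 * of_real pi * \<i>"
  ultimately have hk: "((\<lambda>x. k * (h (?e x))\<^sup>2) has_integral k * (h 0)\<^sup>2) {0..1}" by simp
  have k0: "k \<noteq> 0" by (simp add: k_def)
  have hi: "((\<lambda>x. (h (?e x))\<^sup>2) has_integral (h 0)\<^sup>2) {0..1}"
    using has_integral_mult_right[OF hk, of "inverse k"] k0 by (simp add: mult.assoc[symmetric])
  have ni: "(\<lambda>x. (norm (h (?e x)))\<^sup>2) integrable_on {0..1}"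
    by (intro integrable_continuous_real continuous_intros che)
  have "norm (integral {0..1} (\<lambda>x. (h (?e x))\<^sup>2)) \<le> integral {0..1} (\<lambda>x. (norm (h (?e x)))\<^sup>2)"
    using hi ni by (intro integral_norm_bound_integral) (auto simp: norm_power)
  then have le: "(norm (h 0))\<^sup>2 \<le> integral {0..1} (\<lambda>x. (norm (h (?e x)))\<^sup>2)"
    using hi by (simp add: integral_unique norm_power)
  have [measurable]: "(\<lambda>x. h (?e x)) \<in> borel_measurable borel"
    by (intro borel_measurable_continuous_onI che)
  have "((\<lambda>x. if x \<in> {0..1} then (norm (h (?e x)))\<^sup>2 else 0) has_integral integral {0..1} (\<lambda>x. (norm (h (?e x)))\<^sup>2)) UNIV"
    using ni by (simp only: has_integral_restrict_UNIV integrable_integral)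
  from nn_integral_has_integral_lborel[OF _ _ this]
  have "(\<integral>\<^sup>+x. ennreal (if x \<in> {0..1} then (norm (h (?e x)))\<^sup>2 else 0) \<partial>lborel) = ennreal (integral {0..1} (\<lambda>x. (norm (h (?e x)))\<^sup>2))"
    by simp
  also have "(\<integral>\<^sup>+x. ennreal (if x \<in> {0..1} then (norm (h (?e x)))\<^sup>2 else 0) \<partial>lborel) =
      (\<integral>\<^sup>+x. ennreal ((norm (h (?e x)))\<^sup>2) * indicator {0..1} x \<partial>lborel)"
    by (intro nn_integral_cong) (auto split: split_indicator)
  finally show ?thesis using le by (simp add: ennreal_leI)
qed

lemma continuous_vector_smult:
  assumes "continuous_on S f" "continuous_on S g"
  shows "continuous_on S (\<lambda>x. f x *s (g x :: complex ^ 'n))"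
proof -
  have "continuous_on S (\<lambda>x. \<chi> i. f x * g x $ i)"
    using assms by (intro continuous_intros)
  then show ?thesis by (simp add: vector_scalar_mult_def)
qed

text \<open>The circle inequality holds along each complex line \<open>z \<mapsto> z *s t\<close>.
  After integration in \<open>t\<close> and exchange of the integrals, each rotation is absorbed by
  the invariance of \<open>p\<close> and of Lebesgue measure.\<close>

lemma rotation_mean_square:
  fixes h :: "complex ^ 'n \<Rightarrow> complex"
  assumes h: "holo h" and p[measurable]: "p \<in> borel_measurable borel" and rot: "\<And>a t. p (cis a *s t) = p t"
  shows "ennreal ((norm (h 0))\<^sup>2) * (\<integral>\<^sup>+t. ennreal (exp (- p t)) \<partial>lborel)
    \<le> (\<integral>\<^sup>+t. ennreal ((norm (h t))\<^sup>2) * ennreal (exp (- p t)) \<partial>lborel)"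
proof -
  let ?I = "\<lambda>\<theta>. indicator {0..1} (\<theta>::real) :: ennreal"
  let ?f = "\<lambda>t. ennreal ((norm (h t))\<^sup>2) * ennreal (exp (- p t))"
  let ?e = "\<lambda>\<theta>. cis (2 * pi * \<theta>)"
  note [measurable] = holo_measurable[OF h]
  have em: "(\<lambda>z :: real \<times> (complex ^ 'n). ?e (fst z) *s snd z) \<in> borel_measurable borel"
    by (intro borel_measurable_continuous_onI continuous_vector_smult continuous_intros)
  then have [measurable]: "(\<lambda>z :: real \<times> (complex ^ 'n). ?e (fst z) *s snd z) \<in> borel_measurable (borel \<Otimes>\<^sub>M borel)"
    by (simp add: borel_prod)
  have "ennreal ((norm (h 0))\<^sup>2) * (\<integral>\<^sup>+t. ennreal (exp (- p t)) \<partial>lborel)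
      = (\<integral>\<^sup>+t. ennreal ((norm (h 0))\<^sup>2) * ennreal (exp (- p t)) \<partial>lborel)"
    by (simp add: nn_integral_cmult)
  also have "\<dots> \<le> (\<integral>\<^sup>+t. (\<integral>\<^sup>+\<theta>. ennreal ((norm (h (?e \<theta> *s t)))\<^sup>2) * ?I \<theta> \<partial>lborel) * ennreal (exp (- p t)) \<partial>lborel)"
  proof (intro nn_integral_mono mult_right_mono)
    show "ennreal ((norm (h 0))\<^sup>2) \<le> (\<integral>\<^sup>+\<theta>. ennreal ((norm (h (?e \<theta> *s t)))\<^sup>2) * ?I \<theta> \<partial>lborel)" for t
      using circle_mean_square[OF holo_disc[OF h, of t]] by simp
  qed simp
  also have "\<dots> = (\<integral>\<^sup>+t. (\<integral>\<^sup>+\<theta>. ?f (?e \<theta> *s t) * ?I \<theta> \<partial>lborel) \<partial>lborel)"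
  proof (rule nn_integral_cong)
    fix t :: "complex ^ 'n"
    have [measurable]: "(\<lambda>\<theta>. h (?e \<theta> *s t)) \<in> borel_measurable borel"
      by (intro borel_measurable_continuous_onI continuous_on_compose2[OF holo_continuous[OF h]] continuous_vector_smult continuous_intros) auto
    show "(\<integral>\<^sup>+\<theta>. ennreal ((norm (h (?e \<theta> *s t)))\<^sup>2) * ?I \<theta> \<partial>lborel) * ennreal (exp (- p t))
        = (\<integral>\<^sup>+\<theta>. ?f (?e \<theta> *s t) * ?I \<theta> \<partial>lborel)"
    proof -
      have "(\<integral>\<^sup>+\<theta>. ennreal ((norm (h (?e \<theta> *s t)))\<^sup>2) * ?I \<theta> \<partial>lborel) * ennreal (exp (- p t))
          = (\<integral>\<^sup>+\<theta>. ennreal ((norm (h (?e \<theta> *s t)))\<^sup>2) * ?I \<theta> * ennreal (exp (- p t)) \<partial>lborel)"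
        by (rule nn_integral_multc[symmetric]) measurable
      then show ?thesis by (simp add: rot mult_ac)
    qed
  qed
  also have "\<dots> = (\<integral>\<^sup>+\<theta>. (\<integral>\<^sup>+t. ?f (?e \<theta> *s t) * ?I \<theta> \<partial>lborel) \<partial>lborel)"
  proof (rule lborel_pair.Fubini')
    have "(\<lambda>z. ?f (?e (fst z) *s snd z) * ?I (fst z)) \<in> borel_measurable (borel \<Otimes>\<^sub>M borel)" by measurable
    then show "(\<lambda>(\<theta>, t). ?f (?e \<theta> *s t) * ?I \<theta>) \<in> borel_measurable (lborel \<Otimes>\<^sub>M lborel)"
      by (simp add: case_prod_beta')
  qed
  also have "\<dots> = (\<integral>\<^sup>+\<theta>. (\<integral>\<^sup>+t. ?f t \<partial>lborel) * ?I \<theta> \<partial>lborel)"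
  proof (rule nn_integral_cong)
    fix \<theta> :: real
    have lin: "linear (\<lambda>t :: complex ^ 'n. ?e \<theta> *s t)" by (rule smult_linear)
    have [measurable]: "(\<lambda>t :: complex ^ 'n. ?e \<theta> *s t) \<in> borel_measurable borel" by (rule linear_measurable[OF lin])
    have "bij (\<lambda>t :: complex ^ 'n. ?e \<theta> *s t)"
      by (rule bij_betw_byWitness[where f' = "\<lambda>t. inverse (?e \<theta>) *s t"]) (auto simp: cis_mult)
    moreover have "norm (?e \<theta> *s t) = norm t" for t :: "complex ^ 'n"
      by (simp add: norm_vec_def norm_mult)
    ultimately have "(\<integral>\<^sup>+t. ?f (?e \<theta> *s t) \<partial>lborel) = (\<integral>\<^sup>+t. ?f t \<partial>lborel)"
      by (intro nn_integral_isometry[where f = ?f] lin) measurable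
    then show "(\<integral>\<^sup>+t. ?f (?e \<theta> *s t) * ?I \<theta> \<partial>lborel) = (\<integral>\<^sup>+t. ?f t \<partial>lborel) * ?I \<theta>"
      by (subst nn_integral_multc) auto
  qed
  also have "\<dots> = (\<integral>\<^sup>+t. ?f t \<partial>lborel)"
    by (subst nn_integral_cmult) auto
  finally show ?thesis .
qed

lemma holo_translate: "holo h \<Longrightarrow> holo (\<lambda>t. h (s + t))"
  unfolding holo_def
proof
  fix z assume "\<forall>z. \<exists>L. (h has_derivative L) (at z) \<and> (\<forall>c w. L (c *s w) = c * L w)"
  then obtain L where L: "(h has_derivative L) (at (s + z))" "\<forall>c w. L (c *s w) = c * L w" by blast
  have "((\<lambda>t. s + t) has_derivative (\<lambda>t. t)) (at z)" by (auto intro!: derivative_eq_intros)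
  from diff_chain_at[OF this L(1)] have "((\<lambda>t. h (s + t)) has_derivative L) (at z)" by (simp add: o_def)
  with L(2) show "\<exists>L. ((\<lambda>t. h (s + t)) has_derivative L) (at z) \<and> (\<forall>c w. L (c *s w) = c * L w)" by blast
qed

abbreviation weighted_norm_sq :: "complex ^ 'n ^ 'n \<Rightarrow> complex ^ 'n ^ 'n \<Rightarrow> (complex ^ 'n \<Rightarrow> complex) \<Rightarrow> ennreal" where
  "weighted_norm_sq H B v \<equiv> \<integral>\<^sup>+x. ennreal ((norm (v x))\<^sup>2) * ennreal (exp (- rq H B x)) \<partial>lborel"

text \<open>The relation between A, A1 and D says that the inverses of A and A1 differ by D, so that
  exp(-A) is, up to a constant, the convolution of exp(-A1) with the rotation invariant Gaussian
  of covariance D.\<close>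

lemma gaussian_domination:
  fixes H B H1 B1 D E :: "complex ^ 'n ^ 'n"
  assumes H1: "hadj H1 = H1" "transpose B1 = B1"
    and E: "posdef E" and ED: "E ** D = mat 1"
    and rel: "\<And>x. rl H1 B1 (x - D *v rl H B x) = rl H B x"
    and w: "holo w"
  shows "weighted_norm_sq H1 B1 w * (\<integral>\<^sup>+x. ennreal (exp (- rq H B x)) \<partial>lborel)
    \<le> weighted_norm_sq H B w * (\<integral>\<^sup>+x. ennreal (exp (- rq H1 B1 x)) \<partial>lborel)"
proof -
  let ?q = "\<lambda>x. ennreal (exp (- rq H B x))" and ?q1 = "\<lambda>x. ennreal (exp (- rq H1 B1 x))"
    and ?e = "\<lambda>x. ennreal (exp (- rq E 0 x))"
  let ?Z = "\<integral>\<^sup>+x. ?q1 x * ?e x \<partial>lborel" and ?ZE = "\<integral>\<^sup>+x. ?e x \<partial>lborel"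
  have E': "hadj E = E" using E by (simp add: posdef_def)
  have t0: "transpose (0 :: complex ^ 'n ^ 'n) = 0" by (simp add: transpose_def vec_eq_iff)
  have rq0: "rq E 0 x = Re (hip x (E *v x))" for x
    by (simp add: rq_def cdot_simps)
  \<comment> \<open>Completion of the square: for fixed \<open>x\<close>, the sum of
    \<open>rq H1 B1 (x - t)\<close> and \<open>rq E 0 t\<close> is stationary at
    \<open>t = D *v rl H B x\<close>, where \<open>rl H1 B1 (x - t)\<close> and
    \<open>rl E 0 t\<close> both equal \<open>rl H B x\<close>; its value there is
    \<open>rq H B x\<close>.\<close>
  have ident: "rq H1 B1 (x - (D *v rl H B x + t)) + rq E 0 (D *v rl H B x + t) = rq H B x + (rq H1 B1 t + rq E 0 t)" for x t
  proof -
    let ?a = "rl H B x"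
    let ?y = "x - D *v ?a"
    have lin: "rl H1 B1 (x - (D *v ?a + t)) = ?a - rl H1 B1 t"
      using rel[of x] linear_diff[OF linear_rl, of H1 B1 ?y t] by (simp add: diff_diff_eq)
    have linE: "rl E 0 (D *v ?a + t) = ?a + rl E 0 t"
    proof -
      have "rl E 0 (D *v ?a) = ?a"
        by (simp add: rl_def matrix_vector_mul_assoc ED)
      then show ?thesis by (simp add: linear_add[OF linear_rl])
    qed
    have s1: "?y \<bullet> rl H1 B1 t = ?a \<bullet> t"
      using inner_rl_sym[OF H1, of ?y t] rel[of x] by simp
    have s2: "(D *v ?a) \<bullet> rl E 0 t = ?a \<bullet> t"
      using inner_rl_sym[OF E' t0, of "D *v ?a" t] by (simp add: rl_def matrix_vector_mul_assoc ED)
    have "rq H1 B1 (x - (D *v ?a + t)) = (?y - t) \<bullet> (?a - rl H1 B1 t)"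
      unfolding rq_inner lin by (simp add: diff_diff_eq)
    moreover have "rq E 0 (D *v ?a + t) = (D *v ?a + t) \<bullet> (?a + rl E 0 t)"
      unfolding rq_inner linE ..
    ultimately show ?thesis
      using s1 s2 unfolding rq_inner by (simp add: inner_simps inner_commute[of t ?a])
  qed
  \<comment> \<open>By \<open>ident\<close>, the convolution of \<open>?q1\<close> and
    \<open>?e\<close> is \<open>?Z\<close> times \<open>?q\<close>. Exchanging the integrals moves
    the translation onto the arbitrary \<open>F\<close>.\<close>
  have conv: "(\<integral>\<^sup>+x. F x * ?q x \<partial>lborel) * ?Z = (\<integral>\<^sup>+s. ?q1 s * (\<integral>\<^sup>+t. F (s + t) * ?e t \<partial>lborel) \<partial>lborel)"
    if [measurable]: "F \<in> borel_measurable borel" for F :: "complex ^ 'n \<Rightarrow> ennreal"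
  proof -
    have 1: "(\<integral>\<^sup>+t. ?q1 (x - t) * ?e t \<partial>lborel) = ?q x * ?Z" for x
    proof -
      have "(\<integral>\<^sup>+t. ?q1 (x - t) * ?e t \<partial>lborel) = (\<integral>\<^sup>+t. ?q1 (x - (D *v rl H B x + t)) * ?e (D *v rl H B x + t) \<partial>lborel)"
        by (rule nn_integral_translate[symmetric]) measurable
      also have "\<dots> = (\<integral>\<^sup>+t. ?q x * (?q1 t * ?e t) \<partial>lborel)"
      proof (rule nn_integral_cong)
        fix t
        have "exp (- rq H1 B1 (x - (D *v rl H B x + t))) * exp (- rq E 0 (D *v rl H B x + t)) = exp (- rq H B x) * (exp (- rq H1 B1 t) * exp (- rq E 0 t))"
          using ident[of x t] by (simp add: exp_add[symmetric])
        then show "?q1 (x - (D *v rl H B x + t)) * ?e (D *v rl H B x + t) = ?q x * (?q1 t * ?e t)"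
          by (simp add: ennreal_mult'[symmetric])
      qed
      also have "\<dots> = ?q x * ?Z" by (rule nn_integral_cmult) measurable
      finally show ?thesis .
    qed
    have "(\<integral>\<^sup>+x. F x * ?q x \<partial>lborel) * ?Z = (\<integral>\<^sup>+x. F x * ?q x * ?Z \<partial>lborel)"
      by (rule nn_integral_multc[symmetric]) measurable
    also have "\<dots> = (\<integral>\<^sup>+x. (\<integral>\<^sup>+t. F x * (?q1 (x - t) * ?e t) \<partial>lborel) \<partial>lborel)"
      by (subst nn_integral_cmult) (simp_all add: 1 mult.assoc)
    also have "\<dots> = (\<integral>\<^sup>+t. (\<integral>\<^sup>+x. F x * (?q1 (x - t) * ?e t) \<partial>lborel) \<partial>lborel)"
      by (rule lborel_pair.Fubini') measurable
    also have "\<dots> = (\<integral>\<^sup>+t. (\<integral>\<^sup>+s. F (t + s) * (?q1 s * ?e t) \<partial>lborel) \<partial>lborel)"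
    proof (rule nn_integral_cong)
      fix t
      have "(\<integral>\<^sup>+x. F x * (?q1 (x - t) * ?e t) \<partial>lborel) = (\<integral>\<^sup>+s. F (t + s) * (?q1 (t + s - t) * ?e t) \<partial>lborel)"
        by (rule nn_integral_translate[symmetric]) measurable
      then show "(\<integral>\<^sup>+x. F x * (?q1 (x - t) * ?e t) \<partial>lborel) = (\<integral>\<^sup>+s. F (t + s) * (?q1 s * ?e t) \<partial>lborel)" by simp
    qed
    also have "\<dots> = (\<integral>\<^sup>+s. (\<integral>\<^sup>+t. F (t + s) * (?q1 s * ?e t) \<partial>lborel) \<partial>lborel)"
      by (rule lborel_pair.Fubini') measurable
    also have "\<dots> = (\<integral>\<^sup>+s. ?q1 s * (\<integral>\<^sup>+t. F (s + t) * ?e t \<partial>lborel) \<partial>lborel)"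
      by (subst nn_integral_cmult[symmetric]) (auto simp: mult_ac add.commute)
    finally show ?thesis .
  qed
  note [measurable] = holo_measurable[OF w]
  let ?F = "\<lambda>x. ennreal ((norm (w x))\<^sup>2)"
  let ?J = "\<integral>\<^sup>+x. ?F x * ?q x \<partial>lborel" and ?J1 = "\<integral>\<^sup>+x. ?F x * ?q1 x \<partial>lborel"
    and ?Q = "\<integral>\<^sup>+x. ?q x \<partial>lborel" and ?Q1 = "\<integral>\<^sup>+x. ?q1 x \<partial>lborel"
  have "?J1 * ?ZE = (\<integral>\<^sup>+s. ?q1 s * (?F s * ?ZE) \<partial>lborel)"
    by (subst nn_integral_multc[symmetric]) (auto simp: mult_ac)
  also have "\<dots> \<le> (\<integral>\<^sup>+s. ?q1 s * (\<integral>\<^sup>+t. ?F (s + t) * ?e t \<partial>lborel) \<partial>lborel)"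
  proof (intro nn_integral_mono mult_left_mono)
    fix s
    have cc: "cis a * cnj (cis a) = 1" "cnj (cis a) * cis a = 1" for a
      by (simp_all add: cis_cnj cis_mult)
    have "rq E 0 (cis a *s t) = rq E 0 t" for a t
      unfolding rq0 matrix_smult hip_simps mult.assoc[symmetric] by (simp add: cc mult.commute)
    then show "?F s * ?ZE \<le> (\<integral>\<^sup>+t. ?F (s + t) * ?e t \<partial>lborel)"
      using rotation_mean_square[OF holo_translate[OF w, of s], of "rq E 0"] by simp
  qed simp
  also have "\<dots> = ?J * ?Z" by (rule conv[symmetric]) measurable
  finally have le: "?J1 * ?ZE \<le> ?J * ?Z" .
  \<comment> \<open>The constant function 1 in place of \<open>F\<close> evaluates the normalization
    \<open>?Z\<close>, which can then be eliminated.\<close>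
  have "?Q * ?Z = (\<integral>\<^sup>+s. ?q1 s * ?ZE \<partial>lborel)" using conv[of "\<lambda>_. 1"] by simp
  also have "\<dots> = ?Q1 * ?ZE" by (rule nn_integral_multc) measurable
  finally have eq: "?Q * ?Z = ?Q1 * ?ZE" .
  have "rq E 0 x > 0" if "x \<noteq> 0" for x using E that by (simp add: rq0 posdef_def)
  then obtain z where z: "z > 0" "?ZE = ennreal z"
    by (rule gaussian_integral[OF E' t0])
  have "?J1 * ?Q * ?ZE = ?J1 * ?ZE * ?Q" by (simp add: mult_ac)
  also have "\<dots> \<le> ?J * ?Z * ?Q" by (rule mult_right_mono[OF le]) simp
  also have "\<dots> = ?J * (?Q * ?Z)" by (simp add: mult_ac)
  also have "\<dots> = ?J * ?Q1 * ?ZE" unfolding eq by (simp add: mult_ac)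
  finally have "?J1 * ?Q * ?ZE / ?ZE \<le> ?J * ?Q1 * ?ZE / ?ZE" by (rule divide_right_mono_ennreal)
  then show ?thesis using z by (simp add: mult_divide_eq_ennreal)
qed

section \<open>Geometry of the FBI transform\<close>

lemma qform_cdot: "qform A z = cdot z (A *v z)"
  by (simp add: qform_def cdot_def matrix_vector_mult_def sum_distrib_left mult_ac)

lemma cdot_mkpt: "cdot (mkpt x y) (mkpt x' y') = cdot x x' + cdot y y'"
  by (simp add: cdot_def sum_UNIV_sum)

lemma cdot_sym: "transpose S = S \<Longrightarrow> cdot x (S *v y) = cdot y (S *v x)"
  by (metis cdot_commute cdot_matrix)

lemma matrix_eq_of_cdot:
  assumes "\<And>v w. cdot v (X *v w) = cdot v (Y *v w)"
  shows "X = Y"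
  using assms by (metis cdot_eqI matrix_eq)

lemma symmetric_eq_of_qform:
  fixes S S' :: "complex ^ 'n ^ 'n"
  assumes S: "transpose S = S" "transpose S' = S'" and q: "\<And>w. cdot w (S *v w) = cdot w (S' *v w)"
  shows "S = S'"
proof (rule matrix_eq_of_cdot)
  fix v w
  have "cdot (v + w) (X *v (v + w)) = cdot v (X *v v) + cdot w (X *v w) + 2 * cdot v (X *v w)" if "transpose X = X" for X :: "complex ^ 'n ^ 'n"
    using cdot_sym[OF that, of w v] by (simp add: matrix_vector_right_distrib cdot_simps)
  from this[OF S(1)] this[OF S(2)] show "cdot v (S *v w) = cdot v (S' *v w)"
    using q[of "v + w"] q[of v] q[of w] by simp
qed

definition msc :: "complex \<Rightarrow> complex ^ 'n ^ 'm \<Rightarrow> complex ^ 'n ^ 'm" where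
  "msc c A = (\<chi> i j. c * A $ i $ j)"

lemma msc_simps:
  "msc c A *v x = c *s (A *v x)" "msc c A ** B = msc c (A ** B)" "A' ** msc c A = msc c (A' ** A)"
  "transpose (msc c A) = msc c (transpose A)" "cnj_mat (msc c A) = msc (cnj c) (cnj_mat A)"
  "msc c (A + A'') = msc c A + msc c A''" "msc c (- A) = msc (- c) A" "- msc c A = msc (- c) A" "msc c (msc d A) = msc (c * d) A"
  "msc 1 A = A" "msc c 0 = 0"
  by (simp_all add: msc_def vec_eq_iff matrix_vector_mult_def matrix_matrix_mult_def transpose_def cnj_mat_def
      sum_distrib_left mult_ac distrib_left)

lemma msc_blk: "msc e (blk a b c d) = blk (msc e a) (msc e b) (msc e c) (msc e d)"
  by (simp add: msc_def vec_eq_iff split_sum_all)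

lemma cnj_cvec [simp]: "cnj_vec (cvec_of y) = cvec_of y"
  by (simp add: cnj_vec_def cvec_of_def)

lemma cvec_of_real_vector: "cnj_vec w = w \<Longrightarrow> \<exists>y. w = cvec_of y"
  by (intro exI[of _ "\<chi> i. Re (w $ i)"]) (simp add: cnj_vec_def cvec_of_def vec_eq_iff complex_eq_iff)

lemma inverse_matrix_exists:
  assumes "det (A :: complex ^ 'n ^ 'n) \<noteq> 0"
  obtains A' where "A ** A' = mat 1" "A' ** A = mat 1"
  using assms unfolding invertible_det_nz[symmetric] invertible_def by blast

lemma matrix_inv_mult:
  assumes "det (A :: complex ^ 'n ^ 'n) \<noteq> 0"
  shows "matrix_inv A ** A = mat 1" "A ** matrix_inv A = mat 1"
  using someI_ex[of "\<lambda>A'. A ** A' = mat 1 \<and> A' ** A = mat 1"] assms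
  unfolding invertible_det_nz[symmetric] invertible_def matrix_inv_def by blast+

lemma posdef_det: "posdef H \<Longrightarrow> det H \<noteq> 0"
proof -
  assume H: "posdef H"
  have "inj ((*v) H)"
  proof (rule injI)
    fix x y assume "H *v x = H *v y"
    then have "H *v (x - y) = 0" by (simp add: matrix_vector_mult_diff_distrib)
    then show "x = y" using H unfolding posdef_def by (metis hip_simps(10) less_irrefl right_minus_eq zero_complex.sel(1))
  qed
  then show ?thesis
    using det_nz_iff_inj_gen[OF matrix_vector_mul_linear_gen[of H]] by simp
qed

text \<open>The graph parametrization of phase space attached to an FBI phase: the point Theta x y is real
  if y is the conjugate of x, and T maps it over x.\<close>

lemma fbi_geometry:
  fixes P T :: "('n::finite) pmat"
  assumes phase: "fbi_phase P" and T: "fbi_canon P T"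
  obtains H B :: "complex ^ 'n ^ 'n" and \<Theta> where
    "posdef H" "transpose B = B" "\<And>x. 2 * fbi_weight P x = rq H B x"
    "\<And>x y. T *v \<Theta> x y = mkpt x (- \<i> *s (B *v x + cnj_mat H *v y))"
    "\<And>x y. cnj_vec (\<Theta> x y) = \<Theta> (cnj_vec y) (cnj_vec x)"
    "\<And>x y x' y'. symp (\<Theta> x y) (\<Theta> x' y') = \<i> * (cdot x (cnj_mat H *v y') - cdot x' (cnj_mat H *v y))"
proof -
  obtain P11 L L' P22 where Pb: "P = blk P11 L L' P22" by (rule blk_cases)
  have "transpose P = P" using phase by (simp add: fbi_phase_def symmetric_mat_def)
  then have P11: "transpose P11 = P11" and L': "L' = transpose L" and P22: "transpose P22 = P22"
    by (auto simp: Pb transpose_blk)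
  have detL: "det L \<noteq> 0"
  proof -
    have "(\<chi> i j. P $ Inl i $ Inr j) = L" by (simp add: Pb vec_eq_iff)
    then show ?thesis using phase by (simp add: fbi_phase_def)
  qed
  \<comment> \<open>The quadratic part in the real variable \<open>y\<close> of the supremum is the
    form of the imaginary part \<open>bm\<close>, positive definite by admissibility of the phase.
    The real part \<open>am\<close> only shifts the momentum component of
    \<open>\<Theta>\<close>.\<close>
  define am where "am = (\<chi> i j. complex_of_real (Re (P22 $ i $ j)))"
  define bm where "bm = (\<chi> i j. complex_of_real (Im (P22 $ i $ j)))"
  have P22_eq: "P22 = am + msc \<i> bm"
    by (simp add: am_def bm_def msc_def vec_eq_iff complex_eq_iff)
  have P22s: "P22 $ i $ j = P22 $ j $ i" for i j
    using P22 by (simp add: transpose_def vec_eq_iff)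
  have am: "transpose am = am" "cnj_mat am = am" and bm: "transpose bm = bm" "cnj_mat bm = bm"
    by (simp_all add: am_def bm_def transpose_def cnj_mat_def vec_eq_iff P22s)
  have qf: "qform P (mkpt x y) = cdot x (P11 *v x) + 2 * cdot (transpose L *v x) y + cdot y (P22 *v y)" for x y
  proof -
    have "cdot x (L *v y) = cdot (transpose L *v x) y" by (simp add: cdot_matrix)
    moreover have "cdot y (transpose L *v x) = cdot (transpose L *v x) y" by (rule cdot_commute)
    ultimately show ?thesis
      by (simp add: qform_cdot Pb L' blk_mult_mkpt cdot_mkpt cdot_simps)
  qed
  have Im22: "Im (cdot (cvec_of y) (P22 *v cvec_of y)) = Re (cdot (cvec_of y) (bm *v cvec_of y))" for y
    by (simp add: cdot_def cvec_of_def matrix_vector_mult_def bm_def)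
  have bpos: "Re (cdot (cvec_of y) (bm *v cvec_of y)) > 0" if "y \<noteq> 0" for y
  proof -
    have "Im (qform P (mkpt 0 (cvec_of y))) > 0" using phase that by (simp add: fbi_phase_def)
    then show ?thesis by (simp add: qf cdot_simps Im22)
  qed
  have b0: "Re (cdot (cvec_of y) (bm *v cvec_of y)) \<ge> 0" for y
    using bpos[of y] by (cases "y = 0") (auto simp: cvec_of_def cdot_def)
  have pb: "posdef bm"
    unfolding posdef_def
  proof (intro conjI allI impI)
    show "hadj bm = bm" by (simp add: hadj_def bm)
    fix v :: "complex ^ 'n" assume v: "v \<noteq> 0"
    let ?r = "\<chi> i. Re (v $ i)" and ?s = "\<chi> i. Im (v $ i)"
    have "v = cvec_of ?r + \<i> *s cvec_of ?s" by (simp add: vec_eq_iff cvec_of_def complex_eq_iff)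
    then have "hip v (bm *v v) = hip (cvec_of ?r + \<i> *s cvec_of ?s) (bm *v (cvec_of ?r + \<i> *s cvec_of ?s))" by simp
    also have "\<dots> = cdot (cvec_of ?r) (bm *v cvec_of ?r) + cdot (cvec_of ?s) (bm *v cvec_of ?s)"
      using cdot_sym[OF bm(1), of "cvec_of ?r" "cvec_of ?s"]
      by (simp add: hip_def matrix_vector_right_distrib matrix_smult cdot_simps algebra_simps)
    finally have e: "Re (hip v (bm *v v)) = Re (cdot (cvec_of ?r) (bm *v cvec_of ?r)) + Re (cdot (cvec_of ?s) (bm *v cvec_of ?s))"
      by simp
    have "?r \<noteq> 0 \<or> ?s \<noteq> 0" using v by (auto simp: vec_eq_iff complex_eq_iff)
    then show "Re (hip v (bm *v v)) > 0"
      unfolding e using bpos[of ?r] bpos[of ?s] b0[of ?r] b0[of ?s] by (auto intro: add_pos_nonneg add_nonneg_pos)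
  qed
  obtain \<beta> where \<beta>: "bm ** \<beta> = mat 1" "\<beta> ** bm = mat 1" by (rule inverse_matrix_exists[OF posdef_det[OF pb]])
  have \<beta>c: "cnj_mat \<beta> = \<beta>"
  proof -
    have "cnj_mat \<beta> ** bm = mat 1" using arg_cong[OF \<beta>(2), of cnj_mat] bm by simp
    then show ?thesis by (metis \<beta>(1) matrix_mul_assoc matrix_mul_lid matrix_mul_rid)
  qed
  have \<beta>t: "transpose \<beta> = \<beta>"
  proof -
    have "transpose \<beta> ** bm = mat 1" using arg_cong[OF \<beta>(1), of transpose] bm by (simp add: matrix_transpose_mul)
    then show ?thesis by (metis \<beta>(1) matrix_mul_assoc matrix_mul_lid matrix_mul_rid)
  qed
  have bb: "bm *v (\<beta> *v v) = v" for v by (simp add: matrix_vector_mul_assoc \<beta>)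
  \<comment> \<open>These coefficients come from completing the square in \<open>y\<close>. The
    supremum contributes the form of \<open>\<beta>\<close> at the imaginary part of
    \<open>transpose L *v x\<close>; products of this vector with its conjugate go into
    \<open>H\<close>, its products with itself into \<open>B\<close>.\<close>
  define H where "H = cnj_mat L ** \<beta> ** transpose L"
  define B where "B = msc (2 * \<i>) P11 - L ** \<beta> ** transpose L"
  \<comment> \<open>At \<open>y = cnj_vec x\<close> this is the real maximizer in
    \<open>fbi_weight\<close>. An independent \<open>y\<close> in place of the conjugate makes the
    expression complex linear. The second component of \<open>\<Theta>\<close> is
    \<open>- phase_dy\<close> at this point, rewritten with the real and imaginary parts of
    \<open>P22\<close>.\<close>
  define y0 where "y0 = (\<lambda>x y. (\<i> / 2) *s (\<beta> *v (transpose L *v x - hadj L *v y)))"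
  define \<Theta> where "\<Theta> = (\<lambda>x y. mkpt (y0 x y) (- (transpose L *v x) - hadj L *v y - 2 *s (am *v y0 x y)))"
  have Hc: "cnj_mat H *v y = L *v (\<beta> *v (hadj L *v y))" for y
    by (simp add: H_def hadj_def \<beta>c matrix_vector_mul_assoc matrix_mul_assoc)
  have Hv: "H *v x = cnj_mat L *v (\<beta> *v (transpose L *v x))" for x
    by (simp add: H_def matrix_vector_mul_assoc matrix_mul_assoc)
  have Bv: "B *v x = (2 * \<i>) *s (P11 *v x) - L *v (\<beta> *v (transpose L *v x))" for x
    by (simp add: B_def matrix_vector_mult_diff_rdistrib msc_simps matrix_vector_mul_assoc matrix_mul_assoc)
  have "hadj H = H"
    by (simp add: H_def hadj_def matrix_transpose_mul \<beta>c \<beta>t matrix_mul_assoc)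
  moreover have "Re (hip x (H *v x)) > 0" if x: "x \<noteq> 0" for x
  proof -
    let ?v = "transpose L *v x" and ?u = "\<beta> *v (transpose L *v x)"
    have "det (transpose L) \<noteq> 0" using detL by simp
    then have "?v \<noteq> 0" using det_inj x by blast
    then have "?u \<noteq> 0" by (metis bb matrix_vector_mult_0_right)
    then have "Re (hip ?u (bm *v ?u)) > 0" using pb by (simp add: posdef_def)
    also have "hip ?u (bm *v ?u) = cnj (hip ?v ?u)" by (simp add: bb cnj_hip)
    also have "hip ?v ?u = hip x (H *v x)" unfolding Hv hip_def by (simp add: cdot_matrix)
    finally show ?thesis by simp
  qed
  ultimately have "posdef H" by (simp add: posdef_def)
  moreover have "transpose B = B"
  proof -
    have "transpose (L ** \<beta> ** transpose L) = L ** \<beta> ** transpose L"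
      by (simp add: matrix_transpose_mul \<beta>t matrix_mul_assoc)
    moreover have "transpose (X - Y) = transpose X - transpose Y" for X Y :: "complex ^ 'n ^ 'n"
      by (simp add: transpose_def vec_eq_iff)
    ultimately show ?thesis by (simp add: B_def msc_simps P11)
  qed
  moreover have "2 * fbi_weight P x = rq H B x" for x
  proof -
    let ?v = "transpose L *v x"
    define p where "p = cvec_of (\<chi> i. Im (?v $ i))"
    have pc: "cnj_vec p = p" by (simp add: p_def)
    have bpc: "cnj_vec (\<beta> *v p) = \<beta> *v p" by (simp add: \<beta>c pc)
    define m where "m = - Im (cdot x (P11 *v x)) + Re (cdot p (\<beta> *v p))"
    \<comment> \<open>Completing the square in \<open>y\<close>: the maximum is \<open>m\<close>,
      reached at \<open>- (\<beta> *v p)\<close>, which is a real vector since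
      \<open>\<beta>\<close> and \<open>p\<close> are real.\<close>
    have val: "- Im (qform P (mkpt x (cvec_of y))) = m - Re (cdot (cvec_of y + \<beta> *v p) (bm *v (cvec_of y + \<beta> *v p)))" for y
    proof -
      let ?Y = "cvec_of y"
      have "Im (cdot ?v ?Y) = Re (cdot p ?Y)"
        by (simp add: cdot_def p_def cvec_of_def)
      moreover have "cdot (?Y + \<beta> *v p) (bm *v (?Y + \<beta> *v p)) = cdot ?Y (bm *v ?Y) + 2 * cdot p ?Y + cdot p (\<beta> *v p)"
        using cdot_sym[OF bm(1), of "\<beta> *v p" ?Y]
        by (simp add: matrix_vector_right_distrib cdot_simps bb cdot_commute[of ?Y p] cdot_commute[of "\<beta> *v p" p])
      ultimately show ?thesis by (simp add: qf Im22 m_def)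
    qed
    have "fbi_weight P x = m"
      unfolding fbi_weight_def
    proof (rule cSup_eq_maximum)
      have "cnj_vec (- (\<beta> *v p)) = - (\<beta> *v p)" using bpc by simp
      then obtain y where "- (\<beta> *v p) = cvec_of y" using cvec_of_real_vector by blast
      then have "- Im (qform P (mkpt x (cvec_of y))) = m" unfolding val by (simp add: cdot_simps flip: \<open>- (\<beta> *v p) = cvec_of y\<close>)
      then show "m \<in> range (\<lambda>y. - Im (qform P (mkpt x (cvec_of y))))" by (metis rangeI)
    next
      fix t assume "t \<in> range (\<lambda>y. - Im (qform P (mkpt x (cvec_of y))))"
      then obtain y where t: "t = m - Re (cdot (cvec_of y + \<beta> *v p) (bm *v (cvec_of y + \<beta> *v p)))" unfolding val by auto
      have "cnj_vec (cvec_of y + \<beta> *v p) = cvec_of y + \<beta> *v p" using bpc by simp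
      then obtain y' where "cvec_of y + \<beta> *v p = cvec_of y'" using cvec_of_real_vector by blast
      then show "t \<le> m" unfolding t using b0[of y'] by simp
    qed
    moreover have "2 * Re (cdot p (\<beta> *v p)) = Re (cdot (cnj_vec ?v) (\<beta> *v ?v)) - Re (cdot ?v (\<beta> *v ?v))"
    proof -
      have pv: "p = (- \<i> / 2) *s (?v - cnj_vec ?v)"
        unfolding p_def by (simp add: vec_eq_iff cvec_of_def cnj_vec_def complex_eq_iff)
      have "Re (cdot (cnj_vec ?v) (\<beta> *v cnj_vec ?v)) = Re (cdot ?v (\<beta> *v ?v))"
        by (metis \<beta>c cnj.simps(1) cnj_cdot cnj_vec_simps(7))
      then show ?thesis
        unfolding pv using cdot_sym[OF \<beta>t, of ?v "cnj_vec ?v"]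
        by (simp only: matrix_smult cdot_simps matrix_vector_mult_diff_distrib) (simp add: field_simps)
    qed
    moreover have "hip x (H *v x) = cdot (cnj_vec ?v) (\<beta> *v ?v)" unfolding Hv hip_def by (simp add: cdot_matrix)
    moreover have "cdot x (B *v x) = 2 * \<i> * cdot x (P11 *v x) - cdot ?v (\<beta> *v ?v)"
      unfolding Bv by (simp add: cdot_simps cdot_matrix)
    ultimately show ?thesis by (simp add: rq_def m_def)
  qed
  moreover have "T *v \<Theta> x y = mkpt x (- \<i> *s (B *v x + cnj_mat H *v y))" for x y
  proof -
    have pdy: "phase_dy P x w = 2 *s (transpose L *v x + P22 *v w)" for w
      by (simp add: phase_dy_def Pb L' vec_eq_iff sum_UNIV_sum matrix_vector_mult_def)
    have pdx: "phase_dx P x w = 2 *s (P11 *v x + L *v w)" for w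
      by (simp add: phase_dx_def Pb L' vec_eq_iff sum_UNIV_sum matrix_vector_mult_def)
    have b1: "bm *v y0 x y = (\<i> / 2) *s (transpose L *v x - hadj L *v y)"
      by (simp add: y0_def matrix_smult bb)
    have "- phase_dy P x (y0 x y) = - (transpose L *v x) - hadj L *v y - 2 *s (am *v y0 x y)"
      unfolding pdy P22_eq matrix_vector_mult_add_rdistrib msc_simps b1
      by (simp add: vec_eq_iff algebra_simps)
    then have "T *v \<Theta> x y = mkpt x (phase_dx P x (y0 x y))"
      using T unfolding fbi_canon_def \<Theta>_def by metis
    also have "phase_dx P x (y0 x y) = - \<i> *s (B *v x + cnj_mat H *v y)"
      unfolding pdx Hc Bv y0_def matrix_smult matrix_vector_mult_diff_distrib
      by (simp add: vec_eq_iff algebra_simps)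
    finally show ?thesis .
  qed
  moreover have "cnj_vec (\<Theta> x y) = \<Theta> (cnj_vec y) (cnj_vec x)" for x y
  proof -
    have y0c: "cnj_vec (y0 x y) = y0 (cnj_vec y) (cnj_vec x)"
      unfolding y0_def by (simp add: hadj_def \<beta>c matrix_vector_mult_diff_distrib vec_eq_iff algebra_simps)
    show ?thesis
      unfolding \<Theta>_def by (simp add: hadj_def y0c am algebra_simps)
  qed
  moreover have "symp (\<Theta> x y) (\<Theta> x' y') = \<i> * (cdot x (cnj_mat H *v y') - cdot x' (cnj_mat H *v y))" for x y x' y'
  proof -
    define v where "v = transpose L *v x"
    define u where "u = hadj L *v y"
    define v' where "v' = transpose L *v x'"
    define u' where "u' = hadj L *v y'"
    have a: "cdot (am *v z) w = cdot (am *v w) z" for z w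
      using cdot_sym[OF am(1)] cdot_commute by metis
    have b: "cdot z (\<beta> *v w) = cdot w (\<beta> *v z)" for z w by (rule cdot_sym[OF \<beta>t])
    have "symp (\<Theta> x y) (\<Theta> x' y') = - (cdot (v + u) (y0 x' y')) + cdot (v' + u') (y0 x y)"
      unfolding symp_def \<Theta>_def v_def[symmetric] u_def[symmetric] v'_def[symmetric] u'_def[symmetric]
      using a[of "y0 x y" "y0 x' y'"] by (simp add: cdot_simps)
    also have "\<dots> = \<i> * (cdot v (\<beta> *v u') - cdot v' (\<beta> *v u))"
      unfolding y0_def v_def[symmetric] u_def[symmetric] v'_def[symmetric] u'_def[symmetric]
      using b[of v v'] b[of u v'] b[of v u'] b[of u u']
      by (simp add: cdot_simps matrix_vector_mult_diff_distrib algebra_simps)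
    also have "\<dots> = \<i> * (cdot x (cnj_mat H *v y') - cdot x' (cnj_mat H *v y))"
      unfolding Hc by (simp add: v_def u_def v'_def u'_def cdot_matrix)
    finally show ?thesis .
  qed
  ultimately show ?thesis by (rule that)
qed


text \<open>Here \<open>y\<close> is an independent copy of the conjugate of \<open>x\<close>, and
  the points with \<open>y = cnj_vec x\<close> are real. On them \<open>T_Theta\<close> describes
  the graph over \<open>x\<close> of (2/i) times the holomorphic gradient of \<Phi>, for 2 \<Phi> =
  \<open>rq H B\<close>: the manifold to which \<open>T\<close> carries real phase space.\<close>

locale graph_chart =
  fixes H B :: "complex ^ 'n ^ 'n" and T :: "('n::finite) pmat" and \<Theta> :: "complex ^ 'n \<Rightarrow> complex ^ 'n \<Rightarrow> 'n phase"
  assumes H: "posdef H" and B: "transpose B = B"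
    and T_Theta: "T *v \<Theta> x y = mkpt x (- \<i> *s (B *v x + cnj_mat H *v y))"
    and cnj_Theta: "cnj_vec (\<Theta> x y) = \<Theta> (cnj_vec y) (cnj_vec x)"
    and symp_Theta: "symp (\<Theta> x y) (\<Theta> x' y') = \<i> * (cdot x (cnj_mat H *v y') - cdot x' (cnj_mat H *v y))"
begin

lemma H_herm: "hadj H = H" "transpose H = cnj_mat H" "transpose (cnj_mat H) = H"
proof -
  show 1: "hadj H = H" using H by (simp add: posdef_def)
  then show "transpose H = cnj_mat H" by (rule hermitian_cnj)
  then show "transpose (cnj_mat H) = H" by (metis transpose_transpose)
qed

lemma cnj_H_solve: "\<exists>y. cnj_mat H *v y = w"
proof -
  have "det (cnj_mat H) \<noteq> 0" using posdef_det[OF H] by (simp add: det_cnj_mat)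
  then obtain H' where "cnj_mat H ** H' = mat 1" by (rule inverse_matrix_exists)
  then show ?thesis by (intro exI[of _ "H' *v w"]) (simp add: matrix_vector_mul_assoc)
qed

lemma Theta_over: "\<exists>y. T *v \<Theta> x y = mkpt x \<xi>"
proof -
  obtain y where "cnj_mat H *v y = \<i> *s \<xi> - B *v x" using cnj_H_solve by blast
  then have "B *v x + cnj_mat H *v y = \<i> *s \<xi>" by simp
  then have "- \<i> *s (B *v x + cnj_mat H *v y) = \<xi>" by (simp only: vector_smult_assoc) simp
  then show ?thesis by (intro exI[of _ y]) (simp only: T_Theta)
qed

text \<open>\<open>T\<close> is surjective, because over each \<open>x\<close> the invertible
  \<open>cnj_mat H\<close> lets \<open>y\<close> produce any second component; finite dimension does
  the rest.\<close>

lemma det_T: "det T \<noteq> 0"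
proof -
  have "surj ((*v) T)"
  proof (rule surjI)
    fix z show "T *v (SOME w. T *v w = z) = z"
      by (rule someI_ex) (metis Theta_over mkpt_parts(3))
  qed
  then have "inj ((*v) T)"
    using linear_matrix_vector linear_surjective_imp_injective by blast
  then show ?thesis using det_nz_iff_inj_gen[OF matrix_vector_mul_linear_gen[of T]] by simp
qed

lemma T_inj: "T *v z = T *v w \<Longrightarrow> z = w"
  using det_inj[OF det_T, of "z - w"] by (simp add: matrix_vector_mult_diff_distrib)

lemma Theta_surj: obtains x y where "z = \<Theta> x y"
  by (metis Theta_over T_inj mkpt_parts(3))

lemma symp_T: "symp (T *v z) (T *v w) = symp z w"
proof -
  obtain x y where z: "z = \<Theta> x y" by (rule Theta_surj)
  obtain x' y' where w: "w = \<Theta> x' y'" by (rule Theta_surj)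
  have "cdot (B *v x) x' = cdot (B *v x') x" using cdot_sym[OF B, of x x'] by (simp add: cdot_commute)
  then show ?thesis
    unfolding z w symp_Theta T_Theta unfolding symp_def mkpt_parts
    by (simp add: cdot_simps cdot_commute[of "cnj_mat H *v _"] algebra_simps)
qed

text \<open>A symmetric matrix is determined by its quadratic form, so \<open>A\<close> is the
  congruence by \<open>T\<close> of the matrix of the model form. With J the symplectic matrix, the
  Hamilton map is 2 J A, and canonicity in the form T J T^t = J turns congruence of \<open>A\<close>
  into conjugation of the Hamilton map.\<close>

lemma T_conj_Hamilton:
  assumes A: "symmetric_mat A"
    and conj: "\<And>z. qform A (matrix_inv T *v z) = \<i> * cdot (M *v xpart z) (xipart z)"
  shows "T ** hamilton_map A = blk (msc \<i> M) 0 0 (- transpose (msc \<i> M)) ** T"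
proof -
  let ?J = "blk 0 (mat 1) (- mat 1) 0 :: 'n pmat"
  let ?A = "blk 0 (msc (\<i> / 2) (transpose M)) (msc (\<i> / 2) M) 0"
  have neg: "- (X :: complex ^ 'a ^ 'a) = msc (-1) X" for X by (simp add: msc_def vec_eq_iff)
  have sy: "symp z w = - cdot z (?J *v w)" for z w
  proof -
    have "cdot (mkpt a b) (?J *v mkpt c d) = cdot a d - cdot b c" for a b c d
      by (simp add: blk_mult_mkpt cdot_mkpt neg msc_simps cdot_simps)
    from this[of "xpart z" "xipart z" "xpart w" "xipart w"] show ?thesis
      by (simp add: symp_def cdot_commute)
  qed
  have TJT: "transpose T ** ?J ** T = ?J"
  proof (rule matrix_eq_of_cdot)
    fix v w
    have "cdot v ((transpose T ** ?J ** T) *v w) = cdot (T *v v) (?J *v (T *v w))"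
      by (simp add: cdot_matrix matrix_vector_mul_assoc matrix_mul_assoc)
    then show "cdot v ((transpose T ** ?J ** T) *v w) = cdot v (?J *v w)"
      using symp_T[of v w] unfolding sy by simp
  qed
  have JJ: "?J ** ?J = msc (-1) (mat 1)"
    by (simp add: blk_mult neg msc_simps blk_one[symmetric] msc_blk)
  \<comment> \<open>\<open>TJT\<close> exhibits a left inverse of \<open>T\<close>. Being also a
    right inverse, it yields the same identity with \<open>T\<close> and its transpose
    exchanged.\<close>
  have "msc (-1) (?J ** transpose T ** ?J) ** T = mat 1"
  proof -
    have "?J ** (transpose T ** ?J ** T) = msc (-1) (mat 1)" by (simp only: TJT JJ)
    then show ?thesis by (simp add: msc_simps matrix_mul_assoc)
  qed
  then have "T ** msc (-1) (?J ** transpose T ** ?J) = mat 1" by (simp add: matrix_left_right_inverse)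
  then have "msc (-1) (T ** ?J ** transpose T ** ?J) ** ?J = ?J" by (simp add: msc_simps matrix_mul_assoc)
  then have TJ: "T ** ?J ** transpose T = ?J"
    using JJ by (simp add: msc_simps matrix_mul_assoc[symmetric])
  have inv: "matrix_inv T ** T = mat 1"
    by (rule matrix_inv_mult[OF det_T])
  have A_eq: "A = transpose T ** ?A ** T"
  proof (rule symmetric_eq_of_qform)
    show At: "transpose A = A" using A by (simp add: symmetric_mat_def)
    have "transpose ?A = ?A" by (simp add: transpose_blk msc_simps) (simp add: transpose_def vec_eq_iff)
    then show "transpose (transpose T ** ?A ** T) = transpose T ** ?A ** T"
      by (simp add: matrix_transpose_mul matrix_mul_assoc)
    fix w
    let ?x = "xpart (T *v w)" and ?\<xi> = "xipart (T *v w)"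
    have "cdot w (A *v w) = qform A (matrix_inv T *v (T *v w))"
      by (simp add: qform_cdot matrix_vector_mul_assoc inv)
    also have "\<dots> = \<i> * cdot (M *v ?x) ?\<xi>" by (rule conj)
    also have "\<dots> = cdot (T *v w) (?A *v (T *v w))"
    proof -
      have "\<i> * cdot (M *v a) b = cdot (mkpt a b) (?A *v mkpt a b)" for a b
        by (simp add: blk_mult_mkpt cdot_mkpt msc_simps cdot_simps cdot_matrix cdot_commute[of b])
      from this[of ?x ?\<xi>] show ?thesis by simp
    qed
    also have "\<dots> = cdot w ((transpose T ** ?A ** T) *v w)"
      by (simp add: cdot_matrix matrix_vector_mul_assoc matrix_mul_assoc)
    finally show "cdot w (A *v w) = cdot w ((transpose T ** ?A ** T) *v w)" .
  qed
  have "hamilton_map A = msc 2 (?J ** A)"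
  proof -
    obtain a b c d where "A = blk a b c d" by (rule blk_cases)
    then show ?thesis
      by (simp add: blk_mult neg msc_simps msc_blk) (simp add: hamilton_map_def msc_def vec_eq_iff split_sum_all)
  qed
  then have "T ** hamilton_map A = msc 2 (T ** ?J ** transpose T ** ?A ** T)"
    by (simp add: A_eq msc_simps matrix_mul_assoc)
  also have "\<dots> = msc 2 (?J ** ?A) ** T" by (simp only: TJ msc_simps)
  also have "msc 2 (?J ** ?A) = blk (msc \<i> M) 0 0 (- transpose (msc \<i> M))"
    by (simp add: blk_mult neg msc_simps msc_blk)
  finally show ?thesis .
qed

end

text \<open>After conjugation by \<open>T\<close>, \<open>K\<close> is the canonical lift of the
  linear map \<open>x \<mapsto> G *v x\<close>: momenta transform by the inverse transpose of
  \<open>G\<close>, that is by \<open>transpose F\<close>.\<close>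

locale evolution_chart = graph_chart +
  fixes K :: "('n::finite) pmat" and F G :: "complex ^ 'n ^ 'n"
  assumes FG: "F ** G = mat 1"
    and T_K: "T ** K = blk G 0 0 (transpose F) ** T"
    and K_pos: "strictly_positive K"
begin

\<comment> \<open>rq H1 B1 is the pullback of rq H B by G.\<close>
definition "H1 = hadj G ** H ** G"
definition "B1 = transpose G ** B ** G"

lemma GtFt: "transpose G ** transpose F = mat 1"
  using FG by (simp add: matrix_transpose_mul[symmetric])

text \<open>In graph coordinates \<open>K\<close> multiplies \<open>x\<close> by \<open>G\<close>.
  The new \<open>y'\<close> stays implicit: the momentum equation multiplied by
  \<open>transpose G\<close> contains only the pulled back matrix \<open>B1\<close>, and no inverse
  of \<open>H\<close> has to be written.\<close>

lemma K_Theta: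
  obtains y' where "K *v \<Theta> x y = \<Theta> (G *v x) y'"
    "transpose G *v (cnj_mat H *v y') + B1 *v x = B *v x + cnj_mat H *v y"
proof -
  obtain y' where y': "cnj_mat H *v y' = transpose F *v (B *v x + cnj_mat H *v y) - B *v (G *v x)"
    using cnj_H_solve by blast
  have "T *v (K *v \<Theta> x y) = blk G 0 0 (transpose F) *v (T *v \<Theta> x y)"
    by (simp add: matrix_vector_mul_assoc T_K)
  also have "\<dots> = T *v \<Theta> (G *v x) y'"
  proof -
    have "B *v (G *v x) + cnj_mat H *v y' = transpose F *v (B *v x + cnj_mat H *v y)" by (simp add: y')
    then show ?thesis
      by (simp only: T_Theta blk_mult_mkpt matrix_smult matrix_vector_mult_0 vector_smult_rzero add_0_left add_0_right)
  qed
  finally have "K *v \<Theta> x y = \<Theta> (G *v x) y'" by (rule T_inj)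
  moreover have "transpose G *v (cnj_mat H *v y') + B1 *v x = B *v x + cnj_mat H *v y"
    unfolding y' B1_def
    by (simp add: matrix_vector_mult_diff_distrib matrix_vector_mul_assoc matrix_mul_assoc GtFt)
  ultimately show ?thesis by (rule that)
qed

lemma H1_posdef: "posdef H1"
  unfolding posdef_def
proof (intro conjI allI impI)
  show "hadj H1 = H1" by (simp add: H1_def hadj_mult H_herm matrix_mul_assoc)
  fix x :: "complex ^ 'n" assume "x \<noteq> 0"
  then have "G *v x \<noteq> 0" using left_inverse_det[OF FG] det_inj by blast
  then show "Re (hip x (H1 *v x)) > 0" using H by (simp add: H1_def hip_congruence[symmetric] posdef_def)
qed

lemma B1_sym: "transpose B1 = B1"
  by (simp add: B1_def matrix_transpose_mul B matrix_mul_assoc)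

text \<open>Strict positivity is used at the real point over \<open>x\<close>, where
  \<open>symp (cnj_vec ?z) ?z\<close> vanishes; it says that \<open>?g\<close> is longer than
  \<open>p\<close> in the norm of \<open>H\<close>. Pairing the momentum equation with
  \<open>x\<close> gives the increase of the form as
  \<open>Re (hip ?g (H *v ?g)) - Re (hip ?g (H *v p))\<close>, which is positive because twice the
  mixed term is at most the sum of the two squares.\<close>

lemma rq_growth:
  assumes x: "x \<noteq> 0"
  shows "rq H1 B1 x > rq H B x"
proof -
  let ?z = "\<Theta> x (cnj_vec x)" and ?g = "G *v x"
  obtain y' where y': "K *v ?z = \<Theta> ?g y'"
    "transpose G *v (cnj_mat H *v y') + B1 *v x = B *v x + cnj_mat H *v cnj_vec x" by (rule K_Theta)
  define p where "p = cnj_vec y'"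
  have "?z \<noteq> 0"
  proof
    assume "?z = 0"
    then have "T *v ?z = 0" by simp
    moreover have "xpart (T *v ?z) = x" by (simp only: T_Theta mkpt_parts)
    ultimately have "x = xpart 0" by simp
    then have "x = 0" by (simp add: xpart_def vec_eq_iff)
    then show False using x by simp
  qed
  then have "Re (\<i> * (symp (cnj_vec (K *v ?z)) (K *v ?z) - symp (cnj_vec ?z) ?z)) > 0"
    using K_pos by (simp add: strictly_positive_def)
  moreover have "symp (cnj_vec ?z) ?z = 0" by (simp add: cnj_Theta symp_Theta)
  moreover have "\<i> * symp (cnj_vec (K *v ?z)) (K *v ?z) = cnj (hip ?g (H *v ?g)) - cnj (hip p (H *v p))"
    unfolding y'(1) cnj_Theta symp_Theta p_def hip_def cnj_cdot
    by (simp add: algebra_simps)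
  ultimately have gp: "Re (hip ?g (H *v ?g)) > Re (hip p (H *v p))"
    by (metis cnj.simps(1) diff_gt_0_iff_gt diff_zero minus_complex.sel(1))
  have "0 \<le> Re (hip (?g - p) (H *v (?g - p)))"
  proof (cases "?g - p = 0")
    case True
    then show ?thesis by (simp only: hip_simps) simp
  next
    case False
    then show ?thesis using H unfolding posdef_def by (blast intro: less_imp_le)
  qed
  moreover have "Re (hip p (H *v ?g)) = Re (hip ?g (H *v p))"
    by (metis H_herm(1) cnj.simps(1) cnj_hip hip_adj)
  ultimately have le: "2 * Re (hip ?g (H *v p)) \<le> Re (hip ?g (H *v ?g)) + Re (hip p (H *v p))"
    by (simp add: hip_simps matrix_vector_mult_diff_distrib)
  have "hadj G *v (H *v p) + cnj_mat B1 *v cnj_vec x = cnj_mat B *v cnj_vec x + H *v x"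
    using arg_cong[OF y'(2), of cnj_vec] by (simp add: p_def hadj_def)
  then have "hip x (hadj G *v (H *v p)) + hip x (cnj_mat B1 *v cnj_vec x) = hip x (cnj_mat B *v cnj_vec x) + hip x (H *v x)"
    by (metis hip_simps(2))
  moreover have "hip x (hadj G *v (H *v p)) = hip ?g (H *v p)" by (simp add: hip_adj)
  moreover have "hip x (cnj_mat C *v cnj_vec x) = cnj (cdot x (C *v x))" for C
    by (simp add: hip_def cnj_cdot)
  ultimately have "Re (hip ?g (H *v p)) + Re (cdot x (B1 *v x)) = Re (cdot x (B *v x)) + Re (hip x (H *v x))"
    by (metis cnj.simps(1) plus_complex.sel(1))
  moreover have "Re (hip x (H1 *v x)) = Re (hip ?g (H *v ?g))" by (simp add: H1_def hip_congruence)
  ultimately show ?thesis using le gp by (simp add: rq_def)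
qed

end

section \<open>The optimal pluriharmonic shift\<close>

lemma matrix_diff_distrib:
  "A ** (B - C) = A ** B - A ** (C :: complex ^ 'm ^ ('m::finite))" "(B - C) ** A = B ** A - C ** A"
  by (simp_all add: matrix_matrix_mult_def vec_eq_iff sum_subtractf algebra_simps)

lemma Wm_diff: "Wm H (B - C) = Wm H B - Wm 0 C"
  by (simp add: Wm_def vec_eq_iff split_sum_all)

lemma Wm_scaleR: "Wm 0 (r *\<^sub>R C) = r *\<^sub>R Wm 0 C"
  by (simp add: Wm_def vec_eq_iff split_sum_all cnj_mat_def)

lemma rq_diff: "rq H (B - C) x = rq H B x - rq 0 C x"
  by (simp add: rq_def matrix_vector_mult_diff_rdistrib cdot_simps hip_simps)

lemma rq_scaleR_mat: "rq 0 (r *\<^sub>R C) x = r * rq 0 C x"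
proof -
  have "(r *\<^sub>R C) *v x = complex_of_real r *s (C *v x)"
    by (simp add: vec_eq_iff matrix_vector_mult_def scaleR_sum_right[symmetric] scaleR_conv_of_real[where 'a = complex] sum_distrib_left mult_ac)
  then show ?thesis by (simp add: rq_def hip_simps cdot_simps)
qed

lemma rq_scaleR: "rq H B (r *\<^sub>R x) = r\<^sup>2 * rq H B x"
  by (simp add: rq_inner linear_scale[OF linear_rl] power2_eq_square)

lemma continuous_rq: "continuous_on S (rq H B)"
proof -
  have "continuous_on S (rl H B)"
    using linear_rl[of H B] by (intro linear_continuous_on) (simp add: linear_conv_bounded_linear)
  then show ?thesis unfolding rq_inner[abs_def] by (intro continuous_intros)
qed

lemma transpose_zero [simp]: "transpose 0 = (0 :: 'a::zero ^ 'n ^ 'm)"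
  by (simp add: transpose_def vec_eq_iff)

lemma transpose_diff: "transpose (A - B) = transpose A - transpose (B :: complex ^ 'n ^ 'm)"
  by (simp add: transpose_def vec_eq_iff)

lemma hadj_one: "hadj (mat 1) = mat 1"
  by (simp add: hadj_def)

text \<open>For Hermitian \<open>H\<close> and symmetric \<open>B\<close> the matrices
  \<open>Wm H B\<close> are exactly those that are Hermitian and invariant under conjugation
  combined with exchange of the two blocks. Both properties pass to the inverse by its
  uniqueness.\<close>

lemma Wm_inverse:
  fixes H B :: "complex ^ 'n ^ 'n"
  assumes H: "hadj H = H" and B: "transpose B = B" and d: "det (Wm H B) \<noteq> 0"
  obtains S t where "Wm H B ** Wm S t = mat 1" "Wm S t ** Wm H B = mat 1" "hadj S = S" "transpose t = t"
proof -
  obtain X where X: "Wm H B ** X = mat 1" "X ** Wm H B = mat 1" by (rule inverse_matrix_exists[OF d])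
  have uniq: "Y = X" if "Y ** Wm H B = mat 1" for Y
    using that X(1) by (metis matrix_mul_assoc matrix_mul_lid matrix_mul_rid)
  obtain S t' t S' where Xb: "X = blk S t' t S'" by (rule blk_cases)
  have W: "hadj (Wm H B) = Wm H B"
  proof -
    have "hadj (cnj_mat B) = B" "hadj (cnj_mat H) = cnj_mat H"
      using B hermitian_cnj[OF H] by (simp_all add: hadj_def)
    moreover have "hadj B = cnj_mat B" using B by (metis cnj_mat_transpose hadj_def)
    ultimately show ?thesis using H by (simp add: Wm_def hadj_blk)
  qed
  have "hadj X ** Wm H B = mat 1"
    using arg_cong[OF X(1), of hadj] by (simp add: hadj_mult W hadj_one)
  then have hX: "hadj X = X" by (rule uniq)
  let ?P = "blk 0 (mat 1) (mat 1) 0 :: complex ^ ('n + 'n) ^ ('n + 'n)"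
  have PP: "?P ** ?P = mat 1" by (simp add: blk_mult blk_one)
  have PW: "?P ** cnj_mat (Wm H B) ** ?P = Wm H B"
    by (simp add: Wm_def cnj_mat_blk blk_mult)
  have "(?P ** cnj_mat X ** ?P) ** (?P ** cnj_mat (Wm H B) ** ?P) = ?P ** (cnj_mat X ** (?P ** ?P) ** cnj_mat (Wm H B)) ** ?P"
    by (simp add: matrix_mul_assoc)
  also have "\<dots> = mat 1"
    using arg_cong[OF X(2), of cnj_mat] by (simp add: PP)
  finally have "?P ** cnj_mat X ** ?P = X" unfolding PW by (rule uniq)
  then have "S' = cnj_mat S" "t' = cnj_mat t"
    unfolding Xb by (auto simp: cnj_mat_blk blk_mult)
  then have Xw: "X = Wm S t" by (simp add: Xb Wm_def)
  have "hadj S = S" "hadj t = cnj_mat t"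
    using hX unfolding Xw Wm_def hadj_blk by (auto simp: hadj_def)
  then have "transpose t = t" by (metis cnj_mat_simps(1) cnj_mat_transpose hadj_def)
  with \<open>hadj S = S\<close> show ?thesis using X unfolding Xw by (intro that)
qed

lemma rl_inverse:
  assumes "Wm H B ** Wm S t = mat 1"
  shows "rl H B (rl S t u) = u"
proof -
  have "Wm H B *v (Wm S t *v mkpt u (cnj_vec u)) = mkpt u (cnj_vec u)"
    by (simp add: matrix_vector_mul_assoc assms)
  then show ?thesis by (simp only: Wm_mult mkpt_eq_iff)
qed

lemma Wm_inverse_apply:
  fixes H B :: "complex ^ 'n ^ 'n"
  assumes "Wm H B ** Wm S t = mat 1"
  shows "H *v (S *v u) + cnj_mat B *v (t *v u) = u" "B *v (S *v u) + cnj_mat H *v (t *v u) = 0"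
proof -
  have "Wm H B *v (Wm S t *v mkpt u 0) = mkpt u 0" by (simp add: matrix_vector_mul_assoc assms)
  then show "H *v (S *v u) + cnj_mat B *v (t *v u) = u" "B *v (S *v u) + cnj_mat H *v (t *v u) = 0"
    by (simp_all add: Wm_def blk_mult_mkpt)
qed

text \<open>Schur complement identity: the first block column of the inverse, completed to a
  triangular matrix, factors \<open>Wm H B\<close> into triangular pieces.\<close>

lemma det_Wm_inverse:
  fixes H B :: "complex ^ 'n ^ 'n"
  assumes "Wm H B ** Wm S t = mat 1"
  shows "det (Wm H B) * det S = cnj (det H)"
proof -
  have "Wm H B ** blk S 0 t (mat 1) = blk (mat 1) (cnj_mat B) 0 (cnj_mat H)"
    using assms unfolding Wm_def blk_mult blk_one[symmetric] by simp
  from arg_cong[OF this, of det] show ?thesis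
    by (simp add: det_mul det_blk_lower det_blk_upper det_cnj_mat)
qed

text \<open>A nontrivial zero of a nonnegative form is a minimum point, so the gradient
  \<open>rl H B x\<close> vanishes there, contradicting invertibility of
  \<open>Wm H B\<close>.\<close>

lemma rq_pos_of_det:
  assumes H: "hadj H = H" and B: "transpose B = B" and nn: "\<And>x. rq H B x \<ge> 0" and d: "det (Wm H B) \<noteq> 0" and x: "x \<noteq> 0"
  shows "rq H B x > 0"
proof (rule ccontr)
  assume "\<not> rq H B x > 0"
  then have q0: "rq H B x = 0" using nn[of x] by simp
  define r where "r = rl H B x"
  define k where "k = rq H B r"
  have k: "k \<ge> 0" unfolding k_def by (rule nn)
  have e: "rq H B (x - \<tau> *\<^sub>R r) = - 2 * \<tau> * (r \<bullet> r) + \<tau>\<^sup>2 * k" for \<tau>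
    using q0 inner_rl_sym[OF H B, of x r]
    by (simp add: rq_inner linear_diff[OF linear_rl] linear_scale[OF linear_rl] r_def[symmetric] k_def inner_simps power2_eq_square algebra_simps)
  have "r \<bullet> r = 0"
  proof (rule ccontr)
    assume "r \<bullet> r \<noteq> 0"
    then have rr: "r \<bullet> r > 0" by simp
    \<comment> \<open>A step against the gradient, short enough for the quadratic term
      \<open>\<tau>\<^sup>2 * k\<close> to stay below the linear decrease; the \<open>+ 1\<close>
      covers \<open>k = 0\<close>.\<close>
    define \<tau> where "\<tau> = (r \<bullet> r) / (k + 1)"
    have \<tau>: "\<tau> > 0" using rr k by (simp add: \<tau>_def)
    have "\<tau> * k < r \<bullet> r" using rr k by (simp add: \<tau>_def field_simps)
    then have "\<tau> * k < 2 * (r \<bullet> r)" using rr by linarith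
    then have "\<tau> * (\<tau> * k) < \<tau> * (2 * (r \<bullet> r))" using \<tau> by (rule mult_strict_left_mono)
    then show False using nn[of "x - \<tau> *\<^sub>R r"] unfolding e by (simp add: power2_eq_square algebra_simps)
  qed
  then have "rl H B x = 0" by (simp add: r_def)
  then have "Wm H B *v mkpt x (cnj_vec x) = 0"
    by (simp only: Wm_mult) (simp add: mkpt_def vec_eq_iff split_sum_all)
  then have "mkpt x (cnj_vec x) = 0" by (rule det_inj[OF d])
  then have "x = xpart 0" by (metis mkpt_parts(1))
  then show False using x by (simp add: xpart_def vec_eq_iff)
qed

lemma continuous_on_det:
  fixes M :: "'a::topological_space \<Rightarrow> complex ^ 'm ^ 'm"
  assumes "\<And>i j. continuous_on S (\<lambda>b. M b $ i $ j)"
  shows "continuous_on S (\<lambda>b. det (M b))"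
  unfolding det_def by (intro continuous_intros assms)

lemma continuous_on_det_Wm: "continuous_on S (\<lambda>b. det (Wm H (B - b)))"
proof (rule continuous_on_det)
  have c: "continuous_on S (\<lambda>b. (b :: complex ^ 'a ^ 'a) $ k $ l)" for k l by (intro continuous_intros)
  show "continuous_on S (\<lambda>b. Wm H (B - b) $ i $ j)" for i j
    by (cases i; cases j) (auto simp: Wm_def cnj_mat_def intro!: continuous_intros c)
qed

text \<open>Nonnegativity instead of positivity makes this set closed, hence compact by
  \<open>bounded_shifts\<close>; degenerate members are excluded later by a vanishing
  determinant.\<close>

definition shifts :: "complex ^ 'n ^ 'n \<Rightarrow> complex ^ 'n ^ 'n \<Rightarrow> (complex ^ 'n ^ 'n) set" where
  "shifts H B = {b. transpose b = b \<and> (\<forall>x. rq H (B - b) x \<ge> 0)}"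

lemma closed_shifts: "closed (shifts H B)"
proof -
  have c: "continuous_on UNIV (\<lambda>b. (b :: complex ^ 'a ^ 'a) $ k $ l)" for k l by (intro continuous_intros)
  have "closed {b :: complex ^ 'a ^ 'a. \<forall>i j. b $ j $ i = b $ i $ j}"
    by (intro closed_Collect_all closed_Collect_eq c)
  moreover have "continuous_on UNIV (\<lambda>b. rq H (B - b) x)" for x
    unfolding rq_diff unfolding rq_def cdot_def hip_def matrix_vector_mult_def
    by (simp, intro continuous_intros c)
  then have "closed {b. \<forall>x. rq H (B - b) x \<ge> 0}"
    by (intro closed_Collect_all closed_Collect_le continuous_on_const)
  ultimately have "closed ({b. \<forall>i j. b $ j $ i = b $ i $ j} \<inter> {b. \<forall>x. rq H (B - b) x \<ge> 0})"
    by (rule closed_Int)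
  also have "{b. \<forall>i j. b $ j $ i = b $ i $ j} \<inter> {b. \<forall>x. rq H (B - b) x \<ge> 0} = shifts H B"
    by (auto simp: shifts_def transpose_def vec_eq_iff)
  finally show ?thesis .
qed

text \<open>Nonnegativity at \<open>x\<close> and at \<open>\<i> *s x\<close> bounds the
  pluriharmonic part of the shifted form, with either sign, by its Hermitian part \<open>h\<close>.
  Polarization together with the parallelogram law for \<open>h\<close> then bounds every matrix
  entry.\<close>

lemma bounded_shifts:
  fixes H B :: "complex ^ 'n ^ 'n"
  assumes H: "posdef H" and B: "transpose B = B"
  shows "bounded (shifts H B)"
proof -
  define h where "h = (\<lambda>x. Re (hip x (H *v x)))"
  have h0: "h x \<ge> 0" for x using H by (cases "x = 0") (auto simp: h_def posdef_def hip_simps less_imp_le)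
  define C where "C = (\<Sum>k\<in>UNIV. h (axis k 1))"
  have hC: "h (axis k 1) \<le> C" for k
    unfolding C_def by (rule member_le_sum) (auto simp: h0)
  have hi: "h (\<i> *s x) = h x" for x by (simp add: h_def matrix_smult hip_simps)
  have par: "h (x + y) + h (x - y) = 2 * h x + 2 * h y" for x y
    by (simp add: h_def matrix_vector_right_distrib matrix_vector_mult_diff_distrib hip_simps)
  have "norm b \<le> norm B + real (CARD('n) * CARD('n)) * (2 * C)" if b: "b \<in> shifts H B" for b
  proof -
    define c where "c = B - b"
    have c: "transpose c = c" using b B by (simp add: c_def shifts_def transpose_diff)
    define q where "q = (\<lambda>x. Re (cdot x (c *v x)))"
    have q: "\<bar>q x\<bar> \<le> h x" for x
    proof -
      have "rq H c x \<ge> 0" "rq H c (\<i> *s x) \<ge> 0" using b by (auto simp: shifts_def c_def)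
      then show ?thesis unfolding rq_i by (simp add: rq_def q_def h_def)
    qed
    have pol: "4 * Re (cdot x (c *v y)) = q (x + y) - q (x - y)" for x y
      using cdot_sym[OF c, of x y]
      by (simp add: q_def matrix_vector_right_distrib matrix_vector_mult_diff_distrib cdot_simps)
    have bd: "2 * \<bar>Re (cdot x (c *v y))\<bar> \<le> h x + h y" for x y
    proof -
      have *: "2 * \<bar>r\<bar> \<le> X + Y"
        if "4 * r = u - v" "\<bar>u\<bar> \<le> a" "\<bar>v\<bar> \<le> a'" "a + a' = 2 * X + 2 * Y" for r u v a a' X Y :: real
      proof -
        have "4 * \<bar>r\<bar> = \<bar>u - v\<bar>" using that(1) by (simp add: abs_mult flip: that(1))
        also have "\<dots> \<le> \<bar>u\<bar> + \<bar>v\<bar>" by (rule abs_triangle_ineq4)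
        also have "\<dots> \<le> 2 * X + 2 * Y" using that by linarith
        finally show ?thesis by simp
      qed
      show ?thesis by (rule *[OF pol q q par])
    qed
    have ent: "cdot (axis i 1) (c *v axis j 1) = c $ i $ j" for i j
      by (simp add: cdot_def axis_def matrix_vector_mult_def if_distrib if_distribR cong: if_cong)
    have entry: "norm (c $ i $ j) \<le> 2 * C" for i j
    proof -
      have "\<bar>Re (c $ i $ j)\<bar> \<le> C" using bd[of "axis i 1" "axis j 1"] hC[of i] hC[of j] unfolding ent by linarith
      moreover have "cdot (axis i 1) (c *v (\<i> *s axis j 1)) = \<i> * c $ i $ j"
        by (simp only: matrix_smult cdot_simps ent)
      then have "\<bar>Im (c $ i $ j)\<bar> \<le> C"
        using bd[of "axis i 1" "\<i> *s axis j 1"] hC[of i] hC[of j] unfolding hi by simp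
      ultimately show ?thesis using cmod_le[of "c $ i $ j"] by linarith
    qed
    have row: "norm (c $ i) \<le> real (CARD('n)) * (2 * C)" for i
    proof -
      have "norm (c $ i) \<le> (\<Sum>j\<in>UNIV. norm (c $ i $ j))" unfolding norm_vec_def by (rule L2_set_le_sum) simp
      also have "\<dots> \<le> (\<Sum>j\<in>(UNIV :: 'n set). 2 * C)" by (rule sum_mono) (rule entry)
      finally show ?thesis by simp
    qed
    have "norm c \<le> (\<Sum>i\<in>UNIV. norm (c $ i))" unfolding norm_vec_def[of c] by (rule L2_set_le_sum) simp
    also have "\<dots> \<le> (\<Sum>i\<in>(UNIV :: 'n set). real (CARD('n)) * (2 * C))" by (rule sum_mono) (rule row)
    finally have "norm c \<le> real (CARD('n) * CARD('n)) * (2 * C)" by simp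
    moreover have "norm b \<le> norm B + norm c" using norm_triangle_ineq4[of B c] by (simp add: c_def)
    ultimately show ?thesis by simp
  qed
  then show ?thesis by (auto simp: bounded_iff)
qed

text \<open>On the compact unit sphere the positive form is bounded away from 0 and the perturbing
  form is bounded; homogeneity extends the estimate to all \<open>x\<close>.\<close>

lemma shifts_perturb:
  fixes H C Z :: "complex ^ 'n ^ 'n"
  assumes pos: "\<And>x. x \<noteq> 0 \<Longrightarrow> rq H C x > 0"
  shows "\<exists>\<delta>>0. \<forall>\<tau>. \<bar>\<tau>\<bar> < \<delta> \<longrightarrow> (\<forall>x. rq H (C - \<tau> *\<^sub>R Z) x \<ge> 0)"
proof -
  let ?S = "sphere 0 1 :: (complex ^ 'n) set"
  have ne: "?S \<noteq> {}" by (metis empty_iff mem_sphere_0 vector_choose_size zero_le_one)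
  obtain a where a: "a \<in> ?S" "\<And>x. x \<in> ?S \<Longrightarrow> rq H C a \<le> rq H C x"
    using continuous_attains_inf[OF compact_sphere ne continuous_rq[of _ H C]] by blast
  have "\<exists>x\<in>?S. \<forall>y\<in>?S. \<bar>rq 0 Z y\<bar> \<le> \<bar>rq 0 Z x\<bar>"
    by (intro continuous_attains_sup compact_sphere ne continuous_on_rabs continuous_rq)
  then obtain c where c: "\<And>x. x \<in> ?S \<Longrightarrow> \<bar>rq 0 Z x\<bar> \<le> c" by blast
  have c0: "c \<ge> 0" using c[OF a(1)] by linarith
  define m where "m = rq H C a"
  have m: "m > 0" unfolding m_def using a(1) by (intro pos) auto
  show ?thesis
  proof (intro exI[of _ "m / (c + 1)"] conjI allI impI)
    show "m / (c + 1) > 0" using m c0 by simp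
    fix \<tau> :: real and x :: "complex ^ 'n" assume \<tau>: "\<bar>\<tau>\<bar> < m / (c + 1)"
    show "rq H (C - \<tau> *\<^sub>R Z) x \<ge> 0"
    proof (cases "x = 0")
      case False
      define u where "u = x /\<^sub>R norm x"
      have u: "u \<in> ?S" "x = norm x *\<^sub>R u" using False by (auto simp: u_def)
      have "\<bar>\<tau> * rq 0 Z u\<bar> \<le> m / (c + 1) * c" unfolding abs_mult using \<tau> c[OF u(1)] by (intro mult_mono) auto
      also have "\<dots> \<le> m" using m c0 by (simp add: field_simps)
      finally have "\<tau> * rq 0 Z u \<le> m" by simp
      then have "rq H (C - \<tau> *\<^sub>R Z) u \<ge> 0"
        using a(2)[OF u(1)] by (simp add: rq_diff rq_scaleR_mat m_def)
      then show ?thesis by (subst u(2)) (simp add: rq_scaleR)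
    qed (simp add: rq_inner)
  qed
qed

text \<open>The perturbed matrix is \<open>Wm H B\<close> times a curve through the identity, so the
  derivative is a trace. Its two diagonal blocks have conjugate traces, whence the factor 2.\<close>

lemma det_Wm_derivative:
  fixes H B Z S t :: "complex ^ 'n ^ 'n"
  assumes W: "Wm H B ** Wm S t = mat 1" and dW: "det (Wm H B) = complex_of_real d"
  shows "((\<lambda>\<tau>. Re (det (Wm H (B - \<tau> *\<^sub>R Z)))) has_real_derivative - 2 * d * Re (trace (cnj_mat t ** Z))) (at 0)"
proof -
  let ?X = "\<lambda>\<tau>::real. mat 1 - \<tau> *\<^sub>R (Wm S t ** Wm 0 Z)"
  have "((\<lambda>\<tau>. det (?X \<tau>)) has_vector_derivative trace (- (Wm S t ** Wm 0 Z))) (at 0)"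
  proof (rule has_derivative_det_one)
    show "((\<lambda>\<tau>. ?X \<tau> $ i $ j) has_vector_derivative (- (Wm S t ** Wm 0 Z)) $ i $ j) (at 0)" for i j
      by (auto intro!: derivative_eq_intros simp: has_vector_derivative_def)
  qed simp
  then have D: "((\<lambda>\<tau>. complex_of_real d * det (?X \<tau>)) has_vector_derivative complex_of_real d * trace (- (Wm S t ** Wm 0 Z))) (at 0)"
    by (rule has_vector_derivative_mult_right)
  have "complex_of_real d * det (?X \<tau>) = det (Wm H (B - \<tau> *\<^sub>R Z))" for \<tau>
  proof -
    have "Wm H B ** ?X \<tau> = Wm H B - \<tau> *\<^sub>R (Wm H B ** Wm S t ** Wm 0 Z)"
      by (simp add: matrix_diff_distrib matrix_scaleR matrix_mul_assoc)
    also have "\<dots> = Wm H (B - \<tau> *\<^sub>R Z)" by (simp add: W Wm_diff Wm_scaleR)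
    finally show ?thesis by (metis dW det_mul)
  qed
  moreover have "Re (complex_of_real d * trace (- (Wm S t ** Wm 0 Z))) = - 2 * d * Re (trace (cnj_mat t ** Z))"
  proof -
    have tn: "trace (- Y) = - trace Y" for Y :: "complex ^ ('n + 'n) ^ ('n + 'n)"
      by (simp add: trace_def sum_negf)
    have "trace (t ** cnj_mat Z) = cnj (trace (cnj_mat t ** Z))"
      by (simp add: trace_def matrix_matrix_mult_def cnj_mat_def)
    then have "trace (Wm S t ** Wm 0 Z) = trace (cnj_mat t ** Z) + cnj (trace (cnj_mat t ** Z))"
      by (simp add: Wm_def blk_mult trace_blk)
    then show ?thesis by (simp add: tn)
  qed
  moreover have "((\<lambda>\<tau>. Re (complex_of_real d * det (?X \<tau>))) has_derivative
      (\<lambda>h. Re (h *\<^sub>R (complex_of_real d * trace (- (Wm S t ** Wm 0 Z)))))) (at 0)"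
    by (rule has_derivative_Re[OF D[unfolded has_vector_derivative_def]])
  ultimately have "((\<lambda>\<tau>. Re (det (Wm H (B - \<tau> *\<^sub>R Z)))) has_derivative
      (\<lambda>h. h * (- 2 * d * Re (trace (cnj_mat t ** Z))))) (at 0)"
    by (simp only: scaleR_complex.sel)
  then show ?thesis
    unfolding has_field_derivative_def by (rule has_derivative_eq_rhs) (simp add: fun_eq_iff mult.commute)
qed

text \<open>Both forms are shifted by the same pluriharmonic form Re (x . b x). Maximality of the ratio
  of determinants makes the off-diagonal blocks t of the two inverses agree.\<close>

lemma optimal_shift:
  fixes H B H1 B1 :: "complex ^ 'n ^ 'n"
  assumes H: "posdef H" and B: "transpose B = B" and H1: "hadj H1 = H1" and B1: "transpose B1 = B1"
    and growth: "\<And>x. x \<noteq> 0 \<Longrightarrow> rq H1 B1 x > rq H B x"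
  obtains b S S1 t where "transpose b = b" "\<And>x. x \<noteq> 0 \<Longrightarrow> rq H (B - b) x > 0"
    "Wm H (B - b) ** Wm S t = mat 1" "Wm S t ** Wm H (B - b) = mat 1" "hadj S = S"
    "Wm H1 (B1 - b) ** Wm S1 t = mat 1" "hadj S1 = S1" "transpose t = t"
proof -
  have Hh: "hadj H = H" using H by (simp add: posdef_def)
  have tB: "transpose (B - b) = B - b" "transpose (B1 - b) = B1 - b" if "b \<in> shifts H B" for b
    using that B B1 by (auto simp: shifts_def transpose_diff)
  have pos1: "rq H1 (B1 - b) x > 0" if "b \<in> shifts H B" "x \<noteq> 0" for b x
    using that growth[OF that(2)] by (auto simp: shifts_def rq_diff) (smt (verit, best))
  have d1: "\<exists>d>0. det (Wm H1 (B1 - b)) = complex_of_real d" if b: "b \<in> shifts H B" for b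
    using gaussian_integral[OF H1 tB(2)[OF b] pos1[OF b]] by metis
  define f where "f = (\<lambda>b. Re (det (Wm H (B - b))) / Re (det (Wm H1 (B1 - b))))"
  have r1: "Re (det (Wm H1 (B1 - b))) > 0" if "b \<in> shifts H B" for b using d1[OF that] by auto
  have "continuous_on (shifts H B) f"
    unfolding f_def using r1 by (intro continuous_intros continuous_on_det_Wm) fastforce
  moreover have "compact (shifts H B)"
    using closed_shifts bounded_shifts[OF H B] by (simp add: compact_eq_bounded_closed)
  moreover have H0: "rq H 0 x > 0" if "x \<noteq> 0" for x
    using H that by (simp add: rq_def posdef_def cdot_simps)
  have B_in: "B \<in> shifts H B"
    unfolding shifts_def using B H0 by (auto, case_tac "x = 0") (auto simp: rq_inner intro: less_imp_le)
  ultimately obtain b where b: "b \<in> shifts H B" "\<And>c. c \<in> shifts H B \<Longrightarrow> f c \<le> f b"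
    using continuous_attains_sup[of "shifts H B" f] by blast
  \<comment> \<open>The shift by \<open>B\<close> itself leaves the positive form of
    \<open>H\<close>, so the maximum of \<open>f\<close> is positive. The shifted form at
    \<open>b\<close> is therefore nondegenerate, and small symmetric perturbations of
    \<open>b\<close> stay in \<open>shifts H B\<close>.\<close>
  obtain dB where "dB > 0" "det (Wm H 0) = complex_of_real dB"
    using gaussian_integral[OF Hh transpose_zero H0] by metis
  then have "f B > 0" using r1[OF B_in] by (simp add: f_def)
  then have "f b > 0" using b(2)[OF B_in] by simp
  then have "det (Wm H (B - b)) \<noteq> 0" unfolding f_def by auto
  then have pos: "rq H (B - b) x > 0" if "x \<noteq> 0" for x
    using b(1) that by (intro rq_pos_of_det[OF Hh tB(1)[OF b(1)]]) (auto simp: shifts_def)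
  obtain d where d: "d > 0" "det (Wm H (B - b)) = complex_of_real d"
    using gaussian_integral[OF Hh tB(1)[OF b(1)] pos] by metis
  obtain d' where d': "d' > 0" "det (Wm H1 (B1 - b)) = complex_of_real d'" using d1[OF b(1)] by auto
  obtain S t where S: "Wm H (B - b) ** Wm S t = mat 1" "Wm S t ** Wm H (B - b) = mat 1" "hadj S = S" "transpose t = t"
  proof (rule Wm_inverse[OF Hh tB(1)[OF b(1)]])
    show "det (Wm H (B - b)) \<noteq> 0" using d by simp
  qed
  obtain S1 t1 where S1: "Wm H1 (B1 - b) ** Wm S1 t1 = mat 1" "hadj S1 = S1" "transpose t1 = t1"
  proof (rule Wm_inverse[OF H1 tB(2)[OF b(1)]])
    show "det (Wm H1 (B1 - b)) \<noteq> 0" using d' by simp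
  qed
  \<comment> \<open>The direction is dictated by the goal: the logarithmic derivative of
    \<open>f\<close> along \<open>Z\<close> is -2 times the sum of the squared moduli of the entries
    of \<open>Z\<close>, so criticality forces \<open>Z = 0\<close>.\<close>
  define Z where "Z = t - t1"
  have Zs: "transpose Z = Z" by (simp add: Z_def transpose_diff S S1)
  let ?a = "Re (trace (cnj_mat t ** Z))" and ?a1 = "Re (trace (cnj_mat t1 ** Z))"
  have Df: "((\<lambda>\<tau>. f (b + \<tau> *\<^sub>R Z)) has_real_derivative
      ((- 2 * d * ?a) * Re (det (Wm H1 (B1 - b - 0 *\<^sub>R Z))) - Re (det (Wm H (B - b - 0 *\<^sub>R Z))) * (- 2 * d' * ?a1))
      / (Re (det (Wm H1 (B1 - b - 0 *\<^sub>R Z))) * Re (det (Wm H1 (B1 - b - 0 *\<^sub>R Z))))) (at 0)"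
    unfolding f_def diff_diff_eq[symmetric]
    by (rule DERIV_divide[OF det_Wm_derivative[OF S(1) d(2)] det_Wm_derivative[OF S1(1) d'(2)]]) (use d' in simp)
  obtain \<delta> where \<delta>: "\<delta> > 0" "\<And>\<tau> x. \<bar>\<tau>\<bar> < \<delta> \<Longrightarrow> rq H (B - b - \<tau> *\<^sub>R Z) x \<ge> 0"
    using shifts_perturb[OF pos, of Z] by blast
  have mx: "\<forall>\<tau>. \<bar>0 - \<tau>\<bar> < \<delta> \<longrightarrow> f (b + \<tau> *\<^sub>R Z) \<le> f (b + 0 *\<^sub>R Z)"
  proof (intro allI impI)
    fix \<tau> assume "\<bar>0 - \<tau>\<bar> < \<delta>"
    then have "b + \<tau> *\<^sub>R Z \<in> shifts H B"
      using \<delta>(2)[of \<tau>] b(1) Zs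
      by (auto simp: shifts_def diff_diff_eq) (simp add: transpose_def vec_eq_iff)
    then show "f (b + \<tau> *\<^sub>R Z) \<le> f (b + 0 *\<^sub>R Z)" using b(2) by simp
  qed
  have "?a = ?a1"
    using DERIV_local_max[OF Df \<delta>(1) mx] d d' by simp
  moreover have "?a - ?a1 = (\<Sum>i\<in>UNIV. \<Sum>j\<in>UNIV. (norm (Z $ i $ j))\<^sup>2)"
  proof -
    have Zij: "Z $ j $ i = Z $ i $ j" for i j using Zs by (simp add: transpose_def vec_eq_iff)
    have "?a - ?a1 = Re (trace (cnj_mat Z ** Z))"
      by (simp add: Z_def matrix_diff_distrib trace_sub)
    also have "\<dots> = (\<Sum>i\<in>UNIV. \<Sum>j\<in>UNIV. Re (cnj (Z $ i $ j) * Z $ i $ j))"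
      unfolding trace_def matrix_matrix_mult_def cnj_mat_def by (simp add: Zij)
    also have "\<dots> = (\<Sum>i\<in>UNIV. \<Sum>j\<in>UNIV. (norm (Z $ i $ j))\<^sup>2)"
      unfolding cmod_power2 by (simp add: power2_eq_square)
    finally show ?thesis .
  qed
  ultimately have "(\<Sum>i\<in>UNIV. \<Sum>j\<in>UNIV. (norm (Z $ i $ j))\<^sup>2) = 0" by simp
  then have "Z = 0"
    by (subst (asm) sum_nonneg_eq_0_iff) (auto simp: sum_nonneg sum_nonneg_eq_0_iff vec_eq_iff)
  then have "t1 = t" by (simp add: Z_def)
  with S S1 pos b(1) show ?thesis by (intro that[of b S t S1]) (auto simp: shifts_def)
qed

text \<open>Inversion reverses the order of positive forms, here through
  \<open>rq H B (?x - ?y) \<ge> 0\<close> for the images \<open>?x\<close> and \<open>?y\<close> of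
  \<open>u\<close> under the two inverses, with strictness from \<open>growth\<close> at
  \<open>?y\<close>. Because the blocks \<open>t\<close> coincide, the inverses differ only by the
  complex linear map \<open>S - S1\<close>.\<close>

lemma covariance_difference:
  fixes H B H1 B1 S S1 t :: "complex ^ 'n ^ 'n"
  assumes H: "hadj H = H" "transpose B = B" and pos: "\<And>x. x \<noteq> 0 \<Longrightarrow> rq H B x > 0"
    and growth: "\<And>x. x \<noteq> 0 \<Longrightarrow> rq H1 B1 x > rq H B x"
    and W: "Wm H B ** Wm S t = mat 1" "Wm S t ** Wm H B = mat 1" and S: "hadj S = S"
    and W1: "Wm H1 B1 ** Wm S1 t = mat 1" and S1: "hadj S1 = S1"
  shows "posdef S1" "posdef (S - S1)" "rl H1 B1 (x - (S - S1) *v rl H B x) = rl H B x"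
proof -
  have q0: "rq H B x \<ge> 0" for x using pos[of x] by (cases "x = 0") (auto simp: rq_inner)
  have nz: "rl S1 t u \<noteq> 0" if "u \<noteq> 0" for u
    using rl_inverse[OF W1, of u] that linear_0[OF linear_rl] by metis
  show "posdef S1"
  proof (rule posdef_of_rq[OF S1])
    fix u :: "complex ^ 'n" assume u: "u \<noteq> 0"
    have "rq S1 t u = rq H1 B1 (rl S1 t u)" by (simp add: rq_inner rl_inverse[OF W1] inner_commute)
    then show "rq S1 t u > 0" using growth[OF nz[OF u]] q0[of "rl S1 t u"] by simp
  qed
  have df: "rl S t u - rl S1 t u = (S - S1) *v u" for u
    by (simp add: rl_def matrix_vector_mult_diff_rdistrib)
  show "posdef (S - S1)"
    unfolding posdef_def
  proof (intro conjI allI impI)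
    show "hadj (S - S1) = S - S1" by (simp add: hadj_add S S1)
    fix u :: "complex ^ 'n" assume u: "u \<noteq> 0"
    let ?x = "rl S t u" and ?y = "rl S1 t u"
    have "0 \<le> rq H B (?x - ?y)" by (rule q0)
    also have "\<dots> = ?x \<bullet> u - 2 * (?y \<bullet> u) + rq H B ?y"
      using inner_rl_sym[OF H, of ?x ?y]
      by (simp add: rq_inner linear_diff[OF linear_rl] rl_inverse[OF W(1)] inner_simps inner_commute[of u])
    finally have "?x \<bullet> u - ?y \<bullet> u \<ge> ?y \<bullet> u - rq H B ?y" by simp
    moreover have "?y \<bullet> u = rq H1 B1 ?y" by (simp add: rq_inner rl_inverse[OF W1])
    ultimately have "?x \<bullet> u - ?y \<bullet> u > 0" using growth[OF nz[OF u]] by simp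
    then have "((S - S1) *v u) \<bullet> u > 0" by (simp add: df[symmetric] inner_simps)
    then show "Re (hip u ((S - S1) *v u)) > 0" by (simp add: Re_hip inner_commute)
  qed
  let ?u = "rl H B x"
  have "x = rl S t ?u" using rl_inverse[OF W(2)] by simp
  then have "x - (S - S1) *v ?u = rl S1 t ?u" using df[of ?u] by (simp add: algebra_simps)
  then show "rl H1 B1 (x - (S - S1) *v ?u) = ?u" by (simp add: rl_inverse[OF W1])
qed

section \<open>Holomorphic functions and eigenvectors\<close>

lemma holo_const: "holo (\<lambda>x. c)"
  unfolding holo_def by (intro allI exI[of _ "\<lambda>_. 0"]) auto

lemma holo_vec_nth: "holo (\<lambda>x. x $ i)"
  unfolding holo_def
  by (intro allI exI[of _ "\<lambda>x. x $ i"]) (auto intro!: bounded_linear_imp_has_derivative bounded_linear_vec_nth)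

lemma holo_add: "holo f \<Longrightarrow> holo g \<Longrightarrow> holo (\<lambda>x. f x + g x)"
  unfolding holo_def
proof
  fix z assume "\<forall>z. \<exists>L. (f has_derivative L) (at z) \<and> (\<forall>c w. L (c *s w) = c * L w)"
    "\<forall>z. \<exists>L. (g has_derivative L) (at z) \<and> (\<forall>c w. L (c *s w) = c * L w)"
  then obtain L L' where "(f has_derivative L) (at z)" "\<forall>c w. L (c *s w) = c * L w"
    "(g has_derivative L') (at z)" "\<forall>c w. L' (c *s w) = c * L' w" by metis
  note d = this
  have "((\<lambda>x. f x + g x) has_derivative (\<lambda>h. L h + L' h)) (at z)"
    by (rule has_derivative_add[OF d(1) d(3)])
  then show "\<exists>L. ((\<lambda>x. f x + g x) has_derivative L) (at z) \<and> (\<forall>c w. L (c *s w) = c * L w)"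
    using d by (intro exI[of _ "\<lambda>h. L h + L' h"]) (auto simp: algebra_simps)
qed

lemma holo_mult: "holo f \<Longrightarrow> holo g \<Longrightarrow> holo (\<lambda>x. f x * g x)"
  unfolding holo_def
proof
  fix z assume "\<forall>z. \<exists>L. (f has_derivative L) (at z) \<and> (\<forall>c w. L (c *s w) = c * L w)"
    "\<forall>z. \<exists>L. (g has_derivative L) (at z) \<and> (\<forall>c w. L (c *s w) = c * L w)"
  then obtain L L' where "(f has_derivative L) (at z)" "\<forall>c w. L (c *s w) = c * L w"
    "(g has_derivative L') (at z)" "\<forall>c w. L' (c *s w) = c * L' w" by metis
  note d = this
  have "((\<lambda>x. f x * g x) has_derivative (\<lambda>h. f z * L' h + L h * g z)) (at z)"
    by (rule has_derivative_mult[OF d(1) d(3)])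
  then show "\<exists>L. ((\<lambda>x. f x * g x) has_derivative L) (at z) \<and> (\<forall>c w. L (c *s w) = c * L w)"
    using d by (intro exI[of _ "\<lambda>h. f z * L' h + L h * g z"]) (auto simp: algebra_simps)
qed

lemma holo_sum: "(\<And>i. i \<in> I \<Longrightarrow> holo (f i)) \<Longrightarrow> holo (\<lambda>x. \<Sum>i\<in>I. f i x)"
  by (induction I rule: infinite_finite_induct) (auto intro: holo_const holo_add)

lemma holo_exp:
  assumes "holo f"
  shows "holo (\<lambda>x. exp (f x))"
  unfolding holo_def
proof
  fix z
  obtain L where L: "(f has_derivative L) (at z)" "\<forall>c w. L (c *s w) = c * L w"
    using assms unfolding holo_def by blast
  have "((\<lambda>x. exp (f x)) has_derivative (\<lambda>h. exp (f z) * L h)) (at z)"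
    using diff_chain_at[OF L(1) DERIV_exp[unfolded has_field_derivative_def]] by (simp add: o_def)
  then show "\<exists>L. ((\<lambda>x. exp (f x)) has_derivative L) (at z) \<and> (\<forall>c w. L (c *s w) = c * L w)"
    using L(2) by (intro exI[of _ "\<lambda>h. exp (f z) * L h"]) auto
qed

lemma holo_compose_matrix:
  fixes A :: "complex ^ 'n ^ 'n"
  assumes "holo f"
  shows "holo (\<lambda>x. f (A *v x))"
  unfolding holo_def
proof
  fix z
  obtain L where L: "(f has_derivative L) (at (A *v z))" "\<forall>c w. L (c *s w) = c * L w"
    using assms unfolding holo_def by blast
  have "((*v) A has_derivative (*v) A) (at z)"
    using linear_matrix_vector[of A] by (intro bounded_linear_imp_has_derivative) (simp add: linear_conv_bounded_linear)
  from diff_chain_at[OF this L(1)] have "((\<lambda>x. f (A *v x)) has_derivative (\<lambda>h. L (A *v h))) (at z)" by (simp add: o_def)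
  then show "\<exists>L. ((\<lambda>x. f (A *v x)) has_derivative L) (at z) \<and> (\<forall>c w. L (c *s w) = c * L w)"
    using L(2) by (intro exI[of _ "\<lambda>h. L (A *v h)"]) (auto simp: matrix_smult)
qed

lemma holo_gaussian: "holo (\<lambda>x. exp (c * cdot x (b *v x)))"
  unfolding cdot_def matrix_vector_mult_def
  by (simp, intro holo_exp holo_mult holo_const holo_sum holo_vec_nth)

lemma norm_gaussian_sq: "(norm (exp (1 / 2 * cdot x (b *v x))))\<^sup>2 = exp (Re (cdot x (b *v x)))"
  "(norm (exp (- (1 / 2) * cdot x (b *v x))))\<^sup>2 = exp (- Re (cdot x (b *v x)))"
  by (simp_all add: power2_eq_square exp_add[symmetric])

lemma matrix_axis: "X *v axis j 1 = column j (X :: complex ^ 'm ^ 'k)"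
  by (simp add: column_def matrix_vector_mult_def axis_def vec_eq_iff if_distrib cong: if_cong)

context evolution_chart
begin

lemma Theta_smult: "\<Theta> (c *s x) (c *s y) = c *s \<Theta> x y"
proof (rule T_inj)
  have "T *v (c *s \<Theta> x y) = c *s mkpt x (- \<i> *s (B *v x + cnj_mat H *v y))"
    by (simp only: matrix_smult T_Theta)
  also have "\<dots> = T *v \<Theta> (c *s x) (c *s y)"
    unfolding T_Theta matrix_smult by (simp add: vec_eq_iff split_sum_all algebra_simps)
  finally show "T *v \<Theta> (c *s x) (c *s y) = T *v (c *s \<Theta> x y)" ..
qed

text \<open>(S u, t u) is the first block column of one inverse applied to \<open>u\<close>, and (S1
  u, t u) that of the other; the common \<open>t\<close> makes the implicit equations of
  \<open>K_Theta\<close> solvable. With S u = s S1 u, they show that \<open>K\<close> maps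
  \<Theta>(S u, t u) to \<Theta>(G S u, s conj(G) t u) and conj(K) maps it to \<Theta>(G S1 u,
  conj(G) t u), and these are proportional.\<close>

lemma eigenvector:
  assumes W: "Wm H (B - b) ** Wm S t = mat 1" and W1: "Wm H1 (B1 - b) ** Wm S1 t = mat 1"
    and u: "S *v u = s *s (S1 *v u)"
  shows "K *v \<Theta> (S *v u) (t *v u) = s *s (cnj_mat K *v \<Theta> (S *v u) (t *v u))"
proof -
  let ?x = "S *v u" and ?x1 = "S1 *v u" and ?y = "t *v u"
  note a = Wm_inverse_apply[OF W, of u] and a1 = Wm_inverse_apply[OF W1, of u]
  obtain y' where y': "K *v \<Theta> ?x ?y = \<Theta> (G *v ?x) y'"
    "transpose G *v (cnj_mat H *v y') + B1 *v ?x = B *v ?x + cnj_mat H *v ?y" by (rule K_Theta)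
  obtain y2 where y2: "K *v \<Theta> (cnj_vec ?y) (cnj_vec ?x) = \<Theta> (G *v cnj_vec ?y) y2"
    "transpose G *v (cnj_mat H *v y2) + B1 *v cnj_vec ?y = B *v cnj_vec ?y + cnj_mat H *v cnj_vec ?x" by (rule K_Theta)
  have inj: "p = q" if "hadj G *v (H *v p) = hadj G *v (H *v q)" for p q
  proof -
    have "hadj G *v (H *v (p - q)) = 0" using that by (simp add: matrix_vector_mult_diff_distrib)
    moreover have "det (hadj G) \<noteq> 0" using left_inverse_det[OF FG] by (simp add: det_hadj)
    ultimately have "p - q = 0" using det_inj posdef_det[OF H] by blast
    then show ?thesis by simp
  qed
  \<comment> \<open>It suffices to compare images under the injective \<open>hadj G ** H\<close>. In
    \<open>e1\<close> the right-hand side equals u + conj(b) t u by the first row for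
    \<open>S\<close>, and the same vector is obtained from the first row for
    \<open>S1\<close>.\<close>
  have "cnj_vec y2 = G *v ?x1"
  proof (rule inj)
    have e1: "hadj G *v (H *v cnj_vec y2) + cnj_mat B1 *v ?y = cnj_mat B *v ?y + H *v ?x"
      using arg_cong[OF y2(2), of cnj_vec] by (simp add: hadj_def)
    have e2: "hadj G *v (H *v (G *v ?x1)) = H1 *v ?x1"
      by (simp add: H1_def matrix_vector_mul_assoc matrix_mul_assoc)
    show "hadj G *v (H *v cnj_vec y2) = hadj G *v (H *v (G *v ?x1))"
    proof -
      have "p = v" if "p + q = r + r'" "r' + (r - w) = z" "v + (q - w) = z" for p q r r' v w z :: "complex ^ 'n"
      proof -
        have "r' + (r - w) = v + (q - w)" using that by simp
        then have "r' + r = v + q" by (simp add: add_diff_eq)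
        then show ?thesis using that(1) by (simp add: add.commute)
      qed
      from this[OF e1, of "cnj_mat b *v ?y" u "H1 *v ?x1"] a(1) a1(1)
      show ?thesis by (simp only: e2 cnj_mat_simps(3) matrix_vector_mult_diff_rdistrib)
    qed
  qed
  then have 1: "G *v ?x = s *s cnj_vec y2"
    by (simp add: u matrix_smult)
  have group: "p = w - q" if "p + q = r + r'" "r - w + r' = 0" for p q r r' w :: "complex ^ 'n"
  proof -
    have "r + r' = w" using that(2) by (simp add: diff_add_eq)
    then show ?thesis using that(1) by (simp add: eq_diff_eq)
  qed
  have "cnj_vec y' = s' *s (G *v cnj_vec ?y)" if "s' = cnj s" for s'
  proof (rule inj)
    have "transpose G *v (cnj_mat H *v y') = (b - B1) *v ?x"
      unfolding matrix_vector_mult_diff_rdistrib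
      by (rule group[OF y'(2)]) (use a(2) in \<open>simp add: matrix_vector_mult_diff_rdistrib\<close>)
    also have "\<dots> = s *s ((b - B1) *v ?x1)" by (simp only: u matrix_smult)
    also have "(b - B1) *v ?x1 = cnj_mat H1 *v ?y"
      using group[of "cnj_mat H1 *v ?y" "B1 *v ?x1" "B1 *v ?x1" "cnj_mat H1 *v ?y" "b *v ?x1"] a1(2)
      by (simp add: matrix_vector_mult_diff_rdistrib add.commute)
    finally have "cnj_vec (transpose G *v (cnj_mat H *v y')) = cnj_vec (s *s (cnj_mat H1 *v ?y))" by simp
    then show "hadj G *v (H *v cnj_vec y') = hadj G *v (H *v (s' *s (G *v cnj_vec ?y)))"
      by (simp add: hadj_def H1_def that matrix_smult matrix_vector_mul_assoc matrix_mul_assoc)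
  qed
  from this[OF refl] have "cnj_vec (cnj_vec y') = cnj_vec (cnj s *s (G *v cnj_vec ?y))" by simp
  then have 2: "y' = s *s (cnj_mat G *v ?y)" by simp
  have "cnj_mat K *v \<Theta> ?x ?y = cnj_vec (K *v \<Theta> (cnj_vec ?y) (cnj_vec ?x))"
  proof -
    have "cnj_vec (K *v \<Theta> (cnj_vec ?y) (cnj_vec ?x)) = cnj_mat K *v cnj_vec (\<Theta> (cnj_vec ?y) (cnj_vec ?x))"
      by (rule cnj_vec_simps)
    then show ?thesis by (simp only: cnj_Theta cnj_vec_simps(1))
  qed
  also have "\<dots> = \<Theta> (cnj_vec y2) (cnj_mat G *v ?y)"
    unfolding y2(1) cnj_Theta by (simp only: cnj_vec_simps(7) cnj_vec_simps(1) cnj_mat_simps(1))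
  finally show ?thesis
    unfolding y'(1) by (simp only: 1 2 Theta_smult)
qed

lemma det_K: "det K \<noteq> 0"
proof -
  have "det T * det K = det G * det F * det T"
    using arg_cong[OF T_K, of det] by (simp add: det_mul det_blk_lower)
  then show ?thesis using left_inverse_det[OF FG] det_T by auto
qed

text \<open>Besides the vectors of \<open>eigenvector\<close> their conjugates are used: the
  \<open>k j\<close> are real, so conjugating the relation between \<open>K\<close> and its
  conjugate exchanges the two matrices and inverts the eigenvalue.\<close>

lemma charpoly_K:
  fixes k :: "'n \<Rightarrow> real"
  assumes W: "Wm H (B - b) ** Wm S t = mat 1" and W1: "Wm H1 (B1 - b) ** Wm S1 t = mat 1"
    and U: "det U \<noteq> 0" and SU: "S ** U = S1 ** U ** diagm k" and S: "det S \<noteq> 0" and k: "\<And>j. k j \<noteq> 0"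
  shows "charpoly (matrix_inv (cnj_mat K) ** K) =
    (\<Prod>j\<in>UNIV. [:- complex_of_real (k j), 1:] * [:- complex_of_real (inverse (k j)), 1:])"
proof -
  define e where "e = (\<lambda>j. \<Theta> (S *v column j U) (t *v column j U))"
  define v where "v = case_sum e (\<lambda>j. cnj_vec (e j))"
  define l where "l = case_sum (\<lambda>j. complex_of_real (k j)) (\<lambda>j. complex_of_real (inverse (k j)))"
  have colS: "column j (S' ** U) = S' *v column j U" for j and S' :: "complex ^ 'n ^ 'n"
    by (simp add: column_def matrix_matrix_mult_def matrix_vector_mult_def)
  have Su: "S *v column j U = complex_of_real (k j) *s (S1 *v column j U)" for j
  proof -
    have "S *v column j U = column j (S1 ** U ** diagm k)" by (simp add: colS[symmetric] SU)
    also have "\<dots> = complex_of_real (k j) *s column j (S1 ** U)"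
    proof -
      have "(X ** diagm k) $ i $ j = complex_of_real (k j) * X $ i $ j" for X :: "complex ^ 'n ^ 'n" and i
        unfolding matrix_matrix_mult_def diagm_def vec_lambda_beta
        by (simp add: if_distrib cong: if_cong)
      then show ?thesis by (simp add: column_def vec_eq_iff)
    qed
    finally show ?thesis by (simp add: colS)
  qed
  have Ke: "K *v e j = complex_of_real (k j) *s (cnj_mat K *v e j)" for j
    unfolding e_def by (rule eigenvector[OF W W1 Su])
  have Ke': "K *v cnj_vec (e j) = complex_of_real (inverse (k j)) *s (cnj_mat K *v cnj_vec (e j))" for j
  proof -
    have "cnj_mat K *v cnj_vec (e j) = complex_of_real (k j) *s (K *v cnj_vec (e j))"
      using arg_cong[OF Ke[of j], of cnj_vec] by simp
    then show ?thesis using k[of j] by (simp add: vector_smult_assoc)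
  qed
  have inv: "matrix_inv (cnj_mat K) ** cnj_mat K = mat 1"
    using det_K by (intro matrix_inv_mult) (simp add: det_cnj_mat)
  have Kv: "K *v v i = l i *s (cnj_mat K *v v i)" for i
    by (cases i) (simp_all add: v_def l_def Ke Ke' del: cnj_vec_simps(7))
  have "(matrix_inv (cnj_mat K) ** K) *v v i = l i *s v i" for i
    by (simp add: matrix_vector_mul_assoc[symmetric] Kv matrix_smult) (simp add: matrix_vector_mul_assoc inv)
  moreover have "det (\<chi> i j. v j $ i) \<noteq> 0"
  proof -
    note row = Wm_inverse_apply[OF W]
    have Tl: "T *v e j = mkpt (S *v column j U) (- \<i> *s (b *v (S *v column j U)))" for j
    proof -
      have "B *v (S *v u) + cnj_mat H *v (t *v u) = b *v (S *v u)" for u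
        using row(2)[of u] by (simp add: matrix_vector_mult_diff_rdistrib algebra_simps)
      then show ?thesis by (simp only: e_def T_Theta)
    qed
    have Tr: "T *v cnj_vec (e j) = mkpt (cnj_mat (t ** U) *v axis j 1)
       (- \<i> *s (cnj_mat U *v axis j 1 + b *v (cnj_mat (t ** U) *v axis j 1)))" for j
    proof -
      let ?u = "column j U"
      have c: "cnj_mat X *v axis j 1 = cnj_vec (column j X)" for X :: "complex ^ 'n ^ 'n"
        by (simp add: matrix_axis column_def cnj_vec_def cnj_mat_def)
      have "H *v (S *v ?u) + cnj_mat B *v (t *v ?u) = ?u + cnj_mat b *v (t *v ?u)"
        using row(1)[of ?u] by (simp add: matrix_vector_mult_diff_rdistrib algebra_simps)
      from arg_cong[OF this, of cnj_vec]
      have "B *v cnj_vec (t *v ?u) + cnj_mat H *v cnj_vec (S *v ?u) = cnj_vec ?u + b *v cnj_vec (t *v ?u)"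
        by (simp only: cnj_vec_simps(2) cnj_vec_simps(7) cnj_mat_simps(1) add.commute)
      then show ?thesis unfolding e_def cnj_Theta T_Theta c colS by (simp only:)
    qed
    \<comment> \<open>Independence is visible after applying \<open>T\<close>: all
      \<open>T *v e j\<close> lie on the graph of - i b. Subtracting that graph leaves a block
      triangular matrix with diagonal blocks \<open>S ** U\<close> and - i times the conjugate of
      \<open>U\<close>.\<close>
    let ?L = "blk (mat 1) 0 (msc (- \<i>) b) (mat 1) ** blk (S ** U) (cnj_mat (t ** U)) 0 (msc (- \<i>) (cnj_mat U))"
    have "T ** (\<chi> i j. v j $ i) = ?L"
    proof -
      have "(T ** (\<chi> i j. v j $ i)) *v axis m 1 = ?L *v axis m 1" for m
      proof -
        have "(T ** (\<chi> i j. v j $ i)) *v axis m 1 = T *v v m"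
          unfolding matrix_axis by (simp add: column_def matrix_matrix_mult_def matrix_vector_mult_def)
        also have "\<dots> = ?L *v axis m 1"
        proof (cases m)
          case (Inl j)
          have "axis m 1 = (mkpt (axis j 1) 0 :: complex ^ ('n + 'n))"
            by (simp add: Inl axis_def vec_eq_iff split_sum_all)
          moreover have "S *v column j U = (S ** U) *v axis j 1"
            by (simp add: matrix_axis colS)
          ultimately show ?thesis
            by (simp add: Inl v_def Tl blk_mult blk_mult_mkpt msc_simps matrix_vector_mul_assoc)
        next
          case (Inr j)
          have "axis m 1 = (mkpt 0 (axis j 1) :: complex ^ ('n + 'n))"
            by (simp add: Inr axis_def vec_eq_iff split_sum_all)
          then show ?thesis
            by (simp add: Inr v_def Tr blk_mult blk_mult_mkpt msc_simps matrix_vector_mult_add_rdistrib matrix_vector_mul_assoc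
                del: cnj_vec_simps(7))
        qed
        finally show ?thesis .
      qed
      then show ?thesis
        unfolding matrix_axis by (simp add: column_def vec_eq_iff)
    qed
    from arg_cong[OF this, of det]
    have "det T * det (\<chi> i j. v j $ i) = det (S ** U) * det (msc (- \<i>) (cnj_mat U))"
      by (simp add: det_mul det_blk_lower det_blk_upper)
    moreover have "det (msc (- \<i>) (cnj_mat U)) \<noteq> 0"
    proof -
      have "det (cnj_mat U) \<noteq> 0" using U by (simp add: det_cnj_mat)
      then obtain U' where "cnj_mat U ** U' = mat 1" by (rule inverse_matrix_exists)
      then have "msc (- \<i>) (cnj_mat U) ** msc \<i> U' = mat 1" by (simp add: msc_simps)
      then show ?thesis using left_inverse_det by blast
    qed
    ultimately show ?thesis using U S by (auto simp: det_mul)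
  qed
  ultimately have "charpoly (matrix_inv (cnj_mat K) ** K) = (\<Prod>i\<in>UNIV. [:- l i, 1:])"
    by (rule charpoly_eigenbasis)
  then show ?thesis by (simp only: prod_UNIV_sum l_def sum.case prod.distrib)
qed

end

section \<open>Spectrum and norm of the evolution\<close>

context evolution_chart
begin

text \<open>\<open>\<mu> j\<close> is the inverse of an eigenvalue of \<open>S\<close> relative to
  \<open>S1\<close>. The constant in the bound is the quotient of the two Gaussian integrals after
  the optimal shift, which is why the Gaussian \<gamma> attains it.\<close>

lemma spectrum_and_extremal:
  obtains \<mu> :: "'n \<Rightarrow> real" and \<gamma> Z where
    "\<And>j. 0 < \<mu> j \<and> \<mu> j < 1"
    "charpoly (matrix_inv (cnj_mat K) ** K) =
      (\<Prod>j\<in>UNIV. [:- complex_of_real (\<mu> j), 1:] * [:- complex_of_real (inverse (\<mu> j)), 1:])"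
    "\<And>v. holo v \<Longrightarrow> weighted_norm_sq H1 B1 v
      \<le> ennreal (norm (det F) * (\<Prod>j\<in>UNIV. sqrt (\<mu> j))) * weighted_norm_sq H B v"
    "holo \<gamma>" "Z > 0" "weighted_norm_sq H B \<gamma> = ennreal Z"
    "weighted_norm_sq H1 B1 \<gamma> = ennreal (norm (det F) * (\<Prod>j\<in>UNIV. sqrt (\<mu> j)) * Z)"
proof -
  have H1: "hadj H1 = H1" using H1_posdef by (simp add: posdef_def)
  obtain b S S1 t where b: "transpose b = b" and pos: "\<And>x. x \<noteq> 0 \<Longrightarrow> rq H (B - b) x > 0"
    and W: "Wm H (B - b) ** Wm S t = mat 1" "Wm S t ** Wm H (B - b) = mat 1" and S: "hadj S = S"
    and W1: "Wm H1 (B1 - b) ** Wm S1 t = mat 1" and S1: "hadj S1 = S1" and t: "transpose t = t"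
    by (rule optimal_shift[OF H B H1 B1_sym rq_growth], assumption) (rule that)
  have tb: "transpose (B - b) = B - b" "transpose (B1 - b) = B1 - b"
    by (simp_all add: transpose_diff b B B1_sym)
  have growth: "rq H1 (B1 - b) x > rq H (B - b) x" if "x \<noteq> 0" for x
    using rq_growth[OF that] by (simp add: rq_diff)
  then have pos1: "rq H1 (B1 - b) x > 0" if "x \<noteq> 0" for x using pos[OF that] that by fastforce
  note cov = covariance_difference[OF H_herm(1) tb(1) pos growth W S W1 S1]
  obtain U :: "complex ^ 'n ^ 'n" and k where U: "det U \<noteq> 0" "hadj U ** S1 ** U = mat 1" "hadj U ** S ** U = diagm k"
    using hermitian_pencil[OF cov(1) S] by blast
  have k1: "k j > 1" for j
  proof -
    have "hadj U ** (S - S1) ** U = diagm k - mat 1"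
      by (simp add: matrix_diff_distrib U)
    moreover have "diagm k - mat 1 = diagm (\<lambda>j. k j - 1)"
      by (auto simp: diagm_def mat_def vec_eq_iff)
    ultimately have e: "hadj U ** (S - S1) ** U = diagm (\<lambda>j. k j - 1)" by simp
    have "U *v axis j 1 \<noteq> 0" using det_inj[OF U(1)] by (metis axis_eq_0_iff one_neq_zero)
    then have "0 < Re (hip (U *v axis j 1) ((S - S1) *v (U *v axis j 1)))" using cov(2) by (simp add: posdef_def)
    also have "\<dots> = k j - 1" by (simp only: hip_congruence e diagm_axis Re_complex_of_real)
    finally show ?thesis by simp
  qed
  have SU: "S ** U = S1 ** U ** diagm k"
  proof -
    have "hadj U ** (S1 ** U) = mat 1" using U(2) by (simp add: matrix_mul_assoc)
    then have "S1 ** U ** hadj U = mat 1" by (simp add: matrix_left_right_inverse)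
    then show ?thesis by (metis U(3) matrix_mul_assoc matrix_mul_lid)
  qed
  have dS: "det S = det S1 * complex_of_real (\<Prod>j\<in>UNIV. k j)" "det S1 \<noteq> 0"
  proof -
    show "det S1 \<noteq> 0" using posdef_det[OF cov(1)] .
    have "det S * det U = det S1 * det U * complex_of_real (\<Prod>j\<in>UNIV. k j)"
      using arg_cong[OF SU, of det] by (simp only: det_mul det_diagm)
    then show "det S = det S1 * complex_of_real (\<Prod>j\<in>UNIV. k j)" using U(1) by simp
  qed
  have kp: "(\<Prod>j\<in>UNIV. k j) > 0" using k1 by (intro prod_pos) (meson less_trans zero_less_one)
  define \<mu> where "\<mu> = (\<lambda>j. inverse (k j))"
  have mu: "0 < \<mu> j \<and> \<mu> j < 1" for j
    using k1[of j] by (simp add: \<mu>_def inverse_less_1_iff)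
  define c where "c = norm (det F) * (\<Prod>j\<in>UNIV. sqrt (\<mu> j))"
  have dFG: "norm (det F) * norm (det G) = 1"
    using arg_cong[OF FG, of det] by (simp add: det_mul norm_mult[symmetric])
  have dF: "norm (det F) > 0" using left_inverse_det[OF FG] by simp
  have c: "c > 0" unfolding c_def using dF mu by (intro mult_pos_pos prod_pos) auto
  obtain Z d where Z: "Z > 0" "d > 0" "(\<integral>\<^sup>+x. ennreal (exp (- rq H (B - b) x)) \<partial>lborel) = ennreal Z"
    "det (Wm H (B - b)) = complex_of_real d" "Z\<^sup>2 * d = (gauss_const TYPE('n))\<^sup>2"
    using gaussian_integral[OF H_herm(1) tb(1) pos] by metis
  obtain Z1 d1 where Z1: "Z1 > 0" "d1 > 0" "(\<integral>\<^sup>+x. ennreal (exp (- rq H1 (B1 - b) x)) \<partial>lborel) = ennreal Z1"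
    "det (Wm H1 (B1 - b)) = complex_of_real d1" "Z1\<^sup>2 * d1 = (gauss_const TYPE('n))\<^sup>2"
    using gaussian_integral[OF H1 tb(2) pos1] by metis
  \<comment> \<open>The squared quotient of the integrals is \<open>d / d1\<close>. By
    \<open>det_Wm_inverse\<close> these determinants are expressed by those of \<open>H\<close>,
    \<open>H1\<close>, \<open>S\<close> and \<open>S1\<close>, and the quotient becomes |det F|^2
    times the product of the \<open>\<mu> j\<close>.\<close>
  have "Z1 = c * Z"
  proof -
    have 1: "d * norm (det S) = norm (det H)"
      using arg_cong[OF det_Wm_inverse[OF W(1)], of norm] Z(2) by (simp add: Z(4) norm_mult)
    have 2: "d1 * norm (det S1) = norm (det H1)"
      using arg_cong[OF det_Wm_inverse[OF W1], of norm] Z1(2) by (simp add: Z1(4) norm_mult)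
    have 3: "norm (det H1) = (norm (det G))\<^sup>2 * norm (det H)"
      by (simp add: H1_def det_mul det_hadj norm_mult power2_eq_square)
    have 4: "norm (det S) = norm (det S1) * (\<Prod>j\<in>UNIV. k j)"
      using kp by (simp add: dS(1) norm_mult del: of_real_prod)
    have "(d1 * norm (det S1)) = (norm (det G))\<^sup>2 * (d * (norm (det S1) * (\<Prod>j\<in>UNIV. k j)))"
      using 1 2 3 4 by simp
    then have "d1 * norm (det S1) = ((norm (det G))\<^sup>2 * d * (\<Prod>j\<in>UNIV. k j)) * norm (det S1)"
      by (simp add: mult_ac)
    then have d1: "d1 = (norm (det G))\<^sup>2 * d * (\<Prod>j\<in>UNIV. k j)" using dS(2) by simp
    have csq: "c\<^sup>2 = (norm (det F))\<^sup>2 * inverse (\<Prod>j\<in>UNIV. k j)"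
    proof -
      have "(sqrt (\<mu> j))\<^sup>2 = inverse (k j)" for j using mu[of j] by (simp add: \<mu>_def less_imp_le)
      then have "(\<Prod>j\<in>UNIV. sqrt (\<mu> j))\<^sup>2 = inverse (\<Prod>j\<in>UNIV. k j)"
        unfolding prod_power_distrib prod_inversef[symmetric] o_def by simp
      then show ?thesis by (simp add: c_def power_mult_distrib)
    qed
    have "c\<^sup>2 * d1 = (norm (det F) * norm (det G))\<^sup>2 * d * (inverse (\<Prod>j\<in>UNIV. k j) * (\<Prod>j\<in>UNIV. k j))"
      by (simp only: csq d1 power_mult_distrib mult_ac)
    also have "inverse (\<Prod>j\<in>UNIV. k j) * (\<Prod>j\<in>UNIV. k j) = 1"
      using kp by (metis left_inverse less_irrefl)
    also have "(norm (det F) * norm (det G))\<^sup>2 * d * 1 = d" by (simp add: dFG)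
    finally have cd: "c\<^sup>2 * d1 = d" .
    have "Z1\<^sup>2 * d1 = (c * Z)\<^sup>2 * d1"
      using Z(5) Z1(5) unfolding cd[symmetric] by (simp add: power_mult_distrib mult_ac)
    then have "Z1\<^sup>2 = (c * Z)\<^sup>2" using Z1(2) by simp
    then show ?thesis using Z(1) Z1(1) c by (simp add: power2_eq_iff_nonneg)
  qed
  \<comment> \<open>Dividing \<open>v\<close> by exp(x . b x / 2) keeps it holomorphic and removes
    the same pluriharmonic form from either weight.\<close>
  have conj: "ennreal ((norm (v x))\<^sup>2) * ennreal (exp (- rq H' B' x))
      = ennreal ((norm (v x * exp (- (1 / 2) * cdot x (b *v x))))\<^sup>2) * ennreal (exp (- rq H' (B' - b) x))" for v x H' B'
  proof -
    have "exp (- Re (cdot x (b *v x))) * exp (- rq H' (B' - b) x) = exp (- rq H' B' x)"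
      by (simp add: rq_diff exp_add[symmetric]) (simp add: rq_def hip_simps)
    then have "(norm (v x * exp (- (1 / 2) * cdot x (b *v x))))\<^sup>2 * exp (- rq H' (B' - b) x) = (norm (v x))\<^sup>2 * exp (- rq H' B' x)"
      unfolding norm_mult power_mult_distrib norm_gaussian_sq by (simp only: mult.assoc)
    then show ?thesis by (simp add: ennreal_mult'[symmetric] del: mult_minus_left)
  qed
  \<comment> \<open>\<open>S - S1\<close> is the covariance of the rotation invariant Gaussian in
    \<open>gaussian_domination\<close>; its inverse is the matrix in the exponent.\<close>
  obtain E where E: "(S - S1) ** E = mat 1" "E ** (S - S1) = mat 1"
    by (rule inverse_matrix_exists[OF posdef_det[OF cov(2)]])
  have Ep: "posdef E"
    unfolding posdef_def
  proof (intro conjI allI impI)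
    have D: "hadj (S - S1) = S - S1" using cov(2) by (simp add: posdef_def)
    have "hadj E ** (S - S1) = mat 1"
      using arg_cong[OF E(1), of hadj] by (simp add: hadj_mult D hadj_one)
    then show "hadj E = E" by (metis E(1) matrix_mul_assoc matrix_mul_lid matrix_mul_rid)
    fix x :: "complex ^ 'n" assume "x \<noteq> 0"
    then have "E *v x \<noteq> 0" using det_inj left_inverse_det[OF E(2)] by blast
    then have "Re (hip (E *v x) ((S - S1) *v (E *v x))) > 0" using cov(2) by (simp add: posdef_def)
    moreover have "hip (E *v x) ((S - S1) *v (E *v x)) = cnj (hip x (E *v x))"
      by (simp add: matrix_vector_mul_assoc E cnj_hip)
    ultimately show "Re (hip x (E *v x)) > 0" by simp
  qed
  have bound: "weighted_norm_sq H1 B1 v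
      \<le> ennreal c * weighted_norm_sq H B v" if v: "holo v" for v
  proof -
    let ?J1 = "\<integral>\<^sup>+x. ennreal ((norm (v x))\<^sup>2) * ennreal (exp (- rq H1 B1 x)) \<partial>lborel"
    let ?J = "\<integral>\<^sup>+x. ennreal ((norm (v x))\<^sup>2) * ennreal (exp (- rq H B x)) \<partial>lborel"
    have "holo (\<lambda>x. v x * exp (- (1 / 2) * cdot x (b *v x)))" by (intro holo_mult v holo_gaussian)
    from gaussian_domination[OF H1 tb(2) Ep E(2) cov(3) this]
    have "?J1 * ennreal Z \<le> ?J * ennreal Z1"
      unfolding conj[symmetric] Z(3) Z1(3) .
    also have "?J * ennreal Z1 = ennreal c * ?J * ennreal Z"
      using c Z(1) by (simp add: \<open>Z1 = c * Z\<close> ennreal_mult mult_ac)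
    finally have "?J1 * ennreal Z / ennreal Z \<le> ennreal c * ?J * ennreal Z / ennreal Z" by (rule divide_right_mono_ennreal)
    then show ?thesis using Z(1) by (simp add: mult_divide_eq_ennreal)
  qed
  have extremal: "ennreal ((norm (exp (1 / 2 * cdot x (b *v x))))\<^sup>2) * ennreal (exp (- rq H' B' x))
      = ennreal (exp (- rq H' (B' - b) x))" for x H' B'
  proof -
    have "norm (exp (1 / 2 * cdot x (b *v x)) * exp (- (1 / 2) * cdot x (b *v x))) = 1"
      by (simp add: exp_add[symmetric])
    then show ?thesis
      by (subst conj[of "\<lambda>x. exp (1 / 2 * cdot x (b *v x))"]) (simp only: power_one ennreal_1 mult_1)
  qed
  show ?thesis
  proof (rule that[of \<mu> "\<lambda>x. exp (1 / 2 * cdot x (b *v x))" Z])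
    show "charpoly (matrix_inv (cnj_mat K) ** K) =
      (\<Prod>j\<in>UNIV. [:- complex_of_real (\<mu> j), 1:] * [:- complex_of_real (inverse (\<mu> j)), 1:])"
    proof -
      have kn: "k j \<noteq> 0" for j using k1[of j] by auto
      then have "det S \<noteq> 0" using dS by simp
      from charpoly_K[OF W(1) W1 U(1) SU this kn] show ?thesis
        by (simp only: \<mu>_def inverse_inverse_eq mult.commute)
    qed
    show "(\<integral>\<^sup>+x. ennreal ((norm (exp (1 / 2 * cdot x (b *v x))))\<^sup>2) * ennreal (exp (- rq H B x)) \<partial>lborel) = ennreal Z"
      unfolding extremal by (simp add: Z(3))
    show "(\<integral>\<^sup>+x. ennreal ((norm (exp (1 / 2 * cdot x (b *v x))))\<^sup>2) * ennreal (exp (- rq H1 B1 x)) \<partial>lborel)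
        = ennreal (norm (det F) * (\<Prod>j\<in>UNIV. sqrt (\<mu> j)) * Z)"
      unfolding extremal by (simp add: Z1(3) \<open>Z1 = c * Z\<close> c_def)
    show "holo (\<lambda>x. exp (1 / 2 * cdot x (b *v x)))" by (rule holo_gaussian)
  qed (rule mu bound[unfolded c_def] Z(1); assumption?)+
qed

end

section \<open>From the weighted integrals back to the operator norm\<close>

lemma HPhi_nn_integral:
  assumes Phi: "\<And>x. 2 * \<Phi> x = rq H B x" and v: "holo v"
  defines "I \<equiv> \<integral>\<^sup>+x. ennreal ((norm (v x))\<^sup>2) * ennreal (exp (- rq H B x)) \<partial>lborel"
  shows "v \<in> HPhi \<Phi> \<longleftrightarrow> I < \<infinity>" "HPhinorm \<Phi> v = sqrt (enn2real I)"
proof -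
  note [measurable] = holo_measurable[OF v]
  have e: "- 2 * \<Phi> x = - rq H B x" for x
    using Phi[of x] by simp
  have m: "(\<lambda>x. (norm (v x))\<^sup>2 * exp (- rq H B x)) \<in> borel_measurable lborel" by measurable
  have I: "I = (\<integral>\<^sup>+x. ennreal ((norm (v x))\<^sup>2 * exp (- rq H B x)) \<partial>lborel)"
    unfolding I_def by (simp add: ennreal_mult')
  show "v \<in> HPhi \<Phi> \<longleftrightarrow> I < \<infinity>"
    unfolding HPhi_def e I using m by (simp add: v integrable_iff_bounded)
  show "HPhinorm \<Phi> v = sqrt (enn2real I)"
    unfolding HPhinorm_def e I by (subst integral_eq_nn_integral[OF m]) auto
qed

text \<open>The prefactor of the evolution has squared modulus |det F|, the determinant of an
  exponential being the exponential of the trace. The substitution of G x for x contributes |det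
  G|^2, and det F det G = 1 leaves |det G|.\<close>

lemma (in evolution_chart) model_evolution_nn_integral:
  assumes F: "F = mexp (\<chi> i j. - \<i> * M $ i $ j)" and v: "holo v"
  shows "weighted_norm_sq H B (model_evol M v)
    = ennreal (norm (det G)) * weighted_norm_sq H1 B1 v"
proof -
  note [measurable] = holo_measurable[OF v] holo_measurable[OF holo_compose_matrix[OF v]]
  let ?e = "exp (- \<i> / 2 * trace M)"
  have G: "det G \<noteq> 0" using left_inverse_det[OF FG] by simp
  have mev: "(norm (model_evol M v x))\<^sup>2 = norm (det F) * (norm (v (F *v x)))\<^sup>2" for x
  proof -
    have "trace (\<chi> i j. - \<i> * M $ i $ j) = - \<i> * trace M"
      by (simp add: trace_def sum_distrib_left sum_negf)
    then have "det F = ?e * ?e" unfolding F det_mexp by (simp add: exp_add[symmetric])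
    moreover have "model_evol M v x = ?e * v (F *v x)" by (simp only: model_evol_def F)
    ultimately show ?thesis by (simp only: norm_mult power2_eq_square mult_ac)
  qed
  have "weighted_norm_sq H B (model_evol M v)
      = (\<integral>\<^sup>+x. ennreal (norm (det F)) * (ennreal ((norm (v (F *v x)))\<^sup>2) * ennreal (exp (- rq H B x))) \<partial>lborel)"
    by (simp add: mev ennreal_mult' mult.assoc)
  also have "\<dots> = ennreal (norm (det F)) * (\<integral>\<^sup>+x. ennreal ((norm (v (F *v x)))\<^sup>2) * ennreal (exp (- rq H B x)) \<partial>lborel)"
    by (rule nn_integral_cmult) measurable
  also have "(\<integral>\<^sup>+x. ennreal ((norm (v (F *v x)))\<^sup>2) * ennreal (exp (- rq H B x)) \<partial>lborel)
      = ennreal ((norm (det G))\<^sup>2) * (\<integral>\<^sup>+x. ennreal ((norm (v (F *v (G *v x))))\<^sup>2) * ennreal (exp (- rq H B (G *v x))) \<partial>lborel)"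
    by (rule nn_integral_complex_linear[OF G, where f = "\<lambda>x. ennreal ((norm (v (F *v x)))\<^sup>2) * ennreal (exp (- rq H B x))"]) measurable
  also have "(\<integral>\<^sup>+x. ennreal ((norm (v (F *v (G *v x))))\<^sup>2) * ennreal (exp (- rq H B (G *v x))) \<partial>lborel)
      = weighted_norm_sq H1 B1 v"
    by (simp add: matrix_vector_mul_assoc FG rq_congruence H1_def B1_def)
  finally have "weighted_norm_sq H B (model_evol M v)
      = ennreal (norm (det F) * (norm (det G))\<^sup>2) * weighted_norm_sq H1 B1 v"
    by (simp add: ennreal_mult mult.assoc)
  also have "norm (det F) * (norm (det G))\<^sup>2 = norm (det G)"
    using arg_cong[OF FG, of "\<lambda>X. norm (det X)"] by (simp add: det_mul norm_mult power2_eq_square mult.assoc[symmetric])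
  finally show ?thesis .
qed

theorem theorem1p3:
  fixes A :: "('n::finite) pmat"          \<comment> \<open>q(z) = qform A z, A symmetric\<close>
    and P :: "'n pmat"                    \<comment> \<open>phase of the FBI transform\<close>
    and c :: complex                      \<comment> \<open>normalising constant of the FBI transform\<close>
    and T :: "'n pmat"
    and M :: "complex ^ 'n ^ 'n"
  assumes q_sym: "symmetric_mat A"
    and K_pos: "strictly_positive (mexp (hamilton_map A))"
    and phase: "fbi_phase P"
    and T_canon: "fbi_canon P T"
    and unitary_into: "\<forall>u\<in>L2. fbi c P u \<in> HPhi (fbi_weight P) \<and>
                          HPhinorm (fbi_weight P) (fbi c P u) = L2norm u"
    and unitary_onto: "\<forall>v\<in>HPhi (fbi_weight P). \<exists>u\<in>L2. fbi c P u = v"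
    and conj_q: "\<forall>z. qform A (matrix_inv T *v z) = \<i> * cdot (M *v xpart z) (xipart z)"
  shows "\<exists>\<mu> :: 'n \<Rightarrow> real.
           (\<forall>j. 0 < \<mu> j \<and> \<mu> j < 1) \<and>
           charpoly (matrix_inv (cnj_mat (mexp (hamilton_map A))) ** mexp (hamilton_map A)) =
             (\<Prod>j\<in>UNIV. [: - complex_of_real (\<mu> j), 1 :] * [: - complex_of_real (inverse (\<mu> j)), 1 :]) \<and>
           evol_dom c P M = L2 \<and>
           has_L2_opnorm (evol c P M) (\<Prod>j\<in>UNIV. \<mu> j powr (1/4))"
proof -
  obtain H B :: "complex ^ 'n ^ 'n" and \<Theta> where H: "posdef H" "transpose B = B" and Phi: "\<And>x. 2 * fbi_weight P x = rq H B x"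
    and \<Theta>: "\<And>x y. T *v \<Theta> x y = mkpt x (- \<i> *s (B *v x + cnj_mat H *v y))"
    "\<And>x y. cnj_vec (\<Theta> x y) = \<Theta> (cnj_vec y) (cnj_vec x)"
    "\<And>x y x' y'. symp (\<Theta> x y) (\<Theta> x' y') = \<i> * (cdot x (cnj_mat H *v y') - cdot x' (cnj_mat H *v y))"
    using fbi_geometry[OF phase T_canon] by blast
  interpret graph_chart H B T \<Theta> by unfold_locales (rule H \<Theta>)+
  define F where "F = mexp (\<chi> i j. - \<i> * M $ i $ j)"
  define G where "G = mexp (msc \<i> M)"
  have Fm: "F = mexp (- msc \<i> M)" by (simp add: F_def msc_def vec_eq_iff) (simp add: uminus_vec_def)
  interpret evolution_chart H B T \<Theta> "mexp (hamilton_map A)" F G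
  proof unfold_locales
    show "F ** G = mat 1"
      using mexp_minus[of "msc \<i> M"] unfolding Fm G_def by (simp add: matrix_left_right_inverse)
    \<comment> \<open>\<open>T\<close> intertwines the Hamilton map with a block diagonal generator,
      hence also the exponentials; the lower block exponentiates to
      \<open>transpose F\<close>.\<close>
    have "T ** mexp (hamilton_map A) = mexp (blk (msc \<i> M) 0 0 (- transpose (msc \<i> M))) ** T"
      using conj_q by (intro mexp_intertwine T_conj_Hamilton[OF q_sym]) simp
    moreover have "- transpose (msc \<i> M) = transpose (- msc \<i> M)" by (simp add: transpose_def vec_eq_iff)
    ultimately show "T ** mexp (hamilton_map A) = blk G 0 0 (transpose F) ** T"
      by (simp add: mexp_blk mexp_transpose G_def Fm)
  qed (rule K_pos)
  obtain \<mu> :: "'n \<Rightarrow> real" and \<gamma> Z where \<mu>: "\<And>j. 0 < \<mu> j \<and> \<mu> j < 1"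
    and cp: "charpoly (matrix_inv (cnj_mat (mexp (hamilton_map A))) ** mexp (hamilton_map A)) =
      (\<Prod>j\<in>UNIV. [:- complex_of_real (\<mu> j), 1:] * [:- complex_of_real (inverse (\<mu> j)), 1:])"
    and bound: "\<And>v. holo v \<Longrightarrow> weighted_norm_sq H1 B1 v
      \<le> ennreal (norm (det F) * (\<Prod>j\<in>UNIV. sqrt (\<mu> j))) * weighted_norm_sq H B v"
    and \<gamma>: "holo \<gamma>" "Z > 0" "weighted_norm_sq H B \<gamma> = ennreal Z"
    "weighted_norm_sq H1 B1 \<gamma> = ennreal (norm (det F) * (\<Prod>j\<in>UNIV. sqrt (\<mu> j)) * Z)"
    using spectrum_and_extremal by blast
  let ?\<Phi> = "fbi_weight P"
  let ?I = "\<lambda>v. \<integral>\<^sup>+x. ennreal ((norm (v x))\<^sup>2) * ennreal (exp (- rq H B x)) \<partial>lborel"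
  \<comment> \<open>The bound on squared norms is the product of the \<open>sqrt (\<mu> j)\<close>,
    once |det F| and |det G| have cancelled; \<open>C\<close> is its square root.\<close>
  define C where "C = (\<Prod>j\<in>UNIV. \<mu> j powr (1/4))"
  have C0: "C > 0" unfolding C_def using \<mu> by (intro prod_pos) (metis powr_gt_zero less_irrefl)
  have C2: "C\<^sup>2 = (\<Prod>j\<in>UNIV. sqrt (\<mu> j))"
  proof -
    have "(\<mu> j powr (1/4))\<^sup>2 = sqrt (\<mu> j)" for j
      using \<mu>[of j] by (simp add: power2_eq_square powr_add[symmetric] powr_half_sqrt)
    then show ?thesis by (simp add: C_def prod_power_distrib)
  qed
  have dGF: "norm (det G) * (norm (det F) * r) = r" for r :: real
    using arg_cong[OF FG, of "\<lambda>X. norm (det X)"] by (simp add: det_mul norm_mult mult.assoc[symmetric] mult.commute[of "norm (det G)"])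
  have up: "?I (model_evol M v) \<le> ennreal (C\<^sup>2) * ?I v" if v: "holo v" for v
  proof -
    have "?I (model_evol M v) \<le> ennreal (norm (det G)) * (ennreal (norm (det F) * (\<Prod>j\<in>UNIV. sqrt (\<mu> j))) * ?I v)"
      unfolding model_evolution_nn_integral[OF F_def v] by (intro mult_left_mono bound v) simp
    also have "\<dots> = ennreal (C\<^sup>2) * ?I v"
      by (simp add: mult.assoc[symmetric] ennreal_mult'[symmetric] C2) (simp add: mult.assoc dGF)
    finally show ?thesis .
  qed
  have eq: "?I (model_evol M \<gamma>) = ennreal (C\<^sup>2 * Z)"
    unfolding model_evolution_nn_integral[OF F_def \<gamma>(1)] \<gamma>(4)
    by (simp add: ennreal_mult'[symmetric] C2) (simp add: mult.assoc dGF)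
  have hm: "holo (model_evol M v)" if "holo v" for v
    unfolding model_evol_def by (intro holo_mult holo_const holo_compose_matrix that)
  have evolve: "model_evol M v \<in> HPhi ?\<Phi>" "HPhinorm ?\<Phi> (model_evol M v) \<le> C * HPhinorm ?\<Phi> v" if v: "v \<in> HPhi ?\<Phi>" for v
  proof -
    have hv: "holo v" using v by (simp add: HPhi_def)
    have fin: "?I v < \<infinity>" using HPhi_nn_integral(1)[OF Phi hv] v by simp
    then have "ennreal (C\<^sup>2) * ?I v < \<infinity>" by (simp add: ennreal_mult_less_top)
    with up[OF hv] have "?I (model_evol M v) < \<infinity>" by (rule le_less_trans)
    then show "model_evol M v \<in> HPhi ?\<Phi>" using HPhi_nn_integral(1)[OF Phi hm[OF hv]] by simp
    have "enn2real (?I (model_evol M v)) \<le> enn2real (ennreal (C\<^sup>2) * ?I v)"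
      using up[OF hv] fin by (intro enn2real_mono) (auto simp: ennreal_mult_less_top)
    also have "\<dots> = C\<^sup>2 * enn2real (?I v)" by (simp add: enn2real_mult)
    finally have "sqrt (enn2real (?I (model_evol M v))) \<le> sqrt (C\<^sup>2 * enn2real (?I v))" by simp
    then show "HPhinorm ?\<Phi> (model_evol M v) \<le> C * HPhinorm ?\<Phi> v"
      unfolding HPhi_nn_integral(2)[OF Phi hv] HPhi_nn_integral(2)[OF Phi hm[OF hv]] using C0 by (simp add: real_sqrt_mult)
  qed
  \<comment> \<open>\<open>evol\<close> selects some preimage under the transform. By isometry every
    possible choice has the same norm, so ambiguity on null sets is harmless.\<close>
  have ev: "L2norm (evol c P M u) = HPhinorm ?\<Phi> (model_evol M (fbi c P u))" if u: "u \<in> L2" for u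
  proof -
    have "\<exists>w\<in>L2. fbi c P w = model_evol M (fbi c P u)"
      using unitary_onto unitary_into evolve(1) u by blast
    then have "evol c P M u \<in> L2 \<and> fbi c P (evol c P M u) = model_evol M (fbi c P u)"
      unfolding evol_def by (metis (mono_tags, lifting) someI_ex)
    then show ?thesis using unitary_into by metis
  qed
  have "evol_dom c P M = L2"
    unfolding evol_dom_def using evolve(1) unitary_into by blast
  moreover have "has_L2_opnorm (evol c P M) C"
    unfolding has_L2_opnorm_def
  proof (intro conjI ballI allI impI)
    fix u :: "real ^ 'n \<Rightarrow> complex" assume "u \<in> L2"
    then show "L2norm (evol c P M u) \<le> C * L2norm u" using ev evolve(2) unitary_into by metis
  next
    fix C' assume C': "C' < C"
    \<comment> \<open>The norm is attained: the preimage of \<gamma> gives equality with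
      \<open>C\<close>, and \<open>sqrt Z > 0\<close> makes the inequality strict for each smaller
      \<open>C'\<close>.\<close>
    have "\<gamma> \<in> HPhi ?\<Phi>" using HPhi_nn_integral(1)[OF Phi \<gamma>(1)] \<gamma>(3) by simp
    then obtain u where u: "u \<in> L2" "fbi c P u = \<gamma>" using unitary_onto by blast
    have n1: "L2norm u = sqrt Z"
      using unitary_into u HPhi_nn_integral(2)[OF Phi \<gamma>(1)] \<gamma>(2,3) by (metis enn2real_ennreal less_imp_le)
    have "L2norm (evol c P M u) = sqrt (C\<^sup>2 * Z)"
      unfolding ev[OF u(1)] u(2) HPhi_nn_integral(2)[OF Phi hm[OF \<gamma>(1)]] eq using \<gamma>(2) by (simp add: less_imp_le)
    also have "\<dots> = C * sqrt Z" using C0 by (simp add: real_sqrt_mult)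
    finally have "L2norm (evol c P M u) > C' * L2norm u" using C' \<gamma>(2) by (simp add: n1)
    then show "\<exists>u\<in>L2. C' * L2norm u < L2norm (evol c P M u)" using u(1) by blast
  qed
  ultimately show ?thesis using \<mu> cp unfolding C_def by blast
qed

end
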